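(* For every superpartition $\Lambda$ of bidegree $(n,m)$, the Schur function in noncommuting variables in superspace $$S_\Lambda=\sum_{T\in sSSYT(\Lambda)}\theta_{c(T^a_1)}\cdots\theta_{c(T^a_m)}\sum_{\sigma\in\mathfrak S_n}x_{c(T^s_{\sigma(1)})}\cdots x_{c(T^s_{\sigma(n)})}$$ is symmetric, i.e. invariant under every finite permutation acting simultaneously on the indices of the $x$- and $\theta$-variables.
   Context: Functions. $S_\Lambda$ lives in the $\mathbb Q$-algebra of formal power series of bounded degree in variables $x_1,x_2,\dots$ and $\theta_1,\theta_2,\dots$ subject only to $x_i\theta_j=\theta_jx_i$ and $\theta_i\theta_j=-\theta_j\theta_i$ for all $i,j$ (so $\theta_i^2=0$; the $x_i$ do not commute with each other). A permutation $s\in\mathfrak S_N$ acts by $x_i\mapsto x_{s(i)}$, $\theta_i\mapsto\theta_{s(i)}$ (with $s(i)=i$ for $i>N$). Superpartitions. A superpartition of bidegree $(n,m)$ (degree $n$, fermionic degree $m$) is $\Lambda=(\Lambda_1,\dots,\Lambda_m;\Lambda_{m+1},\dots,\Lambda_k)$ of nonnegative integers with sum $n$, with $\Lambda_1>\dots>\Lambda_m\ge0$ and $\Lambda_{m+1}\ge\dots\ge\Lambda_k\ge1$. Let $\Lambda^+$ be the decreasing rearrangement of $(\Lambda_1,\dots,\Lambda_k)$ and $\Lambda^\oplus$ that of $(\Lambda_1+1,\dots,\Lambda_m+1,\Lambda_{m+1},\dots,\Lambda_k)$. $\Lambda$ is identified with the pair $(\Lambda^\oplus,\Lambda^+)$ and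 drawn as the Young diagram of $\Lambda^\oplus$ in which the cells of $\Lambda^\oplus/\Lambda^+$ are circles (at most one per row and per column, at the end of its row) and the cells of $\Lambda^+$ are boxes. Circles are numbered consistently from top to bottom. $\mathrm{df}(\Lambda)=m$ is the number of circles. A skew diagram is a horizontal $r$-strip if it has $r$ cells, at most one in each column. Tableaux. Let $\bar{\mathbb N}_0=\{\bar0,\bar1,\bar2,\dots\}$ and $|a|=|\bar a|=a$. A super semistandard Young tableau of shape $\Lambda$ and weight $(\alpha_1,\dots,\alpha_r)$, $\alpha_i\in\mathbb N_0\cup\bar{\mathbb N}_0$, is a sequence of superpartitions $(\Lambda_{(0)},\dots,\Lambda_{(r)})$ with $\Lambda_{(0)}=\emptyset$, $\Lambda_{(r)}=\Lambda$ such that for each $i\in\{1,\dots,r\}$: (1) $\Lambda_{(i)}^+/\Lambda_{(i-1)}^+$ is a horizontal $|\alpha_i|$-strip. (2) If $\alpha_i\in\mathbb N_0$: $\mathrm{df}(\Lambda_{(i)})=\mathrm{df}(\Lambda_{(i-1)})$, and whenever the $j$th circle of $\Lambda_{(i-1)}$ is in row $t$, the $j$th circle of $\Lambda_{(i)}$ is in row $t$ if row $t$ of $\Lambda_{(i)}^+/\Lambda_{(i-1)}^+$ is empty, and in row $t+1$ if that row is nonempty. (3) If $\alpha_i\in\bar{\mathbb N}_0$: $\mathrm{df}(\Lambda_{(i)})=\mathrm{df}(\Lambda_{(i-1)})+1$; $\Lambda_{(i)}$ contains a unique circle (the new circle), say in column $c$, such that column $c$ of $\Lambda_{(i)}^+/\Lambda_{(i-1)}^+$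 is empty and every column to the left of $c$ is nonempty in $\Lambda_{(i)}^+/\Lambda_{(i-1)}^+$; and the diagram obtained from $\Lambda_{(i)}$ by removing the new circle satisfies the conditions in (2) relative to $\Lambda_{(i-1)}$. Such a tableau $T$ is represented by filling the diagram of $\Lambda$: the boxes of $\Lambda^+_{(i)}/\Lambda^+_{(i-1)}$ get label $i$, and if $\alpha_i\in\bar{\mathbb N}_0$ the circle created at step $i$ (followed to its final position in $\Lambda$) gets label $i$. Tableaux giving the same filling (i.e. differing only by trailing weights $0$) are identified; $sSSYT(\Lambda)$ is the set of all these fillings of shape $\Lambda$, of all weights (steps with $\alpha_i=0$ are allowed, so labels may be any positive integers). $T^s_1,\dots,T^s_n$ are the boxes of $T$ in a fixed reading order, $T^a_1,\dots,T^a_m$ its circles from top to bottom, and $c(t)$ is the label of $t$. *)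

theory Defs
  imports Complex_Main "HOL-Combinatorics.Permutations" "HOL-Combinatorics.Perm"
begin

text \<open>Everything is indexed from 0: the index \<open>i :: nat\<close> of a variable, a label, a row, a column or a
  tableau step stands for \<open>i + 1\<close> in the usual notation. In particular finite permutations of the positive
  integers (the union of all symmetric groups) become the type \<open>nat perm\<close>.\<close>

section \<open>Power series in noncommuting variables x and anticommuting variables theta\<close>

text \<open>A basis of the monomials is given by \<open>x\<^sub>w \<theta>\<^sub>I\<close> with \<open>x\<^sub>w = x\<^bsub>w ! 0\<^esub> x\<^bsub>w ! 1\<^esub> \<dots>\<close> for a word \<open>w\<close>,
  and \<open>\<theta>\<^sub>I = \<theta>\<^bsub>i1\<^esub> \<dots> \<theta>\<^bsub>im\<^esub>\<close> for a finite set \<open>I = {i1 < \<dots> < im}\<close>. A series of bounded degree is its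
  family of coefficients.\<close>

definition bounded_series :: "(nat list \<Rightarrow> nat set \<Rightarrow> rat) \<Rightarrow> bool" where
  "bounded_series f \<longleftrightarrow> (\<exists>d. \<forall>w I. f w I \<noteq> 0 \<longrightarrow> finite I \<and> length w + card I \<le> d)"

typedef superseries = "{f. bounded_series f}" morphisms coeff Superseries
  by (rule exI[of _ "\<lambda>_ _. 0"]) (simp add: bounded_series_def)

setup_lifting type_definition_superseries

lemma superseries_eqI: "(\<And>w I. coeff f w I = coeff g w I) \<Longrightarrow> f = g"
  by (metis coeff_inject ext)

lemma bounded_coeff: "bounded_series (coeff f)"
  using coeff by simp

lemma coeff_infinite: "infinite I \<Longrightarrow> coeff f w I = 0"
  using bounded_coeff[of f] unfolding bounded_series_def by blast

text \<open>For disjoint \<open>J\<close>, \<open>K\<close>: \<open>\<theta>\<^sub>J \<theta>\<^sub>K = cross_sign J K \<theta>\<^bsub>J \<union> K\<^esub>\<close>.\<close>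

definition cross_sign :: "nat set \<Rightarrow> nat set \<Rightarrow> rat" where
  "cross_sign J K = (\<Prod>j\<in>J. \<Prod>k\<in>K. if k < j then - 1 else 1)"

definition splits :: "nat list \<Rightarrow> nat set \<Rightarrow> ((nat list \<times> nat list) \<times> (nat set \<times> nat set)) set" where
  "splits w I = {(u, v). u @ v = w} \<times> {(J, K). J \<union> K = I \<and> J \<inter> K = {}}"

lemma finite_splits: "finite I \<Longrightarrow> finite (splits w I)"
proof -
  assume "finite I"
  have "{(u, v). u @ v = w} \<subseteq> (\<lambda>k. (take k w, drop k w)) ` {..length w}"
  proof
    fix p assume "p \<in> {(u, v). u @ v = w}"
    then obtain u v where "p = (u, v)" "u @ v = w" by auto
    then show "p \<in> (\<lambda>k. (take k w, drop k w)) ` {..length w}"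
      by (intro image_eqI[of _ _ "length u"]) auto
  qed
  moreover have "{(J, K). J \<union> K = I \<and> J \<inter> K = {}} \<subseteq> Pow I \<times> Pow I" by auto
  ultimately show ?thesis
    unfolding splits_def using \<open>finite I\<close>
    by (meson finite_SigmaI finite_Pow_iff finite_atMost finite_imageI finite_subset)
qed

instantiation superseries :: "{zero, one, plus, minus, uminus, times}"
begin

lift_definition zero_superseries :: superseries is "\<lambda>_ _. 0"
  by (simp add: bounded_series_def)

lift_definition one_superseries :: superseries is "\<lambda>w I. if w = [] \<and> I = {} then 1 else 0"
  by (simp add: bounded_series_def)

lift_definition plus_superseries :: "superseries \<Rightarrow> superseries \<Rightarrow> superseries"
  is "\<lambda>f g w I. f w I + g w I"
proof -
  fix f g :: "nat list \<Rightarrow> nat set \<Rightarrow> rat"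
  assume "bounded_series f" "bounded_series g"
  then obtain d e where
    "\<forall>w I. f w I \<noteq> 0 \<longrightarrow> finite I \<and> length w + card I \<le> d"
    "\<forall>w I. g w I \<noteq> 0 \<longrightarrow> finite I \<and> length w + card I \<le> e"
    unfolding bounded_series_def by blast
  then have "\<forall>w I. f w I + g w I \<noteq> 0 \<longrightarrow> finite I \<and> length w + card I \<le> max d e"
    by (metis add.right_neutral le_max_iff_disj)
  then show "bounded_series (\<lambda>w I. f w I + g w I)"
    unfolding bounded_series_def by blast
qed

lift_definition uminus_superseries :: "superseries \<Rightarrow> superseries" is "\<lambda>f w I. - f w I"
  by (simp add: bounded_series_def)

definition minus_superseries :: "superseries \<Rightarrow> superseries \<Rightarrow> superseries" where
  "minus_superseries f g = f + - g"

lift_definition times_superseries :: "superseries \<Rightarrow> superseries \<Rightarrow> superseries"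
  is "\<lambda>f g w I. \<Sum>((u, v), (J, K)) \<in> splits w I. cross_sign J K * f u J * g v K"
proof -
  fix f g :: "nat list \<Rightarrow> nat set \<Rightarrow> rat"
  assume "bounded_series f" "bounded_series g"
  then obtain d e where
    d: "\<And>w I. f w I \<noteq> 0 \<Longrightarrow> finite I \<and> length w + card I \<le> d" and
    e: "\<And>w I. g w I \<noteq> 0 \<Longrightarrow> finite I \<and> length w + card I \<le> e"
    unfolding bounded_series_def by blast
  have "finite I \<and> length w + card I \<le> d + e"
    if nz: "(\<Sum>((u, v), (J, K)) \<in> splits w I. cross_sign J K * f u J * g v K) \<noteq> 0" for w I
  proof -
    obtain u v J K where s: "((u, v), (J, K)) \<in> splits w I" "f u J \<noteq> 0" "g v K \<noteq> 0"
      by (rule sum.not_neutral_contains_not_neutral[OF nz]) (auto split: prod.splits)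
    have eq: "u @ v = w" "J \<union> K = I" "J \<inter> K = {}" using s(1) by (auto simp: splits_def)
    have fin: "finite J" "finite K" using d[OF s(2)] e[OF s(3)] by auto
    then have "card I = card J + card K" using eq card_Un_disjoint by metis
    moreover have "length w = length u + length v" using eq(1) by auto
    moreover have "finite I" using fin eq(2) by auto
    ultimately show ?thesis using d[OF s(2)] e[OF s(3)] by auto
  qed
  then show "bounded_series (\<lambda>w I. \<Sum>((u, v), (J, K)) \<in> splits w I. cross_sign J K * f u J * g v K)"
    unfolding bounded_series_def by blast
qed

instance ..

end

lemma coeff_times_fun:
  "coeff (f * g) w I =
    (\<Sum>p \<in> splits w I. cross_sign (fst (snd p)) (snd (snd p)) *
       coeff f (fst (fst p)) (fst (snd p)) * coeff g (snd (fst p)) (snd (snd p)))"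
  by (simp add: times_superseries.rep_eq case_prod_beta)

lemma cross_sign_empty [simp]: "cross_sign {} K = 1" "cross_sign J {} = 1"
  by (simp_all add: cross_sign_def)

lemma cross_sign_Un_left:
  "finite J \<Longrightarrow> finite K \<Longrightarrow> J \<inter> K = {} \<Longrightarrow> cross_sign (J \<union> K) L = cross_sign J L * cross_sign K L"
  by (simp add: cross_sign_def prod.union_disjoint)

lemma cross_sign_Un_right:
  "finite K \<Longrightarrow> finite L \<Longrightarrow> K \<inter> L = {} \<Longrightarrow> cross_sign J (K \<union> L) = cross_sign J K * cross_sign J L"
  by (simp add: cross_sign_def prod.union_disjoint prod.distrib)

lemma superseries_mult_assoc: "(f * g) * h = f * (g * h)" for f g h :: superseries
proof (rule superseries_eqI)
  fix w I
  show "coeff ((f * g) * h) w I = coeff (f * (g * h)) w I"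
  proof (cases "finite I")
    case False
    then show ?thesis by (simp add: coeff_infinite)
  next
    case True
    let ?L = "SIGMA p:splits w I. splits (fst (fst p)) (fst (snd p))"
    let ?R = "SIGMA p:splits w I. splits (snd (fst p)) (snd (snd p))"
    have sub: "finite (fst (snd p))" "finite (snd (snd p))" if "p \<in> splits w I" for p
      using that True by (auto simp: splits_def)
    have "coeff ((f * g) * h) w I =
      (\<Sum>p\<in>splits w I. \<Sum>q\<in>splits (fst (fst p)) (fst (snd p)).
         cross_sign (fst (snd p)) (snd (snd p)) * (cross_sign (fst (snd q)) (snd (snd q)) *
         coeff f (fst (fst q)) (fst (snd q)) * coeff g (snd (fst q)) (snd (snd q))) *
         coeff h (snd (fst p)) (snd (snd p)))"
      by (simp add: coeff_times_fun sum_distrib_left sum_distrib_right)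
    also have "\<dots> = (\<Sum>(p, q)\<in>?L.
         cross_sign (fst (snd p)) (snd (snd p)) * (cross_sign (fst (snd q)) (snd (snd q)) *
         coeff f (fst (fst q)) (fst (snd q)) * coeff g (snd (fst q)) (snd (snd q))) *
         coeff h (snd (fst p)) (snd (snd p)))"
      by (rule sum.Sigma) (auto intro!: finite_splits sub simp: True)
    also have "\<dots> = (\<Sum>(p, q)\<in>?R.
         cross_sign (fst (snd p)) (snd (snd p)) * coeff f (fst (fst p)) (fst (snd p)) *
         (cross_sign (fst (snd q)) (snd (snd q)) *
         coeff g (fst (fst q)) (fst (snd q)) * coeff h (snd (fst q)) (snd (snd q))))"
      by (rule sum.reindex_bij_witness[where
            i = "\<lambda>(((u, v), (J, K)), ((x, y), (M, N))). (((u @ x, y), (J \<union> M, N)), ((u, x), (J, M)))"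
            and j = "\<lambda>(((u, v), (J, K)), ((x, y), (M, N))). (((x, y @ v), (M, N \<union> K)), ((y, v), (N, K)))"])
         (use True in \<open>auto simp: splits_def cross_sign_Un_left cross_sign_Un_right Int_Un_distrib Int_Un_distrib2\<close>)
    also have "\<dots> = (\<Sum>p\<in>splits w I. \<Sum>q\<in>splits (snd (fst p)) (snd (snd p)).
         cross_sign (fst (snd p)) (snd (snd p)) * coeff f (fst (fst p)) (fst (snd p)) *
         (cross_sign (fst (snd q)) (snd (snd q)) *
         coeff g (fst (fst q)) (fst (snd q)) * coeff h (snd (fst q)) (snd (snd q))))"
      by (rule sum.Sigma[symmetric]) (auto intro!: finite_splits sub simp: True)
    also have "\<dots> = coeff (f * (g * h)) w I"
      by (simp add: coeff_times_fun sum_distrib_left sum_distrib_right)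
    finally show ?thesis .
  qed
qed

lemma sum_singleton_support:
  "finite A \<Longrightarrow> a \<in> A \<Longrightarrow> (\<And>p. p \<in> A \<Longrightarrow> p \<noteq> a \<Longrightarrow> F p = 0) \<Longrightarrow> sum F A = (F a :: 'b :: comm_monoid_add)"
  by (metis (no_types, lifting) Diff_iff empty_iff finite.insertI finite.emptyI insert_iff
      sum.infinite sum.insert sum.mono_neutral_right sum.neutral subsetI add.right_neutral)

instance superseries :: ring_1
proof
  fix f g h :: superseries
  show "f + g + h = f + (g + h)" "f + g = g + f" "0 + f = f" "- f + f = 0"
    by (transfer; simp add: fun_eq_iff)+
  show "f - g = f + - g" by (rule minus_superseries_def)
  show "f * g * h = f * (g * h)" by (rule superseries_mult_assoc)
  show "(f + g) * h = f * h + g * h" "f * (g + h) = f * g + f * h"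
    by (rule superseries_eqI;
        simp add: coeff_times_fun plus_superseries.rep_eq algebra_simps sum.distrib)+
  show "(0::superseries) \<noteq> 1"
    by transfer (auto simp: fun_eq_iff)
  show "1 * f = f"
  proof (rule superseries_eqI)
    fix w I
    show "coeff (1 * f) w I = coeff f w I"
    proof (cases "finite I")
      case True
      show ?thesis
        unfolding coeff_times_fun
        by (subst sum_singleton_support[where a = "(([], w), ({}, I))"])
           (auto simp: splits_def one_superseries.rep_eq intro: finite_splits[OF True, unfolded splits_def])
    qed (simp add: coeff_infinite)
  qed
  show "f * 1 = f"
  proof (rule superseries_eqI)
    fix w I
    show "coeff (f * 1) w I = coeff f w I"
    proof (cases "finite I")
      case True
      show ?thesis
        unfolding coeff_times_fun
        by (subst sum_singleton_support[where a = "((w, []), (I, {}))"])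
           (auto simp: splits_def one_superseries.rep_eq intro: finite_splits[OF True, unfolded splits_def])
    qed (simp add: coeff_infinite)
  qed
qed

lift_definition X :: "nat \<Rightarrow> superseries" is "\<lambda>i w I. if w = [i] \<and> I = {} then 1 else 0"
  by (auto simp: bounded_series_def)

lift_definition Theta :: "nat \<Rightarrow> superseries" is "\<lambda>i w I. if w = [] \<and> I = {i} then 1 else 0"
  by (auto simp: bounded_series_def)

lemma coeff_X_times:
  "coeff (X i * g) w I = (case w of [] \<Rightarrow> 0 | a # u \<Rightarrow> if a = i then coeff g u I else 0)"
proof (cases "finite I")
  case True
  show ?thesis
  proof (cases "\<exists>u. w = i # u")
    case True
    then obtain u where u: "w = i # u" by auto
    show ?thesis
      unfolding coeff_times_fun
      by (subst sum_singleton_support[where a = "(([i], u), ({}, I))"])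
         (auto simp: splits_def u X.rep_eq intro: finite_splits[OF \<open>finite I\<close>, unfolded splits_def])
  next
    case False
    then show ?thesis
      unfolding coeff_times_fun
      by (subst sum.neutral) (auto simp: splits_def X.rep_eq split: list.splits)
  qed
qed (auto simp: coeff_infinite split: list.split)

lemma coeff_Theta_times:
  "coeff (Theta i * g) w I =
    (if i \<in> I then cross_sign {i} (I - {i}) * coeff g w (I - {i}) else 0)"
proof (cases "finite I")
  case True
  show ?thesis
  proof (cases "i \<in> I")
    case i: True
    then show ?thesis
      unfolding coeff_times_fun
      by (subst sum_singleton_support[where a = "(([], w), ({i}, I - {i}))"])
         (auto simp: splits_def Theta.rep_eq intro: finite_splits[OF \<open>finite I\<close>, unfolded splits_def])
  next
    case False
    then show ?thesis
      unfolding coeff_times_fun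
      by (subst sum.neutral) (auto simp: splits_def Theta.rep_eq)
  qed
qed (auto simp: coeff_infinite)

lemma X_Theta_commute: "X i * Theta j = Theta j * X i"
  by (rule superseries_eqI)
     (auto simp: coeff_X_times coeff_Theta_times X.rep_eq Theta.rep_eq split: list.split)

lemma Theta_anticommute: "Theta i * Theta j = - (Theta j * Theta i)"
proof (rule superseries_eqI)
  fix w I
  show "coeff (Theta i * Theta j) w I = coeff (- (Theta j * Theta i)) w I"
  proof (cases "I = {i, j} \<and> i \<noteq> j")
    case True
    then have "I - {i} = {j}" "I - {j} = {i}" by auto
    then show ?thesis
      using True by (simp add: coeff_Theta_times Theta.rep_eq uminus_superseries.rep_eq cross_sign_def)
  next
    case False
    then have "i \<in> I \<Longrightarrow> I - {i} \<noteq> {j}" "j \<in> I \<Longrightarrow> I - {j} \<noteq> {i}" by auto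
    then show ?thesis
      by (auto simp: coeff_Theta_times Theta.rep_eq uminus_superseries.rep_eq)
  qed
qed


unbundle permutation_syntax

section \<open>The action of permutations and formal sums\<close>

text \<open>For \<open>I = {i1 < \<dots> < im}\<close>: \<open>\<theta>\<^bsub>p i1\<^esub> \<dots> \<theta>\<^bsub>p im\<^esub> = perm_sign p I \<theta>\<^bsub>p ` I\<^esub>\<close>.\<close>

definition perm_sign :: "nat perm \<Rightarrow> nat set \<Rightarrow> rat" where
  "perm_sign p I = (\<Prod>i\<in>I. \<Prod>j\<in>I. if i < j \<and> p \<langle>$\<rangle> j < p \<langle>$\<rangle> i then - 1 else 1)"

text \<open>The substitution \<open>x\<^sub>i \<mapsto> x\<^bsub>p i\<^esub>\<close>, \<open>\<theta>\<^sub>i \<mapsto> \<theta>\<^bsub>p i\<^esub>\<close>; it is a ring endomorphism by the lemmas below.\<close>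

lift_definition act :: "nat perm \<Rightarrow> superseries \<Rightarrow> superseries"
  is "\<lambda>p f w I. perm_sign p (apply (inverse p) ` I) *
        f (map (apply (inverse p)) w) (apply (inverse p) ` I)"
proof -
  fix p :: "nat perm" and f :: "nat list \<Rightarrow> nat set \<Rightarrow> rat"
  assume "bounded_series f"
  then obtain d where d: "\<And>w I. f w I \<noteq> 0 \<Longrightarrow> finite I \<and> length w + card I \<le> d"
    unfolding bounded_series_def by blast
  let ?q = "apply (inverse p)"
  have inj: "inj_on ?q I" for I by (rule inj_on_subset[OF bij_is_inj[OF bij_apply]]) simp
  have "finite I \<and> length w + card I \<le> d" if "perm_sign p (?q ` I) * f (map ?q w) (?q ` I) \<noteq> 0" for w I
    using d[of "map ?q w" "?q ` I"] that inj[of I] by (simp add: card_image finite_image_iff)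
  then show "bounded_series (\<lambda>w I. perm_sign p (?q ` I) * f (map ?q w) (?q ` I))"
    unfolding bounded_series_def by blast
qed

lemma apply_inverse_apply [simp]:
  "p \<langle>$\<rangle> (inverse p \<langle>$\<rangle> a) = a" "inverse p \<langle>$\<rangle> (p \<langle>$\<rangle> a) = a" for p :: "'a perm"
  by (simp_all add: apply_sequence)

lemma inj_on_apply [simp]: "inj_on (apply p) A"
  by (rule inj_on_subset[OF bij_is_inj[OF bij_apply]]) simp

lemma perm_sign_Un:
  assumes "finite J" "finite K" "J \<inter> K = {}"
  shows "perm_sign p (J \<union> K) * cross_sign J K =
    perm_sign p J * perm_sign p K * cross_sign (apply p ` J) (apply p ` K)"
proof -
  let ?s = "\<lambda>i j. if i < j \<and> p \<langle>$\<rangle> j < p \<langle>$\<rangle> i then - 1 else 1 :: rat"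
  have "perm_sign p (J \<union> K) = perm_sign p J * perm_sign p K *
    ((\<Prod>j\<in>J. \<Prod>k\<in>K. ?s j k) * (\<Prod>k\<in>K. \<Prod>j\<in>J. ?s k j))"
    using assms by (simp add: perm_sign_def prod.union_disjoint prod.distrib)
  also have "(\<Prod>k\<in>K. \<Prod>j\<in>J. ?s k j) = (\<Prod>j\<in>J. \<Prod>k\<in>K. ?s k j)"
    by (rule prod.swap)
  finally have "perm_sign p (J \<union> K) * cross_sign J K = perm_sign p J * perm_sign p K *
    (\<Prod>j\<in>J. \<Prod>k\<in>K. ?s j k * ?s k j * (if k < j then - 1 else 1))"
    by (simp add: cross_sign_def prod.distrib)
  also have "(\<Prod>j\<in>J. \<Prod>k\<in>K. ?s j k * ?s k j * (if k < j then - 1 else 1)) =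
    (\<Prod>j\<in>J. \<Prod>k\<in>K. if p \<langle>$\<rangle> k < p \<langle>$\<rangle> j then - 1 else 1)"
  proof (intro prod.cong refl)
    fix j k assume "j \<in> J" "k \<in> K"
    then have "j \<noteq> k" using assms by auto
    then have "p \<langle>$\<rangle> j \<noteq> p \<langle>$\<rangle> k" by (simp add: apply_inj)
    with \<open>j \<noteq> k\<close> show "?s j k * ?s k j * (if k < j then - 1 else 1) =
        (if p \<langle>$\<rangle> k < p \<langle>$\<rangle> j then - 1 else (1 :: rat))"
      by auto
  qed
  also have "\<dots> = cross_sign (apply p ` J) (apply p ` K)"
    by (simp add: cross_sign_def prod.reindex)
  finally show ?thesis .
qed

lemma act_X: "act p (X i) = X (p \<langle>$\<rangle> i)"
proof (rule superseries_eqI)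
  fix w I
  have "map (apply (inverse p)) w = [i] \<longleftrightarrow> w = [p \<langle>$\<rangle> i]"
    by (cases w) auto
  then show "coeff (act p (X i)) w I = coeff (X (p \<langle>$\<rangle> i)) w I"
    by (simp add: act.rep_eq X.rep_eq perm_sign_def)
qed

lemma act_Theta: "act p (Theta i) = Theta (p \<langle>$\<rangle> i)"
proof (rule superseries_eqI)
  fix w I
  have "apply (inverse p) ` I = {i} \<longleftrightarrow> I = {p \<langle>$\<rangle> i}"
    by (metis apply_inverse_apply(2) image_empty image_insert inj_image_eq_iff inj_on_apply)
  then show "coeff (act p (Theta i)) w I = coeff (Theta (p \<langle>$\<rangle> i)) w I"
    by (simp add: act.rep_eq Theta.rep_eq perm_sign_def)
qed

lemma act_one: "act p 1 = 1"
  by (rule superseries_eqI) (simp add: act.rep_eq one_superseries.rep_eq perm_sign_def)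

lemma act_add: "act p (f + g) = act p f + act p g"
  by (rule superseries_eqI) (simp add: act.rep_eq plus_superseries.rep_eq algebra_simps)

lemma act_times: "act p (f * g) = act p f * act p g"
proof (rule superseries_eqI)
  fix w I
  let ?q = "apply (inverse p)"
  show "coeff (act p (f * g)) w I = coeff (act p f * act p g) w I"
  proof (cases "finite I")
    case True
    have qq: "apply p ` ?q ` J = J" "?q ` apply p ` J = J" for J
      by (simp_all add: image_image)
    have mm: "map (apply p) (map ?q u) = u" "map ?q (map (apply p) u) = u" for u
      by (simp_all add: map_idI)
    have *: "perm_sign p (J \<union> K) * cross_sign J K =
      perm_sign p J * perm_sign p K * cross_sign (apply p ` J) (apply p ` K)"
      if "((u, v), (J, K)) \<in> splits (map ?q w) (?q ` I)" for u v J K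
      using that True by (intro perm_sign_Un) (auto simp: splits_def dest!: arg_cong[where f = finite])
    have "coeff (act p (f * g)) w I =
      (\<Sum>((u, v), (J, K)) \<in> splits (map ?q w) (?q ` I).
         perm_sign p (?q ` I) * (cross_sign J K * coeff f u J * coeff g v K))"
      by (simp add: act.rep_eq times_superseries.rep_eq sum_distrib_left case_prod_beta)
    also have "\<dots> = (\<Sum>((u, v), (J, K)) \<in> splits (map ?q w) (?q ` I).
         cross_sign (apply p ` J) (apply p ` K) * (perm_sign p J * coeff f u J) *
         (perm_sign p K * coeff g v K))"
    proof (intro sum.cong refl, clarify)
      fix u v J K assume a: "((u, v), (J, K)) \<in> splits (map ?q w) (?q ` I)"
      then have "?q ` I = J \<union> K" by (auto simp: splits_def)
      then show "perm_sign p (?q ` I) * (cross_sign J K * coeff f u J * coeff g v K) =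
         cross_sign (apply p ` J) (apply p ` K) * (perm_sign p J * coeff f u J) *
         (perm_sign p K * coeff g v K)"
        using *[OF a] by (simp add: mult.assoc[symmetric])
    qed
    also have "\<dots> = (\<Sum>((u, v), (J, K)) \<in> splits w I.
         cross_sign J K * (perm_sign p (?q ` J) * coeff f (map ?q u) (?q ` J)) *
         (perm_sign p (?q ` K) * coeff g (map ?q v) (?q ` K)))"
    proof (rule sum.reindex_bij_witness[where
          i = "\<lambda>((u, v), (J, K)). ((map ?q u, map ?q v), (?q ` J, ?q ` K))"
          and j = "\<lambda>((u, v), (J, K)). ((map (apply p) u, map (apply p) v), (apply p ` J, apply p ` K))"],
        goal_cases)
      case (2 a)
      then obtain u v J K where a: "a = ((u, v), (J, K))" "u @ v = map ?q w" "J \<union> K = ?q ` I" "J \<inter> K = {}"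
        by (auto simp: splits_def)
      have "map (apply p) u @ map (apply p) v = w"
        using mm(1)[of w] by (simp only: a(2)[symmetric] map_append)
      moreover have "apply p ` J \<union> apply p ` K = I"
        using qq(1)[of I] by (simp only: a(3)[symmetric] image_Un)
      moreover have "apply p ` J \<inter> apply p ` K = {}"
        using a(4) by (simp add: image_Int[symmetric])
      ultimately show ?case by (simp add: a(1) splits_def)
    next
      case (4 b)
      then obtain u v J K where b: "b = ((u, v), (J, K))" "u @ v = w" "J \<union> K = I" "J \<inter> K = {}"
        by (auto simp: splits_def)
      have "?q ` J \<inter> ?q ` K = {}" using b(4) by (simp add: image_Int[symmetric])
      then show ?case by (auto simp: b(1) splits_def b(2)[symmetric] b(3)[symmetric])
    qed (auto simp: qq mm simp del: map_map)
    also have "\<dots> = coeff (act p f * act p g) w I"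
      by (simp add: act.rep_eq times_superseries.rep_eq)
    finally show ?thesis .
  qed (simp add: coeff_infinite)
qed

definition symmetric :: "superseries \<Rightarrow> bool" where
  "symmetric f \<longleftrightarrow> (\<forall>p :: nat perm. act p f = f)"

text \<open>Coefficientwise sum of a possibly infinite family: it makes sense if degrees are uniformly bounded and each
  monomial occurs in only finitely many members. The junk value outside this case is irrelevant.\<close>

definition summable_family :: "('b \<Rightarrow> superseries) \<Rightarrow> 'b set \<Rightarrow> bool" where
  "summable_family F A \<longleftrightarrow>
    (\<exists>d. \<forall>a\<in>A. \<forall>w I. coeff (F a) w I \<noteq> 0 \<longrightarrow> length w + card I \<le> d) \<and>
    (\<forall>w I. finite {a \<in> A. coeff (F a) w I \<noteq> 0})"

definition formal_sum :: "('b \<Rightarrow> superseries) \<Rightarrow> 'b set \<Rightarrow> superseries" where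
  "formal_sum F A = (if summable_family F A
     then Superseries (\<lambda>w I. \<Sum>a\<in>{a \<in> A. coeff (F a) w I \<noteq> 0}. coeff (F a) w I) else 0)"

lemma coeff_formal_sum:
  assumes "summable_family F A"
  shows "coeff (formal_sum F A) w I = (\<Sum>a\<in>{a \<in> A. coeff (F a) w I \<noteq> 0}. coeff (F a) w I)"
proof -
  obtain d where d: "\<And>a w I. a \<in> A \<Longrightarrow> coeff (F a) w I \<noteq> 0 \<Longrightarrow> length w + card I \<le> d"
    using assms unfolding summable_family_def by blast
  have "finite I \<and> length w + card I \<le> d"
    if nz: "(\<Sum>a\<in>{a \<in> A. coeff (F a) w I \<noteq> 0}. coeff (F a) w I) \<noteq> 0" for w I
  proof -
    obtain a where "a \<in> A" "coeff (F a) w I \<noteq> 0"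
      using sum.not_neutral_contains_not_neutral[OF nz] by blast
    then show ?thesis using d coeff_infinite by blast
  qed
  then have "bounded_series (\<lambda>w I. \<Sum>a\<in>{a \<in> A. coeff (F a) w I \<noteq> 0}. coeff (F a) w I)"
    unfolding bounded_series_def by blast
  then show ?thesis using assms by (simp add: formal_sum_def Superseries_inverse)
qed


section \<open>Superpartitions\<close>

text \<open>\<open>(\<Lambda>\<^sub>1, \<dots>, \<Lambda>\<^sub>m; \<Lambda>\<^bsub>m+1\<^esub>, \<dots>, \<Lambda>\<^sub>k)\<close> is the pair of the two lists.\<close>

type_synonym spart = "nat list \<times> nat list"

definition superpartition :: "spart \<Rightarrow> bool" where
  "superpartition L \<longleftrightarrow> sorted_wrt (>) (fst L) \<and> sorted_wrt (\<ge>) (snd L) \<and> (\<forall>a\<in>set (snd L). a \<ge> 1)"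

definition sdegree :: "spart \<Rightarrow> nat" where
  "sdegree L = sum_list (fst L) + sum_list (snd L)"

definition df :: "spart \<Rightarrow> nat" where
  "df L = length (fst L)"

definition superpartition_of :: "nat \<Rightarrow> nat \<Rightarrow> spart \<Rightarrow> bool" where
  "superpartition_of n m L \<longleftrightarrow> superpartition L \<and> sdegree L = n \<and> df L = m"

text \<open>\<open>\<Lambda>\<^sup>+\<close> and \<open>\<Lambda>\<^sup>\<oplus>\<close>; the former may end with a part 0.\<close>

definition sp_plus :: "spart \<Rightarrow> nat list" where
  "sp_plus L = rev (sort (fst L @ snd L))"

definition sp_oplus :: "spart \<Rightarrow> nat list" where
  "sp_oplus L = rev (sort (map Suc (fst L) @ snd L))"

type_synonym cell = "nat \<times> nat"  \<comment> \<open>(row, column)\<close>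

definition diagram :: "nat list \<Rightarrow> cell set" where
  "diagram p = {(t, c). t < length p \<and> c < p ! t}"

definition boxes :: "spart \<Rightarrow> cell set" where
  "boxes L = diagram (sp_plus L)"

definition circles :: "spart \<Rightarrow> cell set" where
  "circles L = diagram (sp_oplus L) - diagram (sp_plus L)"

text \<open>The rows of a set of circles from top to bottom; there is at most one circle per row.\<close>

definition circle_rows :: "cell set \<Rightarrow> nat list" where
  "circle_rows C = sorted_list_of_set (fst ` C)"


section \<open>Super semistandard tableaux\<close>

datatype weight = Plain nat | Barred nat

fun weight_abs :: "weight \<Rightarrow> nat" where
  "weight_abs (Plain a) = a"
| "weight_abs (Barred a) = a"

text \<open>The skew diagram \<open>B / A\<close> is a horizontal \<open>r\<close>-strip.\<close>

definition horizontal_strip :: "nat \<Rightarrow> cell set \<Rightarrow> cell set \<Rightarrow> bool" where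
  "horizontal_strip r A B \<longleftrightarrow> A \<subseteq> B \<and> card (B - A) = r \<and> inj_on snd (B - A)"

text \<open>Condition (2), for the strip \<open>D\<close> and the sets \<open>C\<close>, \<open>C'\<close> of old and new circles.\<close>

definition circles_follow :: "cell set \<Rightarrow> cell set \<Rightarrow> cell set \<Rightarrow> bool" where
  "circles_follow D C C' \<longleftrightarrow> card C' = card C \<and>
     (\<forall>j<card C. circle_rows C' ! j =
        (if circle_rows C ! j \<in> fst ` D then Suc (circle_rows C ! j) else circle_rows C ! j))"

definition new_circle :: "spart \<Rightarrow> spart \<Rightarrow> cell \<Rightarrow> bool" where
  "new_circle K L q \<longleftrightarrow> q \<in> circles L \<and> snd q \<notin> snd ` (boxes L - boxes K) \<and>
     (\<forall>c<snd q. c \<in> snd ` (boxes L - boxes K))"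

fun tableau_step :: "spart \<Rightarrow> spart \<Rightarrow> weight \<Rightarrow> bool" where
  "tableau_step K L (Plain r) \<longleftrightarrow>
     horizontal_strip r (boxes K) (boxes L) \<and> df L = df K \<and>
     circles_follow (boxes L - boxes K) (circles K) (circles L)"
| "tableau_step K L (Barred r) \<longleftrightarrow>
     horizontal_strip r (boxes K) (boxes L) \<and> df L = df K + 1 \<and>
     (\<exists>!q. new_circle K L q) \<and>
     (\<forall>q. new_circle K L q \<longrightarrow>
        circles_follow (boxes L - boxes K) (circles K) (circles L - {q}))"

definition tableau :: "spart \<Rightarrow> weight list \<Rightarrow> spart list \<Rightarrow> bool" where
  "tableau L \<alpha> Ls \<longleftrightarrow> length Ls = Suc (length \<alpha>) \<and> (\<forall>K\<in>set Ls. superpartition K) \<and>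
     Ls ! 0 = ([], []) \<and> Ls ! length \<alpha> = L \<and>
     (\<forall>i<length \<alpha>. tableau_step (Ls ! i) (Ls ! Suc i) (\<alpha> ! i))"

text \<open>A filling is the labelling of the boxes together with the list of the labels of the circles from top to
  bottom.\<close>

type_synonym filling = "(cell \<Rightarrow> nat option) \<times> nat list"

definition box_labels :: "weight list \<Rightarrow> spart list \<Rightarrow> cell \<Rightarrow> nat option" where
  "box_labels \<alpha> Ls q =
     (if q \<in> boxes (Ls ! length \<alpha>)
      then Some (THE i. i < length \<alpha> \<and> q \<in> boxes (Ls ! Suc i) - boxes (Ls ! i)) else None)"

text \<open>The labels of the circles of \<open>Ls ! i\<close>. By condition (2) the old circles keep their relative order, and the
  label of a new circle is inserted after those of the circles above it.\<close>

primrec circle_labels :: "weight list \<Rightarrow> spart list \<Rightarrow> nat \<Rightarrow> nat list" where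
  "circle_labels \<alpha> Ls 0 = []"
| "circle_labels \<alpha> Ls (Suc i) =
     (let ls = circle_labels \<alpha> Ls i in
      case \<alpha> ! i of
        Plain _ \<Rightarrow> ls
      | Barred _ \<Rightarrow>
          (let q = (THE q. new_circle (Ls ! i) (Ls ! Suc i) q);
               k = card {q' \<in> circles (Ls ! Suc i). fst q' < fst q}
           in take k ls @ i # drop k ls))"

definition sSSYT :: "spart \<Rightarrow> filling set" where
  "sSSYT L = {(box_labels \<alpha> Ls, circle_labels \<alpha> Ls (length \<alpha>)) | \<alpha> Ls. tableau L \<alpha> Ls}"


section \<open>Schur functions\<close>

text \<open>The reading order of the boxes: by rows from top to bottom, each from left to right.\<close>

definition box_list :: "spart \<Rightarrow> cell list" where
  "box_list L = concat (map (\<lambda>t. map (Pair t) [0..<sp_plus L ! t]) [0..<length (sp_plus L)])"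

definition tableau_term :: "spart \<Rightarrow> filling \<Rightarrow> superseries" where
  "tableau_term L T =
     prod_list (map Theta (snd T)) *
     (\<Sum>\<sigma> | \<sigma> permutes {..<sdegree L}.
        prod_list (map (\<lambda>i. X (the (fst T (box_list L ! \<sigma> i)))) [0..<sdegree L]))"

definition schur :: "spart \<Rightarrow> superseries" where
  "schur L = formal_sum (tableau_term L) (sSSYT L)"

text \<open>The infinite sum is well defined.\<close>

lemma set_box_list: "set (box_list L) = boxes L"
  by (auto simp: box_list_def boxes_def diagram_def)

lemma length_box_list: "length (box_list L) = sdegree L"
proof -
  have "length (box_list L) = sum_list (map ((!) (sp_plus L)) [0..<length (sp_plus L)])"
    by (simp add: box_list_def length_concat comp_def)
  also have "\<dots> = sum_list (sp_plus L)" by (simp add: map_nth)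
  also have "\<dots> = sum_mset (mset (sp_plus L))" by (rule sum_mset_sum_list[symmetric])
  also have "\<dots> = sum_mset (mset (fst L @ snd L))" by (simp add: sp_plus_def)
  also have "\<dots> = sdegree L" by (simp only: sum_mset_sum_list sdegree_def sum_list_append)
  finally show ?thesis .
qed

lemma length_circle_labels:
  assumes "tableau L \<alpha> Ls" "i \<le> length \<alpha>"
  shows "length (circle_labels \<alpha> Ls i) = df (Ls ! i)"
  using assms(2)
proof (induction i)
  case 0
  then show ?case using assms(1) by (simp add: tableau_def df_def)
next
  case (Suc i)
  then have "tableau_step (Ls ! i) (Ls ! Suc i) (\<alpha> ! i)"
    using assms(1) by (simp add: tableau_def)
  with Suc show ?case by (cases "\<alpha> ! i") (simp_all add: Let_def)
qed

lemma sSSYT_dom: "T \<in> sSSYT L \<Longrightarrow> dom (fst T) = boxes L"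
  by (auto simp: sSSYT_def tableau_def box_labels_def dom_def split: if_splits)

lemma sSSYT_length: "T \<in> sSSYT L \<Longrightarrow> length (snd T) = df L"
  by (auto simp: sSSYT_def length_circle_labels) (simp add: tableau_def)

lemma coeff_sum: "coeff (sum F A) w I = (\<Sum>a\<in>A. coeff (F a) w I)"
  by (induction A rule: infinite_finite_induct)
     (simp_all add: zero_superseries.rep_eq plus_superseries.rep_eq)

lemma coeff_prod_X: "coeff (prod_list (map X is)) w I = (if w = is \<and> I = {} then 1 else 0)"
  by (induction "is" arbitrary: w)
     (auto simp: one_superseries.rep_eq coeff_X_times split: list.split)

lemma coeff_prod_Theta:
  "coeff (prod_list (map Theta is)) w I \<noteq> 0 \<Longrightarrow> w = [] \<and> I = set is \<and> distinct is"
proof (induction "is" arbitrary: w I)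
  case Nil
  then show ?case by (simp add: one_superseries.rep_eq split: if_splits)
next
  case (Cons a as)
  then have "a \<in> I" "coeff (prod_list (map Theta as)) w (I - {a}) \<noteq> 0"
    by (auto simp: coeff_Theta_times split: if_splits)
  with Cons.IH[of w "I - {a}"] show ?case by auto
qed

lemma coeff_tableau_term:
  assumes "coeff (tableau_term L T) w I \<noteq> 0"
  shows "I = set (snd T)" "distinct (snd T)"
    "\<exists>\<sigma>. \<sigma> permutes {..<sdegree L} \<and> w = map (\<lambda>i. the (fst T (box_list L ! \<sigma> i))) [0..<sdegree L]"
proof -
  define F where "F \<sigma> = map (\<lambda>i. the (fst T (box_list L ! \<sigma> i))) [0..<sdegree L]" for \<sigma>
  have F: "prod_list (map (\<lambda>i. X (the (fst T (box_list L ! \<sigma> i)))) [0..<sdegree L]) =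
      prod_list (map X (F \<sigma>))" for \<sigma>
    by (simp add: F_def comp_def)
  let ?P = "{\<sigma>. \<sigma> permutes {..<sdegree L}}"
  have nz: "(\<Sum>p \<in> splits w I. cross_sign (fst (snd p)) (snd (snd p)) *
       coeff (prod_list (map Theta (snd T))) (fst (fst p)) (fst (snd p)) *
       coeff (\<Sum>\<sigma>\<in>?P. prod_list (map X (F \<sigma>))) (snd (fst p)) (snd (snd p))) \<noteq> 0"
    using assms by (simp only: tableau_term_def F coeff_times_fun not_False_eq_True)
  obtain p where "p \<in> splits w I"
      "coeff (prod_list (map Theta (snd T))) (fst (fst p)) (fst (snd p)) \<noteq> 0"
      "coeff (\<Sum>\<sigma>\<in>?P. prod_list (map X (F \<sigma>))) (snd (fst p)) (snd (snd p)) \<noteq> 0"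
    using sum.not_neutral_contains_not_neutral[OF nz] by (metis mult_zero_left mult_zero_right)
  then obtain u v J K where p: "((u, v), (J, K)) \<in> splits w I"
      "coeff (prod_list (map Theta (snd T))) u J \<noteq> 0"
      "coeff (\<Sum>\<sigma>\<in>?P. prod_list (map X (F \<sigma>))) v K \<noteq> 0"
    by (cases p) auto
  then obtain \<sigma> where \<sigma>: "\<sigma> permutes {..<sdegree L}" "coeff (prod_list (map X (F \<sigma>))) v K \<noteq> 0"
    unfolding coeff_sum using sum.not_neutral_contains_not_neutral[OF p(3)[unfolded coeff_sum]] by blast
  then have "v = F \<sigma>" "K = {}" by (auto simp: coeff_prod_X split: if_splits)
  with coeff_prod_Theta[OF p(2)] p(1) have *: "w = F \<sigma>" "I = set (snd T)" "distinct (snd T)"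
    by (auto simp: splits_def)
  then show "I = set (snd T)" "distinct (snd T)" by auto
  show "\<exists>\<sigma>. \<sigma> permutes {..<sdegree L} \<and> w = map (\<lambda>i. the (fst T (box_list L ! \<sigma> i))) [0..<sdegree L]"
    using * \<sigma>(1) by (auto simp: F_def)
qed

lemma summable_schur: "summable_family (tableau_term L) (sSSYT L)"
  unfolding summable_family_def
proof (intro conjI exI[of _ "sdegree L + df L"] ballI allI impI)
  fix T w I assume "T \<in> sSSYT L" "coeff (tableau_term L T) w I \<noteq> 0"
  with coeff_tableau_term[of L T w I] sSSYT_length[of T L] show "length w + card I \<le> sdegree L + df L"
    by (auto simp: distinct_card)
next
  fix w :: "nat list" and I :: "nat set"
  show "finite {T \<in> sSSYT L. coeff (tableau_term L T) w I \<noteq> 0}"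
  proof (cases "finite I")
    case True
    have "{T \<in> sSSYT L. coeff (tableau_term L T) w I \<noteq> 0} \<subseteq>
      {B. dom B = boxes L \<and> ran B \<subseteq> set w} \<times> {ls. set ls \<subseteq> I \<and> length ls = df L}"
    proof
      fix T assume "T \<in> {T \<in> sSSYT L. coeff (tableau_term L T) w I \<noteq> 0}"
      then obtain B ls where Tp: "T = (B, ls)"
        and T: "(B, ls) \<in> sSSYT L" "coeff (tableau_term L (B, ls)) w I \<noteq> 0"
        by (cases T) auto
      from coeff_tableau_term(3)[OF T(2)] obtain \<sigma> where \<sigma>: "\<sigma> permutes {..<sdegree L}"
        "w = map (\<lambda>i. the (B (box_list L ! \<sigma> i))) [0..<sdegree L]" by auto
      have "y \<in> set w" if y: "y \<in> ran B" for y
      proof -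
        obtain q where q: "B q = Some y" using y unfolding ran_def by blast
        then have "q \<in> set (box_list L)" using sSSYT_dom[OF T(1)] by (auto simp: set_box_list)
        then obtain k where k: "k < sdegree L" "q = box_list L ! k"
          by (auto simp: in_set_conv_nth length_box_list)
        then obtain i where "i < sdegree L" "k = \<sigma> i"
          using permutes_image[OF \<sigma>(1)] by (metis imageE lessThan_iff)
        then show ?thesis using k q by (auto simp: \<sigma>(2) intro!: image_eqI[of _ _ i])
      qed
      then show "T \<in> {B. dom B = boxes L \<and> ran B \<subseteq> set w} \<times> {ls. set ls \<subseteq> I \<and> length ls = df L}"
        using sSSYT_dom[OF T(1)] sSSYT_length[OF T(1)] coeff_tableau_term(1)[OF T(2)]
        by (simp add: Tp subset_iff)
    qed
    moreover have "finite {B. dom B = boxes L \<and> ran B \<subseteq> set w}"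
      by (intro finite_set_of_finite_maps) (simp_all add: set_box_list[symmetric])
    moreover have "finite {ls. set ls \<subseteq> I \<and> length ls = df L}"
      using finite_lists_length_eq[OF True] by simp
    ultimately show ?thesis by (meson finite_SigmaI finite_subset)
  qed (simp add: coeff_infinite)
qed

end

theory Submission
  imports Defs
begin

text \<open>
  A superpartition is a partition together with a set of columns in which circles sit at addable corners. Read
  column by column, the pairs \<open>K\<close>, \<open>L\<close> allowed by one step of a tableau are exactly those connected by a row of a
  vertex model: each column carries the number of parts of that size and the presence of a circle, and
  the edge between two columns carries one of four states. The two-row partition functions for the orders \<open>(x, y)\<close>
  and \<open>(y, x)\<close> of two successive steps satisfy a fixed system of linear relations, which is preserved by each
  column (a Yang-Baxter type argument). Hence two steps commute if at least one of them is unbarred, and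
  anticommute if both are barred, once a barred step is weighted by the parity of the number of circles below the
  new one. The coefficients of the Schur function are signed counts of tableaux of a given weight, so exchanging
  adjacent weights has exactly the effect of exchanging adjacent variables.
\<close>

section \<open>The vertex model\<close>

text \<open>The four states carry two bits: \<open>boxes_added\<close>, a part crosses the edge, and
  \<open>bosons_out\<close>, a circle-free part crosses it; the difference is the flux of circles.
  Both are conserved at every column, and the intertwiner mixes only pairs of states with equal
  totals; its one block of size four consists of \<open>Push\<close> with \<open>Idle\<close> and
  \<open>Fresh\<close> with \<open>Carry\<close>, in both orders. A step starts in
  \<open>Idle\<close> or \<open>Fresh\<close>, and for such pairs the relation is a mere exchange up
  to sign. But circles slide left across several columns, so further right the pairs with
  \<open>Push\<close> and \<open>Carry\<close> appear, and their relations must be carried along.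
  One parameter \<open>u\<close> replaces two variables, because the degrees of \<open>K\<close> and
  \<open>L\<close> fix the total number of boxes. The sign is forced by the thetas: the newest label
  is the largest, so sorting moves its theta past the circles below it, which are those to its left.
  That the x do not commute is harmless: summing over all orders of the boxes leaves only the
  multiset of labels.\<close>

text \<open>States of the edge to the right of column \<open>c\<close>, for a step from \<open>K\<close> to \<open>L\<close>. \<open>Idle\<close> and \<open>Carry\<close>: no box is added in
  column \<open>c\<close>; \<open>Push\<close> and \<open>Fresh\<close>: a box is added there. \<open>Carry\<close>: a circle of \<open>K\<close> to the right of \<open>c\<close> moves down a row
  and lands in a column \<open>\<le> c\<close>. \<open>Fresh\<close>: the new circle is to the right of \<open>c\<close>.\<close>

datatype edge = Idle | Push | Fresh | Carry

text \<open>A site is a column \<open>c\<close>: the number of parts equal to \<open>c\<close>, including the one that ends in a circle, and whether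
  there is a circle in column \<open>c\<close>.\<close>

type_synonym site = "nat \<times> bool"

text \<open>A box in column \<open>c\<close> turns the topmost part of size \<open>c\<close> into
  one of size \<open>c + 1\<close>: \<open>Push\<close> on the right takes a part from the site,
  \<open>Push\<close> on the left supplies one. A circle sits on the topmost part of its size. If
  that part receives a box, the circle drops one row; it stays in its column unless the site becomes
  empty, and then it leaves through \<open>Carry\<close> on the left. A carried circle crosses empty
  sites and stops at the first site occupied in the new shape.\<close>

fun vertex :: "edge \<Rightarrow> site \<Rightarrow> edge \<Rightarrow> site option" where
  "vertex Idle (n, f) Idle = Some (n, f)"
| "vertex Idle (n, f) Push = (if n > of_bool f then Some (n - 1, f) else None)"
| "vertex Idle (n, f) Carry = (if n > 0 \<and> \<not> f then Some (n, True) else None)"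
| "vertex Push (n, f) Idle = Some (Suc n, f)"
| "vertex Push (n, f) Push = Some (n, f)"
| "vertex Push (n, f) Carry = (if f then None else Some (Suc n, True))"
| "vertex Carry (n, f) Carry = (if n = 0 then Some (0, False) else None)"
| "vertex Carry (n, f) Push = (if n = 1 \<and> f then Some (0, False) else None)"
| "vertex Fresh (n, f) Fresh = Some (n, f)"
| "vertex Fresh (n, f) Idle = (if f then None else Some (Suc n, True))"
| "vertex _ _ _ = None"

text \<open>The sign of \<open>Fresh\<close> passing an old circle makes the total sign the parity of the circles to the left of the new
  one.\<close>

definition edge_weight :: "'a::comm_ring_1 \<Rightarrow> edge \<Rightarrow> 'a" where
  "edge_weight u j = (if j = Push \<or> j = Fresh then u else 1)"

definition vertex_weight :: "'a::comm_ring_1 \<Rightarrow> edge \<Rightarrow> site \<Rightarrow> edge \<Rightarrow> site \<Rightarrow> 'a" where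
  "vertex_weight u i a j b = (if vertex i a j = Some b
     then edge_weight u j * (if i = Fresh \<and> j = Fresh \<and> snd a then - 1 else 1) else 0)"

definition double_vertex ::
  "'a::comm_ring_1 \<Rightarrow> 'a \<Rightarrow> site \<Rightarrow> site \<Rightarrow> (edge \<Rightarrow> edge \<Rightarrow> 'a) \<Rightarrow> edge \<Rightarrow> edge \<Rightarrow> 'a" where
  "double_vertex u v a d V i1 i2 = (\<Sum>j1\<in>{Idle, Push, Fresh, Carry}. \<Sum>j2\<in>{Idle, Push, Fresh, Carry}.
     case vertex i1 a j1 of None \<Rightarrow> 0
     | Some b \<Rightarrow> vertex_weight u i1 a j1 b * vertex_weight v i2 b j2 d * V j1 j2)"

text \<open>The relation between the two-row partition functions to the right of an edge, as functions of the pair of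
  states on this edge, when the additional boxes are counted (by powers of \<open>u\<close>) in the second row only (\<open>U\<close>) or in
  the first row only (\<open>W\<close>). This is the intertwiner; its entries were found by solving a linear system.\<close>

definition intertwined :: "'a::comm_ring_1 \<Rightarrow> (edge \<Rightarrow> edge \<Rightarrow> 'a) \<Rightarrow> (edge \<Rightarrow> edge \<Rightarrow> 'a) \<Rightarrow> bool" where
  "intertwined u U W \<longleftrightarrow>
     W Idle Idle = U Idle Idle \<and> W Push Push = U Push Push \<and> W Fresh Fresh = - U Fresh Fresh \<and>
     W Carry Carry = u * U Carry Carry \<and>
     W Idle Fresh = U Fresh Idle \<and> W Fresh Idle = U Idle Fresh \<and>
     W Push Fresh = U Fresh Push \<and> W Fresh Push = U Push Fresh \<and>
     W Push Idle = U Push Idle \<and> W Idle Push = u * U Idle Push - (u - 1) * U Push Idle \<and>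
     W Fresh Carry = U Push Idle - U Idle Push - U Carry Fresh \<and>
     W Carry Fresh = u * (U Push Idle - U Idle Push) - U Fresh Carry \<and>
     W Carry Idle = u * U Carry Idle \<and> W Idle Carry = U Idle Carry - (u - 1) * U Carry Idle \<and>
     W Push Carry = U Push Carry \<and> W Carry Push = u * U Carry Push - (u - 1) * U Push Carry"

text \<open>The exchange (RLL) relation for a single column: a finite identity, linear in the
  unknown values of \<open>U\<close> and \<open>W\<close>. The assumption on \<open>a\<close>
  excludes a circle without a part to sit on.\<close>

lemma intertwined_double_vertex:
  assumes "intertwined u U W" and "snd a \<Longrightarrow> fst a > 0"
  shows "intertwined u (double_vertex 1 u a d U) (double_vertex u 1 a d W)"
proof -
  obtain n f where a: "a = (n, f)" by force
  obtain n' f' where d: "d = (n', f')" by force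
  \<comment> \<open>The guards of \<open>vertex\<close> compare the number of parts with 0 and 1
    only.\<close>
  consider "n = 0" | "n = 1" | k where "n = Suc (Suc k)" by (metis One_nat_def not0_implies_Suc)
  then show ?thesis
    using assms
    by cases
      (cases f; cases f'; simp add: a d intertwined_def double_vertex_def vertex_weight_def edge_weight_def;
        simp add: algebra_simps)+
qed

lemma UNIV_edge: "UNIV = {Idle, Push, Fresh, Carry}"
  using edge.exhaust by auto

instance edge :: finite
  by standard (simp add: UNIV_edge)

section \<open>Partition functions of one row and of two rows\<close>

fun transfer :: "'a::comm_ring_1 \<Rightarrow> edge \<Rightarrow> site list \<Rightarrow> site list \<Rightarrow> 'a" where
  "transfer u i [] [] = of_bool (i = Idle)"
| "transfer u i (a # as) (b # bs) = (\<Sum>j\<in>UNIV. vertex_weight u i a j b * transfer u j as bs)"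
| "transfer u i _ _ = 0"

fun double_transfer :: "'a::comm_ring_1 \<Rightarrow> 'a \<Rightarrow> site list \<Rightarrow> site list \<Rightarrow> edge \<Rightarrow> edge \<Rightarrow> 'a" where
  "double_transfer u v [] [] i1 i2 = of_bool (i1 = Idle \<and> i2 = Idle)"
| "double_transfer u v (a # as) (d # ds) i1 i2 = double_vertex u v a d (double_transfer u v as ds) i1 i2"
| "double_transfer u v _ _ _ _ = 0"

text \<open>At the right end both functions are the indicator of the pair \<open>Idle\<close>,
  \<open>Idle\<close>, which satisfies all the relations; the relation then travels left column by
  column.\<close>

lemma intertwined_double_transfer:
  assumes "\<forall>a\<in>set as. snd a \<longrightarrow> fst a > 0"
  shows "intertwined u (double_transfer 1 u as ds) (double_transfer u 1 as ds)"
  using assms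
proof (induction as arbitrary: ds)
  case Nil
  show ?case by (cases ds) (simp_all add: intertwined_def)
next
  case (Cons a as)
  show ?case
  proof (cases ds)
    case Nil
    then show ?thesis by (simp add: intertwined_def)
  next
    case (Cons d ds')
    have "double_transfer v w (a # as) ds = double_vertex v w a d (double_transfer v w as ds')" for v w :: 'a
      using Cons by (intro ext) simp
    then show ?thesis using Cons.prems by (auto intro!: intertwined_double_vertex Cons.IH)
  qed
qed

lemma vertex_weight_eq_0: "vertex i a j \<noteq> Some b \<Longrightarrow> vertex_weight u i a j b = 0"
  by (simp add: vertex_weight_def)

text \<open>The middle site is determined by the first row, so the sum over \<open>A\<close> has at
  most one nonzero term. The \<open>case\<close> form suits the check of the local relation, this
  form the factorization into rows.\<close>

lemma double_vertex_eq_sum: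
  assumes "finite A" "\<And>i j b. vertex i a j = Some b \<Longrightarrow> b \<in> A"
  shows "double_vertex u v a d V i1 i2 =
    (\<Sum>b\<in>A. \<Sum>j1\<in>UNIV. \<Sum>j2\<in>UNIV. vertex_weight u i1 a j1 b * vertex_weight v i2 b j2 d * V j1 j2)"
proof -
  have *: "(case vertex i1 a j1 of None \<Rightarrow> 0
     | Some b \<Rightarrow> vertex_weight u i1 a j1 b * vertex_weight v i2 b j2 d * V j1 j2) =
     (\<Sum>b\<in>A. vertex_weight u i1 a j1 b * vertex_weight v i2 b j2 d * V j1 j2)" for j1 j2
  proof (cases "vertex i1 a j1")
    case None
    then show ?thesis by (simp add: vertex_weight_eq_0)
  next
    case (Some b)
    have "vertex_weight u i1 a j1 b' = 0" if "b' \<noteq> b" for b'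
      using Some that by (simp add: vertex_weight_eq_0)
    moreover have "b \<in> A" using assms(2) Some by blast
    ultimately have "(\<Sum>b'\<in>A. vertex_weight u i1 a j1 b' * vertex_weight v i2 b' j2 d * V j1 j2) =
        vertex_weight u i1 a j1 b * vertex_weight v i2 b j2 d * V j1 j2"
      using assms(1) by (subst sum.mono_neutral_right[of _ "{b}"]) auto
    then show ?thesis using Some by simp
  qed
  show ?thesis
  proof -
    have "double_vertex u v a d V i1 i2 = (\<Sum>j1\<in>UNIV. \<Sum>j2\<in>UNIV. \<Sum>b\<in>A.
        vertex_weight u i1 a j1 b * vertex_weight v i2 b j2 d * V j1 j2)"
      unfolding double_vertex_def UNIV_edge[symmetric] * ..
    also have "\<dots> = (\<Sum>j1\<in>UNIV. \<Sum>b\<in>A. \<Sum>j2\<in>UNIV.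
        vertex_weight u i1 a j1 b * vertex_weight v i2 b j2 d * V j1 j2)"
      by (intro sum.cong refl sum.swap)
    also have "\<dots> = (\<Sum>b\<in>A. \<Sum>j1\<in>UNIV. \<Sum>j2\<in>UNIV.
        vertex_weight u i1 a j1 b * vertex_weight v i2 b j2 d * V j1 j2)"
      by (rule sum.swap)
    finally show ?thesis .
  qed
qed

text \<open>Two rows compose like matrices, with the middle row \<open>bs\<close> as the summation
  index; \<open>A\<close> only keeps this sum finite.\<close>

lemma double_transfer_eq_sum:
  assumes "finite A" "\<And>a i j b. a \<in> set as \<Longrightarrow> vertex i a j = Some b \<Longrightarrow> b \<in> A"
  shows "double_transfer u v as ds i1 i2 =
    (\<Sum>bs | set bs \<subseteq> A \<and> length bs = length as. transfer u i1 as bs * transfer v i2 bs ds)"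
  using assms(2)
proof (induction as arbitrary: ds i1 i2)
  case Nil
  have "{bs. set bs \<subseteq> A \<and> length bs = length []} = {[]}" by auto
  then show ?case by (cases ds) auto
next
  case (Cons a as)
  let ?B = "{bs. set bs \<subseteq> A \<and> length bs = length as}"
  have B: "{bs. set bs \<subseteq> A \<and> length bs = length (a # as)} = (\<lambda>(b, bs). b # bs) ` (A \<times> ?B)"
    by (auto simp: length_Suc_conv image_iff)
  have inj: "inj_on (\<lambda>(b, bs). b # bs) (A \<times> ?B)" by (auto simp: inj_on_def)
  show ?case
  proof (cases ds)
    case Nil
    have "(\<Sum>bs | set bs \<subseteq> A \<and> length bs = length (a # as). transfer u i1 (a # as) bs * transfer v i2 bs ds) = 0"
      by (intro sum.neutral) (auto simp: Nil length_Suc_conv)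
    then show ?thesis by (simp add: Nil)
  next
    case ds: (Cons d ds')
    have IH: "double_transfer u v as ds' j1 j2 = (\<Sum>bs\<in>?B. transfer u j1 as bs * transfer v j2 bs ds')" for j1 j2
      by (rule Cons.IH) (meson Cons.prems list.set_intros(2))
    have "double_transfer u v (a # as) ds i1 i2 =
      (\<Sum>b\<in>A. \<Sum>j1\<in>UNIV. \<Sum>j2\<in>UNIV. vertex_weight u i1 a j1 b * vertex_weight v i2 b j2 d *
         (\<Sum>bs\<in>?B. transfer u j1 as bs * transfer v j2 bs ds'))"
      by (simp add: ds double_vertex_eq_sum[OF assms(1) Cons.prems[OF list.set_intros(1)]] IH)
    also have "\<dots> = (\<Sum>b\<in>A. \<Sum>bs\<in>?B. \<Sum>j1\<in>UNIV. \<Sum>j2\<in>UNIV.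
         (vertex_weight u i1 a j1 b * transfer u j1 as bs) * (vertex_weight v i2 b j2 d * transfer v j2 bs ds'))"
      unfolding sum_distrib_left
      by (subst sum.swap[of _ ?B], subst sum.swap[of _ ?B])
         (simp add: ac_simps)
    also have "\<dots> = (\<Sum>b\<in>A. \<Sum>bs\<in>?B. transfer u i1 (a # as) (b # bs) * transfer v i2 (b # bs) ds)"
      by (simp add: ds sum_product)
    also have "\<dots> = (\<Sum>bs | set bs \<subseteq> A \<and> length bs = length (a # as). transfer u i1 (a # as) bs * transfer v i2 bs ds)"
      unfolding B sum.reindex[OF inj] by (simp add: sum.cartesian_product split_def)
    finally show ?thesis .
  qed
qed

text \<open>\<open>e x\<close> is the edge to the left of column \<open>x\<close>, hence
  \<open>e (Suc x)\<close> is the one that tells whether column \<open>x\<close> receives a box, and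
  \<open>e C\<close> lies beyond the last column.\<close>

definition path :: "(nat \<Rightarrow> edge) \<Rightarrow> (nat \<Rightarrow> site) \<Rightarrow> (nat \<Rightarrow> site) \<Rightarrow> nat \<Rightarrow> nat \<Rightarrow> bool" where
  "path e a b c C \<longleftrightarrow> e C = Idle \<and> (\<forall>x. c \<le> x \<and> x < C \<longrightarrow> vertex (e x) (a x) (e (Suc x)) = Some (b x))"

text \<open>A vertex is determined by its two sites and its right edge, so a row of the model has at most one admissible
  sequence of edges and its partition function is a monomial.\<close>

lemma vertex_left_unique:
  assumes "vertex i a j = Some b" "vertex i' a j = Some b"
  shows "i = i'"
proof -
  obtain n f where a: "a = (n, f)" by force
  show ?thesis using assms by (cases i; cases i'; cases j; auto simp: a split: if_splits)
qed

lemma transfer_path: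
  assumes "path e a b c C" "c \<le> C"
  shows "transfer u i (map a [c..<C]) (map b [c..<C]) =
    (if i = e c then \<Prod>x=c..<C. vertex_weight u (e x) (a x) (e (Suc x)) (b x) else 0)"
  using assms(2,1)
proof (induction c arbitrary: i rule: inc_induct)
  case base
  then show ?case by (simp add: path_def)
next
  case (step c)
  have p: "path e a b (Suc c) C" and v: "vertex (e c) (a c) (e (Suc c)) = Some (b c)"
    using step by (auto simp: path_def)
  have "transfer u i (map a [c..<C]) (map b [c..<C]) =
     vertex_weight u i (a c) (e (Suc c)) (b c) * (\<Prod>x=Suc c..<C. vertex_weight u (e x) (a x) (e (Suc x)) (b x))"
    using step.hyps by (simp add: upt_conv_Cons step.IH[OF p] if_distrib sum.If_cases cong: if_cong)
  also have "\<dots> = (if i = e c then \<Prod>x=c..<C. vertex_weight u (e x) (a x) (e (Suc x)) (b x) else 0)"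
  proof (cases "i = e c")
    case True
    then show ?thesis using step.hyps by (simp add: prod.atLeast_Suc_lessThan)
  next
    case False
    then have "vertex_weight u i (a c) (e (Suc c)) (b c) = 0"
      using vertex_left_unique[OF v] by (blast intro: vertex_weight_eq_0)
    then show ?thesis using False by simp
  qed
  finally show ?case .
qed

lemma transfer_nonzero_path:
  assumes "transfer u i (map a [c..<C]) (map b [c..<C]) \<noteq> 0" "c \<le> C"
  shows "\<exists>e. path e a b c C \<and> e c = i"
  using assms(2,1)
proof (induction c arbitrary: i rule: inc_induct)
  case base
  then show ?case by (intro exI[of _ "\<lambda>_. Idle"]) (auto simp: path_def split: if_splits)
next
  case (step c)
  have "(\<Sum>j\<in>UNIV. vertex_weight u i (a c) j (b c) * transfer u j (map a [Suc c..<C]) (map b [Suc c..<C])) \<noteq> 0"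
    using step by (simp add: upt_conv_Cons)
  then obtain j where "vertex_weight u i (a c) j (b c) * transfer u j (map a [Suc c..<C]) (map b [Suc c..<C]) \<noteq> 0"
    by (rule sum.not_neutral_contains_not_neutral)
  then have j: "vertex i (a c) j = Some (b c)" "transfer u j (map a [Suc c..<C]) (map b [Suc c..<C]) \<noteq> 0"
    using vertex_weight_eq_0[of i "a c" j "b c" u] by (metis mult_zero_left, metis mult_zero_right)
  obtain e where e: "path e a b (Suc c) C" "e (Suc c) = j"
    using step.IH[OF j(2)] by blast
  show ?case
    using e j(1) step.hyps by (intro exI[of _ "e(c := i)"]) (auto simp: path_def Suc_le_eq)
qed

section \<open>Superpartitions as heights and circle columns\<close>

definition height :: "spart \<Rightarrow> nat \<Rightarrow> nat" where
  "height L c = length (filter (\<lambda>p. p > c) (fst L @ snd L))"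

text \<open>In a decreasing list the entries above \<open>c\<close> form an initial segment, so a
  column is given by a count, which does not depend on the order.\<close>

lemma diagram_rev_sort: "diagram (rev (sort xs)) = {(t, c). t < length (filter (\<lambda>p. p > c) xs)}"
proof -
  have "t < length xs \<and> c < rev (sort xs) ! t \<longleftrightarrow> t < length (filter (\<lambda>p. p > c) xs)" for t c
  proof -
    let ?ys = "rev (sort xs)"
    have "{i. i < length ?ys \<and> c < ?ys ! i} = {..<length (filter (\<lambda>p. p > c) ?ys)}"
    proof -
      have down: "c < ?ys ! i" if "i \<le> j" "j < length ?ys" "c < ?ys ! j" for i j
      proof -
        have "sorted_wrt (\<ge>) ?ys" by (simp add: sorted_wrt_rev)
        then have "?ys ! j \<le> ?ys ! i"
          using that by (cases "i = j") (auto simp: sorted_wrt_iff_nth_less)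
        then show ?thesis using that by simp
      qed
      let ?I = "{i. i < length ?ys \<and> c < ?ys ! i}"
      have "card ?I = length (filter (\<lambda>p. p > c) ?ys)"
        by (simp add: length_filter_conv_card)
      moreover have "?I = {..<card ?I}"
      proof (rule ccontr)
        assume ne: "?I \<noteq> {..<card ?I}"
        have fin: "finite ?I" by simp
        have "\<not> ?I \<subseteq> {..<card ?I}"
          using ne card_subset_eq[of "{..<card ?I}" ?I] by (metis card_lessThan finite_lessThan)
        then obtain j where j: "j \<in> ?I" "j \<ge> card ?I" by (meson lessThan_iff not_le subsetI)
        then have "{..j} \<subseteq> ?I" using down by auto
        then have "card {..j} \<le> card ?I" using fin by (intro card_mono)
        then show False using j(2) by simp
      qed
      ultimately show ?thesis by simp
    qed
    then have "t \<in> {i. i < length ?ys \<and> c < ?ys ! i} \<longleftrightarrow> t \<in> {..<length (filter (\<lambda>p. p > c) ?ys)}"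
      by (rule arg_cong)
    moreover have "length (filter (\<lambda>p. p > c) ?ys) = length (filter (\<lambda>p. p > c) xs)"
      by (simp add: rev_filter[symmetric] filter_sort)
    ultimately show ?thesis by simp
  qed
  then show ?thesis by (auto simp: diagram_def)
qed

lemma boxes_eq: "boxes L = {(t, c). t < height L c}"
  by (simp add: boxes_def sp_plus_def diagram_rev_sort height_def)

lemma distinct_fst: "superpartition L \<Longrightarrow> distinct (fst L)"
  using strict_sorted_iff[of "rev (fst L)"] by (simp add: superpartition_def sorted_wrt_rev)

text \<open>Raising a part \<open>p\<close> to \<open>Suc p\<close> adds one cell to column
  \<open>p\<close> and to no other. The parts in \<open>fst L\<close> are distinct, so each circle
  is a single cell at the foot of its column.\<close>

lemma circles_eq:
  assumes "superpartition L"
  shows "circles L = {(height L c, c) | c. c \<in> set (fst L)}"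
proof -
  have 1: "length (filter (\<lambda>p. p > c) (map Suc xs)) =
      length (filter (\<lambda>p. p > c) xs) + (if c \<in> set xs then 1 else 0)" if "distinct xs" for xs :: "nat list" and c
    using that by (induction xs) (auto simp: less_Suc_eq)
  have "diagram (sp_oplus L) = {(t, c). t < height L c + (if c \<in> set (fst L) then 1 else 0)}"
    unfolding sp_oplus_def diagram_rev_sort filter_append length_append 1[OF distinct_fst[OF assms]] height_def
    by (auto simp: split_def)
  then show ?thesis
    unfolding circles_def boxes_def[symmetric] boxes_eq by (auto split: if_splits)
qed

lemma height_antimono: "c \<le> d \<Longrightarrow> height L d \<le> height L c"
proof -
  assume "c \<le> d"
  then have "length (filter (\<lambda>p. p > d) xs) \<le> length (filter (\<lambda>p. p > c) xs)" for xs :: "nat list"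
    by (induction xs) auto
  then show ?thesis unfolding height_def .
qed

text \<open>A circle in column \<open>d\<close> ends a part of size \<open>d\<close>, which is
  counted in column \<open>c\<close> but not in column \<open>d\<close>.\<close>

lemma height_strict:
  assumes "d \<in> set (fst L)" "c < d"
  shows "height L d < height L c"
proof -
  have *: "length (filter (\<lambda>p. p > d) xs) \<le> length (filter (\<lambda>p. p > c) xs) \<and>
     (d \<in> set xs \<longrightarrow> length (filter (\<lambda>p. p > d) xs) < length (filter (\<lambda>p. p > c) xs))" for xs :: "nat list"
    using assms(2) by (induction xs) auto
  show ?thesis using assms(1) *[of "fst L"] *[of "snd L"] unfolding height_def by simp
qed

lemma height_eq_0: "(\<And>p. p \<in> set (fst L) \<union> set (snd L) \<Longrightarrow> p < C) \<Longrightarrow> C \<le> Suc c \<Longrightarrow> height L c = 0"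
  unfolding height_def by (auto simp: filter_empty_conv) force+

lemma sum_height:
  assumes "\<And>p. p \<in> set (fst L) \<union> set (snd L) \<Longrightarrow> p \<le> C"
  shows "(\<Sum>c<C. height L c) = sdegree L"
proof -
  have *: "(\<Sum>c<C. length (filter (\<lambda>p. p > c) xs)) = sum_list xs" if "\<And>p. p \<in> set xs \<Longrightarrow> p \<le> C" for xs
    using that
  proof (induction xs)
    case (Cons x xs)
    have "(\<Sum>c<C. length (filter (\<lambda>p. p > c) (x # xs))) =
      (\<Sum>c<C. of_bool (c < x) + length (filter (\<lambda>p. p > c) xs))"
      by (intro sum.cong) auto
    also have "\<dots> = card ({..<C} \<inter> {c. c < x}) + sum_list xs"
      using Cons by (simp add: sum.distrib)
    also have "{..<C} \<inter> {c. c < x} = {..<x}" using Cons.prems[of x] by auto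
    finally show ?case by simp
  qed simp
  show ?thesis unfolding height_def
    by (subst *) (use assms in \<open>auto simp: sdegree_def\<close>)
qed

lemma superpartition_eqI:
  assumes "superpartition K" "superpartition L" "height K = height L" "set (fst K) = set (fst L)"
  shows "K = L"
proof -
  have srt: "x = y" if "sorted_wrt (>) x" "sorted_wrt (>) y" "set x = set y" for x y :: "nat list"
    using that by (metis rev_is_rev_conv set_rev sorted_wrt_rev strict_sorted_equal)
  have 1: "fst K = fst L"
    using srt assms(1,2,4) by (auto simp: superpartition_def)
  have cnt: "length (filter (\<lambda>p. p > c) (snd K)) = length (filter (\<lambda>p. p > c) (snd L))" for c
    using fun_cong[OF assms(3), of c] 1 by (simp add: height_def)
  have split: "length (filter (\<lambda>p. p > c) xs) = length (filter (\<lambda>p. p > Suc c) xs) + count_list xs (Suc c)"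
    for c and xs :: "nat list"
    by (induction xs) auto
  have "count (mset (snd K)) p = count (mset (snd L)) p" for p
  proof (cases p)
    \<comment> \<open>Heights cannot see parts of size 0, but \<open>snd\<close> has none.\<close>
    case 0
    then show ?thesis
      using assms(1,2) by (metis count_eq_zero_iff not_one_le_zero set_mset_mset superpartition_def)
  next
    case (Suc c)
    then show ?thesis
      using split[of c "snd K"] split[of c "snd L"] cnt[of c] cnt[of "Suc c"] by (simp add: count_mset)
  qed
  then have "mset (snd K) = mset (snd L)" by (rule multiset_eqI)
  moreover have "sorted (rev (snd K))" "sorted (rev (snd L))"
    using assms(1,2) by (auto simp: superpartition_def sorted_wrt_rev)
  ultimately have "snd K = snd L"
    by (metis mset_rev properties_for_sort rev_is_rev_conv)
  with 1 show ?thesis by (simp add: prod_eq_iff)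
qed

section \<open>Moves of circles as paths of the model\<close>

text \<open>Here \<open>A c\<close> is the number of rows of length at least \<open>c\<close>, so that column \<open>c\<close> has height \<open>A (Suc c)\<close>, and \<open>F\<close> is the
  set of circle columns.\<close>

definition sites :: "(nat \<Rightarrow> nat) \<Rightarrow> nat set \<Rightarrow> nat \<Rightarrow> site" where
  "sites A F c = (A c - A (Suc c), c \<in> F)"

text \<open>A circle in column \<open>c\<close> moves to the row \<open>B (Suc c)\<close> of the new top of its column: row \<open>A (Suc c)\<close> receives a box
  if and only if column \<open>c\<close> does.\<close>

definition plain_move :: "(nat \<Rightarrow> nat) \<Rightarrow> nat set \<Rightarrow> (nat \<Rightarrow> nat) \<Rightarrow> nat set \<Rightarrow> bool" where
  "plain_move A F B G \<longleftrightarrow> (\<forall>c. A c \<le> B c \<and> B c \<le> Suc (A c)) \<and>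
     inj_on (\<lambda>c. B (Suc c)) F \<and> (\<lambda>c. B (Suc c)) ` F = (\<lambda>c. B (Suc c)) ` G"

text \<open>The columns of the addable cells: some row has length exactly \<open>c\<close>.\<close>

definition corners :: "(nat \<Rightarrow> nat) \<Rightarrow> nat set" where
  "corners A = {c. A (Suc c) < A c}"

lemma corner_eqI:
  assumes "antimono B" "B (Suc c) = B (Suc d)" "c \<in> corners B" "d \<in> corners B"
  shows "c = d"
proof (rule ccontr)
  assume "c \<noteq> d"
  then consider "Suc c \<le> d" | "Suc d \<le> c" by linarith
  then show False
    by cases (use assms antimonoD[OF assms(1)] in \<open>fastforce simp: corners_def\<close>)+
qed

text \<open>\<open>B (Suc d) = B c\<close> means that columns \<open>c - 1\<close> to
  \<open>d\<close> of the new shape are equally high. The circle of column \<open>d\<close>, once in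
  the row at their foot, therefore slides left past the edge \<open>c\<close>.\<close>

definition move_edge :: "(nat \<Rightarrow> nat) \<Rightarrow> nat set \<Rightarrow> (nat \<Rightarrow> nat) \<Rightarrow> nat \<Rightarrow> edge" where
  "move_edge A F B c = (if B c = Suc (A c) then Push
     else if \<exists>d\<in>F. c \<le> d \<and> B (Suc d) = B c then Carry else Idle)"

text \<open>A circle found in column \<open>c\<close> of the new shape was there before or arrives
  through the right edge as \<open>Carry\<close>. So the new site is a function of the old one and
  of the two adjacent edges.\<close>

lemma plain_move_path:
  assumes mono: "antimono A" "antimono B" and F: "F \<subseteq> corners A" and G: "G \<subseteq> corners B"
    and mv: "plain_move A F B G" and C: "A C = B C" "F \<subseteq> {..<C}"
  shows "path (move_edge A F B) (sites A F) (sites B G) 0 C"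
proof -
  have AB: "A c \<le> B c" "B c \<le> Suc (A c)" for c using mv by (auto simp: plain_move_def)
  have A: "A d \<le> A c" and B: "B d \<le> B c" if "c \<le> d" for c d
    using that by (auto intro: antimonoD[OF mono(1)] antimonoD[OF mono(2)])
  have inj: "c = d" if "c \<in> F" "d \<in> F" "B (Suc c) = B (Suc d)" for c d
    using mv that by (auto simp: plain_move_def dest: inj_onD)
  have FA: "A (Suc d) < A d" if "d \<in> F" for d using F that by (auto simp: corners_def)
  have GB: "c \<in> G \<longleftrightarrow> B (Suc c) < B c \<and> (\<exists>d\<in>F. B (Suc d) = B (Suc c))" for c
  proof
    assume c: "c \<in> G"
    then have "B (Suc c) \<in> (\<lambda>c. B (Suc c)) ` F" using mv by (auto simp: plain_move_def)
    then show "B (Suc c) < B c \<and> (\<exists>d\<in>F. B (Suc d) = B (Suc c))" using c G by (auto simp: corners_def)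
  next
    assume c: "B (Suc c) < B c \<and> (\<exists>d\<in>F. B (Suc d) = B (Suc c))"
    then have "B (Suc c) \<in> (\<lambda>c. B (Suc c)) ` F" by (metis image_eqI)
    then have "B (Suc c) \<in> (\<lambda>c. B (Suc c)) ` G" using mv by (simp add: plain_move_def)
    then obtain d where "d \<in> G" "B (Suc d) = B (Suc c)" by auto
    with c G have "d = c" using corner_eqI[OF mono(2), of d c] by (auto simp: corners_def)
    with \<open>d \<in> G\<close> show "c \<in> G" by simp
  qed
  \<comment> \<open>Columns to the left of a corner \<open>c\<close> are strictly higher than column
    \<open>c\<close>, so no circle starting there can end in column \<open>c\<close>: circles never
    move right.\<close>
  have G1: "c \<in> G \<longleftrightarrow> B (Suc c) < B c \<and> (c \<in> F \<or> (\<exists>d\<in>F. Suc c \<le> d \<and> B (Suc d) = B (Suc c)))" for c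
  proof (cases "B (Suc c) < B c")
    case True
    have "Suc c \<le> d \<or> d = c" if "B (Suc d) = B (Suc c)" for d
    proof (rule ccontr)
      assume "\<not> (Suc c \<le> d \<or> d = c)"
      then have "B c \<le> B (Suc d)" by (intro B) simp
      with that True show False by simp
    qed
    then have "(\<exists>d\<in>F. B (Suc d) = B (Suc c)) \<longleftrightarrow> c \<in> F \<or> (\<exists>d\<in>F. Suc c \<le> d \<and> B (Suc d) = B (Suc c))"
      by metis
    then show ?thesis using GB[of c] by simp
  next
    case False
    then show ?thesis using GB[of c] by simp
  qed
  \<comment> \<open>A circle further right sits at a corner, so its column was lower than column
    \<open>c\<close> by at least one; even with a new box it stays below the raised column
    \<open>c\<close>. Hence \<open>Push\<close> and \<open>Carry\<close> exclude each other on an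
    edge.\<close>
  have far: "B (Suc d) < B (Suc c)" if "d \<in> F" "Suc c \<le> d" "B (Suc c) = Suc (A (Suc c))" for c d
    using FA[OF that(1)] A[OF that(2)] AB(2)[of "Suc d"] that(3) by simp
  have "vertex (move_edge A F B c) (sites A F c) (move_edge A F B (Suc c)) = Some (sites B G c)" for c
  proof -
    have le: "A (Suc c) \<le> A c" "B (Suc c) \<le> B c" by (auto intro: A B)
    define D where "D \<longleftrightarrow> (\<exists>d\<in>F. c \<le> d \<and> B (Suc d) = B c)"
    define D' where "D' \<longleftrightarrow> (\<exists>d\<in>F. Suc c \<le> d \<and> B (Suc d) = B (Suc c))"
    have G2: "c \<in> G \<longleftrightarrow> B (Suc c) < B c \<and> (c \<in> F \<or> D')" using G1[of c] D'_def by simp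
    have D: "B c = B (Suc c) \<and> (c \<in> F \<or> D')" if asmD: "D"
    proof -
      obtain d where d: "d \<in> F" "c \<le> d" "B (Suc d) = B c" using asmD D_def by blast
      have "B (Suc d) \<le> B (Suc c)" using d by (intro B) auto
      then have "B c = B (Suc c)" using d le by simp
      moreover have "d = c \<or> Suc c \<le> d" using d(2) by auto
      ultimately show ?thesis using d D'_def by auto
    qed
    have D1: "D" if asm: "B c = B (Suc c)" "c \<in> F \<or> D'"
    proof (cases "c \<in> F")
      case True
      then show ?thesis unfolding D_def using asm(1) by (intro bexI[of _ c]) simp_all
    next
      case False
      then obtain d where "d \<in> F" "Suc c \<le> d" "B (Suc d) = B (Suc c)" using asm(2) D'_def by blast
      then show ?thesis unfolding D_def using asm(1) by (intro bexI[of _ d]) simp_all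
    qed
    have excl: "\<not> D'" if "c \<in> F"
    proof
      assume D'
      then obtain d where "d \<in> F" "Suc c \<le> d" "B (Suc d) = B (Suc c)" using D'_def by blast
      with inj[of c d] that show False by simp
    qed
    have nD': "\<not> D'" if asm: "B (Suc c) = Suc (A (Suc c))"
    proof
      assume D'
      then obtain d where "d \<in> F" "Suc c \<le> d" "B (Suc d) = B (Suc c)" using D'_def by blast
      with far[of d c] asm show False by simp
    qed
    have e: "move_edge A F B c = (if B c = Suc (A c) then Push else if D then Carry else Idle)"
       "move_edge A F B (Suc c) = (if B (Suc c) = Suc (A (Suc c)) then Push else if D' then Carry else Idle)"
      by (simp_all add: move_edge_def D_def D'_def)
    have FA': "c \<in> F \<Longrightarrow> A (Suc c) < A c" by (rule FA)
    have rows: "B c = A c \<or> B c = Suc (A c)" "B (Suc c) = A (Suc c) \<or> B (Suc c) = Suc (A (Suc c))"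
      using AB[of c] AB[of "Suc c"] by linarith+
    show ?thesis
    proof (cases "B c = Suc (A c)")
      case s: True
      then have lt: "B (Suc c) < B c" if "B (Suc c) = A (Suc c)" using le that by simp
      show ?thesis
      proof (cases "B (Suc c) = Suc (A (Suc c))")
        case True
        then have "c \<in> G \<longleftrightarrow> c \<in> F" using G2 nD' FA' s by auto
        then show ?thesis using True s by (simp add: e sites_def)
      next
        case False
        then have t: "B (Suc c) = A (Suc c)" using rows by simp
        then have g: "c \<in> G \<longleftrightarrow> c \<in> F \<or> D'" using G2 lt by simp
        show ?thesis using g excl t s le by (cases D') (auto simp: e sites_def)
      qed
    next
      case False
      then have s: "B c = A c" using rows by simp
      show ?thesis
      proof (cases "B (Suc c) = Suc (A (Suc c))")
        case t: True
        then have nd': "\<not> D'" by (rule nD')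
        show ?thesis
        proof (cases D)
          case True
          then show ?thesis using D nd' G2 s t by (auto simp: e sites_def)
        next
          case nD: False
          then have "c \<in> F \<Longrightarrow> B c \<noteq> B (Suc c)" using D1 by blast
          then have "c \<in> F \<Longrightarrow> B (Suc c) < B c" using le by linarith
          moreover have "A (Suc c) < A c" using s t le by simp
          ultimately show ?thesis using nD G2 nd' s t by (auto simp: e sites_def)
        qed
      next
        case False
        then have t: "B (Suc c) = A (Suc c)" using rows by simp
        show ?thesis
        proof (cases D)
          case True
          then have "B c = B (Suc c)" "c \<notin> F" "D'" using D FA' s t by auto
          then show ?thesis using True G2 s t by (auto simp: e sites_def)
        next
          case nD: False
          show ?thesis
          proof (cases D')
            case True
            then have "c \<notin> F" "B c \<noteq> B (Suc c)" using excl nD D1 by blast+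
            then have "c \<notin> F" "B (Suc c) < B c" using le by linarith+
            then show ?thesis using True nD G2 s t by (auto simp: e sites_def)
          next
            case False
            then show ?thesis using FA' nD G2 s t by (auto simp: e sites_def)
          qed
        qed
      qed
    qed
  qed
  moreover have "move_edge A F B C = Idle"
  proof -
    have "\<not> (\<exists>d\<in>F. C \<le> d \<and> B (Suc d) = B C)" using C(2) by auto
    then show ?thesis using C(1) by (simp add: move_edge_def)
  qed
  ultimately show ?thesis by (simp add: path_def)
qed

section \<open>From paths back to moves of circles\<close>

definition boxes_added :: "edge \<Rightarrow> nat" where
  "boxes_added j = of_bool (j = Push \<or> j = Fresh)"

lemma vertex_rows:
  assumes "vertex i (n, f) j = Some (n', f')"
  shows "n' + boxes_added j = n + boxes_added i"
  using assms by (cases i; cases j; auto simp: boxes_added_def split: if_splits)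

text \<open>The conservation law \<open>vertex_rows\<close> telescopes from the right end, where the
  two shapes agree.\<close>

lemma path_rows:
  assumes "path e (sites A F) (sites B G) 0 C" "antimono A" "antimono B" "A C = B C" "c \<le> C"
  shows "B c = A c + boxes_added (e c)"
  using assms(5)
proof (induction c rule: inc_induct)
  case base
  then show ?case using assms by (simp add: path_def boxes_added_def)
next
  case (step c)
  have "vertex (e c) (sites A F c) (e (Suc c)) = Some (sites B G c)"
    using assms(1) step.hyps by (simp add: path_def)
  from vertex_rows[OF this[unfolded sites_def]]
  have "B c - B (Suc c) + boxes_added (e (Suc c)) = A c - A (Suc c) + boxes_added (e c)" .
  moreover have "A (Suc c) \<le> A c" "B (Suc c) \<le> B c" by (auto intro: antimonoD[OF assms(2)] antimonoD[OF assms(3)])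
  ultimately show ?case using step.IH by simp
qed

lemma path_plain_move:
  assumes p: "path e (sites A F) (sites B G) 0 C" and mono: "antimono A" "antimono B"
    and F: "F \<subseteq> corners A" "F \<subseteq> {..<C}" and G: "G \<subseteq> corners B" "G \<subseteq> {..<C}"
    and C: "\<And>c. C \<le> c \<Longrightarrow> A c = B c" and nF: "e 0 \<noteq> Fresh" and e0: "e 0 \<noteq> Carry"
  shows "plain_move A F B G"
proof -
  have v: "vertex (e c) (A c - A (Suc c), c \<in> F) (e (Suc c)) = Some (B c - B (Suc c), c \<in> G)" if "c < C" for c
    using p that by (simp add: path_def sites_def)
  \<comment> \<open>No vertex creates \<open>Fresh\<close>: it stands on a right edge only if it
    stands on the left edge, so it must enter at edge 0.\<close>
  have nF: "e c \<noteq> Fresh" if "c \<le> C" for c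
    using that
  proof (induction c)
    case (Suc c)
    then have "e c \<noteq> Fresh" by simp
    then show ?case using v[of c] Suc.prems by (cases "e c"; cases "e (Suc c)") auto
  qed (rule nF)
  have rows: "B c = A c + boxes_added (e c)" if "c \<le> C" for c
    by (rule path_rows[OF p mono C that]) simp
  have AB: "A c \<le> B c \<and> B c \<le> Suc (A c)" for c
    using rows[of c] C[of c] by (cases "c \<le> C") (auto simp: boxes_added_def)
  have A: "A d \<le> A c" and B: "B d \<le> B c" if "c \<le> d" for c d
    using that by (auto intro: antimonoD[OF mono(1)] antimonoD[OF mono(2)])
  let ?h = "\<lambda>c. B (Suc c)"
  let ?F = "\<lambda>c. {d\<in>F. c \<le> d}" and ?G = "\<lambda>c. {d\<in>G. c \<le> d}"
  \<comment> \<open>Balance of circles to the right of edge \<open>c\<close>: the rows reached by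
    the old circles are those of the new circles, except that a circle leaving through
    \<open>Carry\<close> contributes the extra row \<open>B c\<close>. At edge 0 nothing
    leaves.\<close>
  have main: "inj_on ?h (?F c) \<and> (if e c = Carry then ?h ` ?F c = insert (B c) (?h ` ?G c)
      else ?h ` ?F c = ?h ` ?G c \<and> (\<forall>d\<in>?F c. ?h d < B c))" if "c \<le> C" for c
    using that
  proof (induction c rule: inc_induct)
    case base
    have e: "?F C = {}" "?G C = {}" using F(2) G(2) by auto
    show ?case unfolding e using p by (simp add: path_def)
  next
    case (step c)
    have Fc: "?F c = (if c \<in> F then insert c (?F (Suc c)) else ?F (Suc c))"
      and Gc: "?G c = (if c \<in> G then insert c (?G (Suc c)) else ?G (Suc c))"
      by (auto simp: Suc_le_eq order_le_less)
    have le: "A (Suc c) \<le> A c" "B (Suc c) \<le> B c" by (auto intro: A B)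
    have hle: "?h d \<le> B (Suc c)" if "d \<in> ?F (Suc c)" for d by (rule B) (use that in auto)
    have far: "?h d < B (Suc c)" if "d \<in> ?G (Suc c)" for d
      using that G(1) B[of "Suc c" d] by (auto simp: corners_def)
    have AF: "c \<in> F \<Longrightarrow> A (Suc c) < A c" using F by (auto simp: corners_def)
    have BG: "c \<in> G \<Longrightarrow> B (Suc c) < B c" using G by (auto simp: corners_def)
    have r: "B c = A c + boxes_added (e c)" "B (Suc c) = A (Suc c) + boxes_added (e (Suc c))"
      using step.hyps by (auto intro: rows)
    let ?F' = "?F (Suc c)" and ?G' = "?G (Suc c)"
    have IH: "inj_on ?h ?F'" "e (Suc c) = Carry \<Longrightarrow> ?h ` ?F' = insert (B (Suc c)) (?h ` ?G')"
      "e (Suc c) \<noteq> Carry \<Longrightarrow> ?h ` ?F' = ?h ` ?G'"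
      "\<And>d. e (Suc c) \<noteq> Carry \<Longrightarrow> d \<in> ?F' \<Longrightarrow> ?h d < B (Suc c)"
      using step.IH by (simp_all split: if_splits)
    have not_in: "B (Suc c) \<notin> ?h ` ?F'" if "e (Suc c) \<noteq> Carry" using IH(4)[OF that] by force
    consider "e c \<noteq> Carry" "e (Suc c) \<noteq> Carry" "c \<in> F \<longleftrightarrow> c \<in> G"
      | "e c \<noteq> Carry" "e (Suc c) = Carry" "c \<notin> F" "c \<in> G"
      | "e c = Carry" "e (Suc c) = Carry" "c \<notin> F" "c \<notin> G" "B c = B (Suc c)"
      | "e c = Carry" "e (Suc c) \<noteq> Carry" "c \<in> F" "c \<notin> G" "B c = B (Suc c)"
      using v[OF step.hyps(2)] nF[of c] step.hyps le AF
      by (cases "e c"; cases "e (Suc c)") (auto split: if_splits)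
    then show ?case
    proof cases
      case 1
      have "?h d < B c" if "d \<in> ?F c" for d
        using that IH(4)[OF 1(2), of d] BG 1(3) le by (auto simp: Fc split: if_splits)
      then show ?thesis using 1 IH(1,3) not_in by (auto simp: Fc Gc)
    next
      case 2
      have "?h d < B c" if "d \<in> ?F c" for d
        using that 2 hle[of d] BG by (auto simp: Fc)
      then show ?thesis using 2 IH(1,2) by (auto simp: Fc Gc)
    next
      case 3
      then show ?thesis using IH(1,2) by (simp add: Fc Gc)
    next
      case 4
      then show ?thesis using IH(1,3) not_in by (auto simp: Fc Gc)
    qed
  qed
  from main[of 0] e0 have "inj_on ?h F" "?h ` F = ?h ` G" by auto
  then show ?thesis using AB by (simp add: plain_move_def)
qed

lemma card_fst: "superpartition L \<Longrightarrow> card (set (fst L)) = df L"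
  by (simp add: df_def distinct_card distinct_fst)

section \<open>Steps of tableaux as paths of the model\<close>

definition strip :: "spart \<Rightarrow> spart \<Rightarrow> bool" where
  "strip K L \<longleftrightarrow> (\<forall>c. height K c \<le> height L c \<and> height L c \<le> Suc (height K c))"

lemma strip_cases:
  assumes "strip K L"
  obtains "height L c = height K c" | "height L c = Suc (height K c)"
  using assms[unfolded strip_def, rule_format, of c] by linarith

lemma boxes_diff: "boxes L - boxes K = {(t, c). height K c \<le> t \<and> t < height L c}"
  by (auto simp: boxes_eq)

lemma strip_boxes_diff:
  assumes "strip K L"
  shows "boxes L - boxes K = (\<lambda>c. (height K c, c)) ` {c. height K c < height L c}"
proof -
  have "height K c \<le> t \<and> t < height L c \<longleftrightarrow> t = height K c \<and> height K c < height L c" for t c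
    using assms[unfolded strip_def, rule_format, of c] by linarith
  then show ?thesis unfolding boxes_diff by auto
qed

lemma strip_degree:
  assumes "strip K L"
  shows "card (boxes L - boxes K) + sdegree K = sdegree L"
proof -
  obtain C where C: "\<And>p. p \<in> set (fst K) \<union> set (snd K) \<union> set (fst L) \<union> set (snd L) \<Longrightarrow> p \<le> C"
    using finite_nat_set_iff_bounded_le[of "set (fst K) \<union> set (snd K) \<union> set (fst L) \<union> set (snd L)"] by auto
  have "c < C" if "height K c < height L c" for c
    using that height_eq_0[of L "Suc C" c] C by (force simp: less_Suc_eq_le)
  then have eq: "{c. height K c < height L c} = {c \<in> {..<C}. height K c < height L c}" by auto
  have "card (boxes L - boxes K) = card {c. height K c < height L c}"
    unfolding strip_boxes_diff[OF assms] by (intro card_image) (auto simp: inj_on_def)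
  also have "\<dots> = (\<Sum>c<C. of_bool (height K c < height L c))"
    unfolding eq by (simp add: Int_def)
  finally have "card (boxes L - boxes K) + (\<Sum>c<C. height K c) =
      (\<Sum>c<C. of_bool (height K c < height L c) + height K c)"
    by (simp add: sum.distrib)
  also have "\<dots> = (\<Sum>c<C. height L c)"
  proof (intro sum.cong refl)
    fix c show "of_bool (height K c < height L c) + height K c = height L c"
      by (rule strip_cases[OF assms, of c]) simp_all
  qed
  finally show ?thesis using sum_height[of K C] sum_height[of L C] C by simp
qed

lemma horizontal_strip_iff:
  "horizontal_strip r (boxes K) (boxes L) \<longleftrightarrow> strip K L \<and> sdegree L = sdegree K + r"
proof -
  have "strip K L" if "horizontal_strip r (boxes K) (boxes L)"
    unfolding strip_def
  proof (intro allI conjI)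
    fix c
    show "height K c \<le> height L c"
    proof (rule ccontr)
      assume "\<not> height K c \<le> height L c"
      then have "(height L c, c) \<in> boxes K - boxes L" by (simp add: boxes_eq)
      then show False using that by (auto simp: horizontal_strip_def)
    qed
    show "height L c \<le> Suc (height K c)"
    proof (rule ccontr)
      assume "\<not> height L c \<le> Suc (height K c)"
      then have "(height K c, c) \<in> boxes L - boxes K" "(Suc (height K c), c) \<in> boxes L - boxes K"
        by (simp_all add: boxes_eq)
      moreover have "inj_on snd (boxes L - boxes K)" using that by (simp add: horizontal_strip_def)
      ultimately show False using inj_onD[of snd _ "(height K c, c)" "(Suc (height K c), c)"] by fastforce
    qed
  qed
  moreover have "horizontal_strip r (boxes K) (boxes L) \<longleftrightarrow> sdegree L = sdegree K + r" if s: "strip K L"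
  proof -
    have "boxes K \<subseteq> boxes L" using s by (auto simp: boxes_eq strip_def intro: order_less_le_trans)
    moreover have "inj_on snd (boxes L - boxes K)"
      unfolding strip_boxes_diff[OF s] by (auto simp: inj_on_def)
    ultimately show ?thesis using strip_degree[OF s] by (auto simp: horizontal_strip_def)
  qed
  ultimately show ?thesis by blast
qed

lemma inj_on_height: "inj_on (height L) (set (fst L))"
  by (rule inj_onI) (metis height_strict linorder_neqE_nat less_irrefl)

text \<open>A strip fills a row from its first free cell, which for a circle's row is the circle
  itself. So that row receives a box exactly when the circle's column does, and the prescribed new
  row is \<open>height L c\<close>. This rule preserves the order of the circles, so matching them
  by index reduces to an equality of sets of rows.\<close>

lemma circles_follow_iff:
  assumes "strip K L" and F': "F' \<subseteq> set (fst L)"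
  shows "circles_follow (boxes L - boxes K) {(height K c, c) | c. c \<in> set (fst K)} {(height L c, c) | c. c \<in> F'}
    \<longleftrightarrow> card F' = card (set (fst K)) \<and> height L ` F' = height L ` set (fst K)"
proof -
  let ?F = "set (fst K)" and ?D = "boxes L - boxes K"
  let ?C = "{(height K c, c) | c. c \<in> ?F}" and ?C' = "{(height L c, c) | c. c \<in> F'}"
  define g where "g t = (if t \<in> fst ` ?D then Suc t else t)" for t
  have fin: "finite F'" using F' by (rule finite_subset) simp
  have C: "?C = (\<lambda>c. (height K c, c)) ` ?F" "?C' = (\<lambda>c. (height L c, c)) ` F'" by auto
  have card: "card ?C = card ?F" "card ?C' = card F'"
    unfolding C by (auto intro!: card_image inj_onI)
  have rows: "circle_rows ?C = sorted_list_of_set (height K ` ?F)" "circle_rows ?C' = sorted_list_of_set (height L ` F')"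
    unfolding C circle_rows_def by (simp_all add: image_image)
  have inj: "inj_on (height K) ?F" "inj_on (height L) F'"
    using inj_on_height inj_on_subset[OF inj_on_height F'] by auto
  have len: "length (circle_rows ?C) = card ?F" "length (circle_rows ?C') = card F'"
    unfolding rows by (simp_all add: card_image inj fin)
  have g: "g (height K c) = height L c" if "c \<in> ?F" for c
  proof -
    have st: "height K c \<le> height L c" "height L c \<le> Suc (height K c)" using assms(1) by (auto simp: strip_def)
    have "height K c \<in> fst ` ?D \<longleftrightarrow> (\<exists>d. height K d = height K c \<and> height K d < height L d)"
      unfolding strip_boxes_diff[OF assms(1)] by (auto simp: image_iff)
    also have "\<dots> \<longleftrightarrow> height K c < height L c"
    proof
      assume "\<exists>d. height K d = height K c \<and> height K d < height L d"
      then obtain d where d: "height K d = height K c" "height K d < height L d" by auto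
      then have "c \<le> d" using height_strict[OF that, of d] by (cases "c \<le> d") auto
      then show "height K c < height L c" using height_antimono[of c d L] d by simp
    qed auto
    finally show ?thesis using st by (auto simp: g_def)
  qed
  have follow: "circles_follow ?D ?C ?C' \<longleftrightarrow> card F' = card ?F \<and> circle_rows ?C' = map g (circle_rows ?C)"
    unfolding circles_follow_def card g_def[symmetric] by (auto simp: list_eq_iff_nth_eq len)
  have img: "g ` set (circle_rows ?C) = height L ` ?F"
    by (auto simp: rows image_image g)
  show ?thesis
    unfolding follow
  proof (intro conj_cong refl)
    assume cd: "card F' = card ?F"
    show "circle_rows ?C' = map g (circle_rows ?C) \<longleftrightarrow> height L ` F' = height L ` ?F"
    proof
      assume "circle_rows ?C' = map g (circle_rows ?C)"
      then have "set (circle_rows ?C') = g ` set (circle_rows ?C)" by simp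
      then show "height L ` F' = height L ` ?F" unfolding img by (simp add: rows fin)
    next
      assume im: "height L ` F' = height L ` ?F"
      have "sorted (map g (circle_rows ?C))"
      proof -
        have "g s \<le> g t" if "s < t" for s t using that by (auto simp: g_def)
        moreover have "sorted_wrt (<) (circle_rows ?C)" by (simp add: rows)
        ultimately show ?thesis
          by (simp add: sorted_wrt_map) (metis (mono_tags, lifting) sorted_wrt_mono_rel)
      qed
      moreover have "distinct (map g (circle_rows ?C))"
      \<comment> \<open>By itself \<open>g\<close> could merge two neighbouring rows; the size of
        the image rules this out.\<close>
      proof (rule card_distinct)
        have "card (set (map g (circle_rows ?C))) = card (height L ` F')" by (simp add: img im)
        then show "card (set (map g (circle_rows ?C))) = length (map g (circle_rows ?C))"
          by (simp add: card_image inj cd len)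
      qed
      moreover have "set (map g (circle_rows ?C)) = height L ` F'" by (simp add: img im)
      ultimately show "circle_rows ?C' = map g (circle_rows ?C)"
        unfolding rows by (metis sorted_list_of_set.idem_if_sorted_distinct)
    qed
  qed
qed

definition plain_strip :: "spart \<Rightarrow> spart \<Rightarrow> bool" where
  "plain_strip K L \<longleftrightarrow> strip K L \<and> df L = df K \<and> height L ` set (fst L) = height L ` set (fst K)"

definition barred_strip :: "nat \<Rightarrow> spart \<Rightarrow> spart \<Rightarrow> bool" where
  "barred_strip q K L \<longleftrightarrow> strip K L \<and> df L = Suc (df K) \<and> q \<in> set (fst L) \<and> height L q = height K q \<and>
     (\<forall>c<q. height L c = Suc (height K c)) \<and> height L ` (set (fst L) - {q}) = height L ` set (fst K)"

lemma tableau_step_Plain: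
  assumes "superpartition K" "superpartition L"
  shows "tableau_step K L (Plain r) \<longleftrightarrow> plain_strip K L \<and> sdegree L = sdegree K + r"
  using circles_follow_iff[of K L "set (fst L)"]
  by (auto simp: horizontal_strip_iff plain_strip_def circles_eq assms card_fst)

lemma new_circle_iff:
  assumes "superpartition L" "strip K L"
  shows "new_circle K L p \<longleftrightarrow> (\<exists>q. p = (height L q, q) \<and> q \<in> set (fst L) \<and> height L q = height K q \<and>
     (\<forall>c<q. height L c = Suc (height K c)))"
proof -
  have D: "snd ` (boxes L - boxes K) = {c. height K c < height L c}"
    unfolding strip_boxes_diff[OF assms(2)] by (auto simp: image_image)
  have "\<not> height K c < height L c \<longleftrightarrow> height L c = height K c"
       "height K c < height L c \<longleftrightarrow> height L c = Suc (height K c)" for c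
    using assms(2)[unfolded strip_def, rule_format, of c] by linarith+
  then show ?thesis
    unfolding new_circle_def circles_eq[OF assms(1)] D by (auto simp: split_def)
qed

text \<open>\<open>q\<close> is forced to be the first column without a new box.\<close>

lemma barred_strip_unique: "barred_strip q K L \<Longrightarrow> barred_strip q' K L \<Longrightarrow> q = q'"
  unfolding barred_strip_def by (metis linorder_neqE_nat n_not_Suc_n)

lemma barred_strip_new_circle:
  assumes "superpartition L" "barred_strip q K L"
  shows "new_circle K L p \<longleftrightarrow> p = (height L q, q)"
proof -
  have "strip K L" using assms(2) by (simp add: barred_strip_def)
  then show ?thesis
    unfolding new_circle_iff[OF assms(1) \<open>strip K L\<close>] using assms(2) unfolding barred_strip_def
    by (metis linorder_neqE_nat n_not_Suc_n)
qed

lemma tableau_step_Barred: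
  assumes K: "superpartition K" and L: "superpartition L"
  shows "tableau_step K L (Barred r) \<longleftrightarrow> (\<exists>q. barred_strip q K L) \<and> sdegree L = sdegree K + r"
proof (cases "strip K L \<and> sdegree L = sdegree K + r \<and> df L = Suc (df K)")
  case True
  then have s: "strip K L" by simp
  let ?n = "\<lambda>q. q \<in> set (fst L) \<and> height L q = height K q \<and> (\<forall>c<q. height L c = Suc (height K c))"
  have uniq: "q = q'" if "?n q" "?n q'" for q q' using that by (metis linorder_neqE_nat n_not_Suc_n)
  have nc: "new_circle K L p \<longleftrightarrow> (\<exists>q. p = (height L q, q) \<and> ?n q)" for p
    by (rule new_circle_iff[OF L s])
  have ex: "(\<exists>!p. new_circle K L p) \<longleftrightarrow> (\<exists>q. ?n q)"
    unfolding nc using uniq by blast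
  have fol: "circles_follow (boxes L - boxes K) (circles K) (circles L - {(height L q, q)}) \<longleftrightarrow>
      height L ` (set (fst L) - {q}) = height L ` set (fst K)" if "?n q" for q
  proof -
    have "circles L - {(height L q, q)} = {(height L c, c) | c. c \<in> set (fst L) - {q}}"
      by (auto simp: circles_eq[OF L])
    moreover have "card (set (fst L) - {q}) = card (set (fst K))"
      using that True by (simp add: card_fst K L)
    ultimately show ?thesis
      using circles_follow_iff[OF s, of "set (fst L) - {q}"] by (auto simp: circles_eq[OF K])
  qed
  have "tableau_step K L (Barred r) \<longleftrightarrow> (\<exists>q. ?n q) \<and> (\<forall>q. ?n q \<longrightarrow>
     height L ` (set (fst L) - {q}) = height L ` set (fst K))"
  proof -
    have "tableau_step K L (Barred r) \<longleftrightarrow> (\<exists>q. ?n q) \<and> (\<forall>p. new_circle K L p \<longrightarrow>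
       circles_follow (boxes L - boxes K) (circles K) (circles L - {p}))"
      using True by (simp add: horizontal_strip_iff ex)
    also have "\<dots> \<longleftrightarrow> (\<exists>q. ?n q) \<and> (\<forall>q. ?n q \<longrightarrow>
       circles_follow (boxes L - boxes K) (circles K) (circles L - {(height L q, q)}))"
      unfolding nc by blast
    also have "\<dots> \<longleftrightarrow> (\<exists>q. ?n q) \<and> (\<forall>q. ?n q \<longrightarrow>
       height L ` (set (fst L) - {q}) = height L ` set (fst K))"
      by (intro arg_cong2[where f = "(\<and>)"] refl all_cong fol)
    finally show ?thesis .
  qed
  also have "\<dots> \<longleftrightarrow> (\<exists>q. barred_strip q K L)"
  proof -
    have "barred_strip q K L \<longleftrightarrow> ?n q \<and> height L ` (set (fst L) - {q}) = height L ` set (fst K)" for q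
      using True by (auto simp: barred_strip_def)
    then show ?thesis using uniq by metis
  qed
  finally show ?thesis using True by simp
next
  case False
  then show ?thesis by (auto simp: horizontal_strip_iff barred_strip_def)
qed

lemma barred_strip_inj:
  assumes "superpartition K" "superpartition L" "barred_strip q K L"
  shows "inj_on (height L) (set (fst K))"
proof -
  note bs = assms(3)[unfolded barred_strip_def]
  have "card (height L ` set (fst K)) = card (height L ` (set (fst L) - {q}))" using bs by simp
  also have "\<dots> = card (set (fst L) - {q})"
    by (rule card_image) (rule inj_on_subset[OF inj_on_height], auto)
  also have "\<dots> = card (set (fst K))" using bs assms by (simp add: card_fst)
  finally show ?thesis using inj_on_iff_eq_card[of "set (fst K)" "height L"] by simp
qed

text \<open>Padding with zero parts to \<open>N\<close> parts without circle in total makes column 0 obey the same vertex rules as the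
  other columns.\<close>

definition rows :: "nat \<Rightarrow> spart \<Rightarrow> nat \<Rightarrow> nat" where
  "rows N L c = (case c of 0 \<Rightarrow> N + df L | Suc c' \<Rightarrow> height L c')"

lemma rows_simps [simp]: "rows N L 0 = N + df L" "rows N L (Suc c) = height L c"
  by (simp_all add: rows_def)

definition encode :: "nat \<Rightarrow> nat \<Rightarrow> spart \<Rightarrow> site list" where
  "encode N C L = map (sites (rows N L) (set (fst L))) [0..<C]"

text \<open>\<open>height L 0 < N\<close> guarantees zero parts in the padding, so column 0 is a
  corner and no circle can be carried out of the window on the left. \<open>p < C\<close> makes all
  columns from \<open>C - 1\<close> on empty, which closes it on the right.\<close>

definition fits :: "nat \<Rightarrow> nat \<Rightarrow> spart \<Rightarrow> bool" where
  "fits N C L \<longleftrightarrow> superpartition L \<and> height L 0 < N \<and> (\<forall>p\<in>set (fst L) \<union> set (snd L). p < C)"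

lemma fits_height: "fits N C L \<Longrightarrow> C \<le> Suc c \<Longrightarrow> height L c = 0"
  by (rule height_eq_0) (auto simp: fits_def)

lemma antimono_rows: "height L 0 \<le> N + df L \<Longrightarrow> antimono (rows N L)"
  by (rule decseq_SucI) (auto simp: rows_def height_antimono split: nat.split)

lemma rows_corners:
  assumes "height L 0 < N"
  shows "set (fst L) \<subseteq> corners (rows N L)"
proof
  fix c assume c: "c \<in> set (fst L)"
  show "c \<in> corners (rows N L)"
  proof (cases c)
    case 0
    then show ?thesis using assms by (simp add: corners_def)
  next
    case (Suc d)
    then show ?thesis using height_strict[OF c, of d] by (simp add: corners_def)
  qed
qed

lemma fits_rows:
  assumes "fits N C L"
  shows "antimono (rows N L)" "set (fst L) \<subseteq> corners (rows N L)" "set (fst L) \<subseteq> {..<C}"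
    "0 < C \<Longrightarrow> C \<le> c \<Longrightarrow> rows N L c = 0"
proof -
  show "antimono (rows N L)" using assms by (intro antimono_rows) (simp add: fits_def)
  show "set (fst L) \<subseteq> corners (rows N L)" using assms by (intro rows_corners) (simp add: fits_def)
  show "set (fst L) \<subseteq> {..<C}" using assms by (auto simp: fits_def)
  show "rows N L c = 0" if "0 < C" "C \<le> c"
    using that fits_height[OF assms, of "c - 1"] by (cases c) auto
qed

lemma sum_height_diff:
  assumes "strip K L" "fits N C K" "fits N C L"
  shows "(\<Sum>x=0..<C. height L x - height K x) = sdegree L - sdegree K"
proof -
  have "(\<Sum>x<C. height L x - height K x) = (\<Sum>x<C. height L x) - (\<Sum>x<C. height K x)"
    by (rule sum_subtractf_nat) (use assms(1) in \<open>simp add: strip_def\<close>)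
  moreover have "(\<Sum>x<C. height M x) = sdegree M" if "fits N C M" for M
    by (rule sum_height) (use that in \<open>auto simp: fits_def intro: less_imp_le\<close>)
  ultimately show ?thesis using assms(2,3) by (simp add: lessThan_atLeast0)
qed

lemma prod_vertex_weight:
  assumes "path e (sites A F) (sites B G) 0 C" "antimono A" "antimono B" "A C = B C"
  shows "(\<Prod>x=0..<C. vertex_weight u (e x) (sites A F x) (e (Suc x)) (sites B G x)) =
    u ^ (\<Sum>x=0..<C. B (Suc x) - A (Suc x)) *
    (\<Prod>x=0..<C. if e x = Fresh \<and> e (Suc x) = Fresh \<and> x \<in> F then - 1 else 1)"
proof -
  have "vertex_weight u (e x) (sites A F x) (e (Suc x)) (sites B G x) =
     u ^ (B (Suc x) - A (Suc x)) * (if e x = Fresh \<and> e (Suc x) = Fresh \<and> x \<in> F then - 1 else 1)"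
    if "x < C" for x
  proof -
    have "vertex (e x) (sites A F x) (e (Suc x)) = Some (sites B G x)"
      using assms(1) that by (simp add: path_def)
    moreover have "B (Suc x) - A (Suc x) = boxes_added (e (Suc x))"
      using path_rows[OF assms, of "Suc x"] that by simp
    moreover have "snd (sites A F x) = (x \<in> F)" by (simp add: sites_def)
    ultimately show ?thesis by (simp add: vertex_weight_def edge_weight_def boxes_added_def)
  qed
  then show ?thesis by (simp add: prod.distrib power_sum)
qed

text \<open>Because of the padding, the condition at index 0 compares numbers of circles, but only
  up to one. Given equal images, injectivity of \<open>height L\<close> on the old circle columns
  amounts to equality of these numbers.\<close>

lemma plain_move_iff:
  assumes "fits N C K" "fits N C L"
  shows "plain_move (rows N K) (set (fst K)) (rows N L) (set (fst L)) \<longleftrightarrow> plain_strip K L"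
proof -
  let ?F = "set (fst K)" and ?G = "set (fst L)"
  have cards: "card ?F = df K" "card ?G = df L" using assms by (auto simp: card_fst fits_def)
  have "plain_move (rows N K) ?F (rows N L) ?G \<longleftrightarrow> strip K L \<and> df K \<le> df L \<and> df L \<le> Suc (df K) \<and>
     inj_on (height L) ?F \<and> height L ` ?F = height L ` ?G"
  proof -
    have all: "(\<forall>c. P c) \<longleftrightarrow> P 0 \<and> (\<forall>c. P (Suc c))" for P by (metis nat.exhaust)
    show ?thesis
      unfolding plain_move_def strip_def all[of "\<lambda>c. rows N K c \<le> rows N L c \<and> rows N L c \<le> Suc (rows N K c)"]
      by auto
  qed
  also have "\<dots> \<longleftrightarrow> plain_strip K L"
  proof -
    have "inj_on (height L) ?F \<longleftrightarrow> df L = df K" if "height L ` ?F = height L ` ?G"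
    proof -
      have "card (height L ` ?F) = df L"
        using that card_image[OF inj_on_height[of L]] cards by simp
      then show ?thesis using inj_on_iff_eq_card[of ?F "height L"] cards by simp
    qed
    then show ?thesis by (auto simp: plain_strip_def)
  qed
  finally show ?thesis .
qed

lemma transfer_plain:
  assumes K: "fits N C K" and L: "fits N C L" and C: "0 < C"
  shows "transfer u Idle (encode N C K) (encode N C L) =
    (if plain_strip K L then u ^ (sdegree L - sdegree K) else 0)"
proof -
  let ?A = "rows N K" and ?B = "rows N L" and ?F = "set (fst K)" and ?G = "set (fst L)"
  note mono = fits_rows(1)[OF K] fits_rows(1)[OF L] and corn = fits_rows(2)[OF K] fits_rows(2)[OF L]
    and bd = fits_rows(3)[OF K] fits_rows(3)[OF L]
  have tail: "?A c = ?B c" if "C \<le> c" for c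
    using fits_rows(4)[OF K C that] fits_rows(4)[OF L C that] by simp
  show ?thesis
  proof (cases "plain_strip K L")
    case True
    let ?e = "move_edge ?A ?F ?B"
    have p: "path ?e (sites ?A ?F) (sites ?B ?G) 0 C"
      by (rule plain_move_path[OF mono corn]) (use True K L tail bd in \<open>auto simp: plain_move_iff\<close>)
    have "height L d < N + df L" for d
      using L height_antimono[of 0 d L] by (auto simp: fits_def)
    then have e0: "?e 0 = Idle" using True by (auto simp: move_edge_def plain_strip_def nat_neq_iff)
    have nF: "?e x \<noteq> Fresh" for x by (simp add: move_edge_def)
    have "strip K L" using True by (simp add: plain_strip_def)
    then have "(\<Sum>x=0..<C. ?B (Suc x) - ?A (Suc x)) = sdegree L - sdegree K"
      using sum_height_diff[of K L N C] K L by simp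
    then show ?thesis
      unfolding encode_def transfer_path[OF p le0] prod_vertex_weight[OF p mono tail[OF order_refl]]
      using True by (simp add: e0 nF)
  next
    case False
    have "transfer u Idle (encode N C K) (encode N C L) = 0"
    proof (rule ccontr)
      assume "transfer u Idle (encode N C K) (encode N C L) \<noteq> 0"
      then obtain e where p: "path e (sites ?A ?F) (sites ?B ?G) 0 C" and "e 0 = Idle"
        unfolding encode_def by (blast dest: transfer_nonzero_path)
      then have "plain_move ?A ?F ?B ?G"
        by (intro path_plain_move[OF p mono corn(1) bd(1) corn(2) bd(2) tail]) auto
      then show False using False K L by (simp add: plain_move_iff)
    qed
    then show ?thesis using False by simp
  qed
qed

text \<open>Replacing \<open>Fresh\<close> by \<open>Push\<close> and deleting the new circle turns a barred step into a plain move.\<close>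

lemma transfer_barred:
  assumes K: "fits N C K" and L: "fits N C L" and C: "0 < C" and q: "barred_strip q K L"
  shows "transfer u Fresh (encode N C K) (encode N C L) =
    (- 1) ^ card {c \<in> set (fst K). c < q} * u ^ (sdegree L - sdegree K)"
proof -
  let ?A = "rows N K" and ?B = "rows N L" and ?F = "set (fst K)" and ?G = "set (fst L)"
  note mono = fits_rows(1)[OF K] fits_rows(1)[OF L] and corn = fits_rows(2)[OF K] fits_rows(2)[OF L]
    and bd = fits_rows(3)[OF K] fits_rows(3)[OF L]
  have tail: "?A c = ?B c" if "C \<le> c" for c
    using fits_rows(4)[OF K C that] fits_rows(4)[OF L C that] by simp
  note bs = q[unfolded barred_strip_def]
  have qG: "q \<in> ?G" and s: "strip K L" using bs by auto
  have qC: "q < C" using qG bd by auto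
  have inj: "inj_on (height L) ?F"
    using barred_strip_inj[OF _ _ q] K L by (simp add: fits_def)
  have mv: "plain_move ?A ?F ?B (?G - {q})"
    unfolding plain_move_def
  proof (intro conjI allI)
    fix c show "?A c \<le> ?B c" "?B c \<le> Suc (?A c)"
      using bs by (cases c; simp add: strip_def)+
  qed (use inj bs in simp_all)
  let ?e = "move_edge ?A ?F ?B"
  have p: "path ?e (sites ?A ?F) (sites ?B (?G - {q})) 0 C"
    by (rule plain_move_path[OF mono corn(1) _ mv]) (use corn bd tail in auto)
  have push: "?e c = Push" if "c \<le> q" for c
    using that bs by (cases c) (auto simp: move_edge_def)
  have v: "vertex Push (sites ?A ?F q) (?e (Suc q)) = Some (sites ?B (?G - {q}) q)"
    using p qC push[OF order_refl] unfolding path_def by (metis le0)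
  have "?e (Suc q) \<noteq> Push" using bs by (simp add: move_edge_def)
  \<comment> \<open>\<open>Carry\<close> on the right would leave a circle in column
    \<open>q\<close>, and so would an old circle there; but the target has its circle in
    \<open>q\<close> deleted.\<close>
  then have eq: "?e (Suc q) = Idle" "q \<notin> ?F"
    using v by (cases "?e (Suc q)"; simp add: sites_def split: if_splits)+
  define e where "e c = (if c \<le> q then Fresh else ?e c)" for c
  have p': "path e (sites ?A ?F) (sites ?B ?G) 0 C"
    unfolding path_def
  proof (intro conjI allI impI)
    show "e C = Idle" using p qC by (simp add: e_def path_def)
    fix x assume x: "0 \<le> x \<and> x < C"
    then have vx: "vertex (?e x) (sites ?A ?F x) (?e (Suc x)) = Some (sites ?B (?G - {q}) x)"
      using p by (simp add: path_def)
    consider "x < q" | "x = q" | "q < x" by linarith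
    then show "vertex (e x) (sites ?A ?F x) (e (Suc x)) = Some (sites ?B ?G x)"
    proof cases
      case 1
      then show ?thesis using vx push[of x] push[of "Suc x"] by (simp add: e_def sites_def)
    next
      case 2
      then show ?thesis using vx push[of x] eq qG by (simp add: e_def sites_def)
    next
      case 3
      then show ?thesis using vx by (simp add: e_def sites_def)
    qed
  qed
  have nF: "?e x \<noteq> Fresh" for x by (simp add: move_edge_def)
  have "(\<Prod>x=0..<C. if e x = Fresh \<and> e (Suc x) = Fresh \<and> x \<in> ?F then - 1 else 1) =
      (\<Prod>x=0..<C. if x \<in> {c \<in> ?F. c < q} then - 1 else (1::'a))"
    by (intro prod.cong refl) (auto simp: e_def nF)
  also have "\<dots> = (\<Prod>x\<in>{0..<C} \<inter> {c \<in> ?F. c < q}. - 1)"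
    by (rule prod.inter_restrict[symmetric]) simp
  also have "{0..<C} \<inter> {c \<in> ?F. c < q} = {c \<in> ?F. c < q}" using bd by auto
  finally have sgn: "(\<Prod>x=0..<C. if e x = Fresh \<and> e (Suc x) = Fresh \<and> x \<in> ?F then - 1 else 1) =
      (- 1 :: 'a) ^ card {c \<in> ?F. c < q}" by simp
  have "(\<Sum>x=0..<C. ?B (Suc x) - ?A (Suc x)) = sdegree L - sdegree K"
    using sum_height_diff[OF s K L] by simp
  then show ?thesis
    unfolding encode_def transfer_path[OF p' le0] prod_vertex_weight[OF p' mono tail[OF order_refl]] sgn
    by (simp add: e_def)
qed

text \<open>The same replacement backwards: \<open>Fresh\<close> enters on the left and persists up
  to a first column \<open>q\<close>, where it can only turn into \<open>Idle\<close>, leaving the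
  new circle behind.\<close>

lemma transfer_barred_nonzero:
  assumes K: "fits N C K" and L: "fits N C L" and C: "0 < C"
    and nz: "transfer u Fresh (encode N C K) (encode N C L) \<noteq> 0"
  shows "\<exists>q. barred_strip q K L"
proof -
  let ?A = "rows N K" and ?B = "rows N L" and ?F = "set (fst K)" and ?G = "set (fst L)"
  note mono = fits_rows(1)[OF K] fits_rows(1)[OF L] and corn = fits_rows(2)[OF K] fits_rows(2)[OF L]
    and bd = fits_rows(3)[OF K] fits_rows(3)[OF L]
  have tail: "?A c = ?B c" if "C \<le> c" for c
    using fits_rows(4)[OF K C that] fits_rows(4)[OF L C that] by simp
  obtain e where p: "path e (sites ?A ?F) (sites ?B ?G) 0 C" and e0: "e 0 = Fresh"
    using nz unfolding encode_def by (blast dest: transfer_nonzero_path)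
  define q where "q = (LEAST c. e (Suc c) \<noteq> Fresh)"
  have "e (Suc (C - 1)) \<noteq> Fresh" using p C by (simp add: path_def)
  then have q1: "e (Suc q) \<noteq> Fresh" and "q \<le> C - 1"
    unfolding q_def by (rule LeastI, intro Least_le)
  then have qC: "q < C" using C by simp
  have fresh: "e c = Fresh" if "c \<le> q" for c
    using that e0 not_less_Least[of "c - 1" "\<lambda>c. e (Suc c) \<noteq> Fresh"] by (cases c) (auto simp: q_def)
  have v: "vertex (e x) (sites ?A ?F x) (e (Suc x)) = Some (sites ?B ?G x)" if "x < C" for x
    using p that by (simp add: path_def)
  have eq: "e (Suc q) = Idle" "q \<notin> ?F" "q \<in> ?G"
    using v[OF qC] q1 fresh[of q] by (cases "e (Suc q)"; simp add: sites_def split: if_splits)+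
  define e' where "e' c = (if c \<le> q then Push else e c)" for c
  have p': "path e' (sites ?A ?F) (sites ?B (?G - {q})) 0 C"
    unfolding path_def
  proof (intro conjI allI impI)
    show "e' C = Idle" using p qC by (simp add: e'_def path_def)
    fix x assume x: "0 \<le> x \<and> x < C"
    then have vx: "vertex (e x) (sites ?A ?F x) (e (Suc x)) = Some (sites ?B ?G x)"
      using v by simp
    consider "x < q" | "x = q" | "q < x" by linarith
    then show "vertex (e' x) (sites ?A ?F x) (e' (Suc x)) = Some (sites ?B (?G - {q}) x)"
    proof cases
      case 1
      then show ?thesis using vx fresh[of x] fresh[of "Suc x"] by (simp add: e'_def sites_def)
    next
      case 2
      then show ?thesis using vx fresh[of x] eq by (simp add: e'_def sites_def)
    next
      case 3
      then show ?thesis using vx by (simp add: e'_def sites_def)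
    qed
  qed
  have "plain_move ?A ?F ?B (?G - {q})"
    by (rule path_plain_move[OF p' mono corn(1) bd(1) _ _ tail]) (use corn(2) bd(2) in \<open>auto simp: e'_def\<close>)
  then have mv: "\<And>c. ?A c \<le> ?B c \<and> ?B c \<le> Suc (?A c)" "height L ` (?G - {q}) = height L ` ?F"
    by (auto simp: plain_move_def)
  have rows: "?B c = ?A c + boxes_added (e c)" if "c \<le> C" for c
    using path_rows[OF p mono tail[OF order_refl] that] .
  have "strip K L" unfolding strip_def using mv(1)[of "Suc c" for c] by simp
  moreover have "df L = Suc (df K)" using rows[of 0] e0 by (simp add: boxes_added_def)
  moreover have "height L q = height K q" using rows[of "Suc q"] eq qC by (simp add: boxes_added_def)
  moreover have "height L c = Suc (height K c)" if "c < q" for c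
    using rows[of "Suc c"] fresh[of "Suc c"] that qC by (simp add: boxes_added_def)
  ultimately show ?thesis using mv(2) eq(3) by (auto simp: barred_strip_def)
qed

section \<open>Commutation of steps\<close>

lemma length_filter_replicates:
  "length (filter P (concat (map (\<lambda>d. replicate (m d) d) xs))) = (\<Sum>d\<leftarrow>xs. if P d then m d else 0)"
  by (induction xs) (auto simp: filter_replicate)

lemma length_filter_upt: "length (filter P [i..<j]) = (\<Sum>d=i..<j. of_bool (P d))"
  by (induction j) (auto simp: not_le)

lemma sorted_wrt_replicates:
  "sorted_wrt (<) xs \<Longrightarrow> sorted (concat (map (\<lambda>d. replicate (m d) d) xs))"
  by (induction xs) (auto simp: sorted_append intro: less_imp_le)

text \<open>The parts are read off from the sites. A superpartition does not record zero parts
  without circle; their number is recovered from the total \<open>N\<close>.\<close>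

lemma encode_surj:
  assumes len: "length bs = C" "0 < C" and legal: "\<forall>b\<in>set bs. snd b \<longrightarrow> 0 < fst b"
    and total: "(\<Sum>x=0..<C. fst (bs ! x) - of_bool (snd (bs ! x))) = N"
  shows "\<exists>M. superpartition M \<and> (\<forall>p\<in>set (fst M) \<union> set (snd M). p < C) \<and> height M 0 \<le> N + df M \<and>
    encode N C M = bs"
proof -
  define m where "m c = fst (bs ! c) - of_bool (snd (bs ! c))" for c
  define xs where "xs = filter (\<lambda>c. snd (bs ! c)) [0..<C]"
  \<comment> \<open>Starts at 1, since the circle-free parts of size 0 are mere padding.\<close>
  define ys where "ys = concat (map (\<lambda>d. replicate (m d) d) [1..<C])"
  define M where "M = (rev xs, rev ys)"
  have sp: "superpartition M"
    unfolding superpartition_def M_def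
    by (auto simp: sorted_wrt_rev xs_def ys_def sorted_wrt_filter strict_sorted_iff intro!: sorted_wrt_replicates)
  have parts: "\<forall>p\<in>set (fst M) \<union> set (snd M). p < C"
    by (auto simp: M_def xs_def ys_def)
  have n: "fst (bs ! c) = m c + of_bool (snd (bs ! c))" if "c < C" for c
    using legal that len by (auto simp: m_def dest: nth_mem)
  have h: "height M c = (\<Sum>d=Suc c..<C. fst (bs ! d))" for c
  proof -
    have "height M c = (\<Sum>d=0..<C. of_bool (c < d \<and> snd (bs ! d))) + (\<Sum>d=1..<C. if c < d then m d else 0)"
      unfolding height_def M_def xs_def ys_def
      by (simp add: rev_filter[symmetric] length_filter_replicates length_filter_upt conj_commute interv_sum_list_conv_sum_set_nat)
    also have "(\<Sum>d=0..<C. of_bool (c < d \<and> snd (bs ! d))) = (\<Sum>d=Suc c..<C. of_bool (snd (bs ! d)) :: nat)"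
      by (intro sum.mono_neutral_cong_right) auto
    also have "(\<Sum>d=1..<C. if c < d then m d else 0) = (\<Sum>d=Suc c..<C. m d)"
      by (intro sum.mono_neutral_cong_right) auto
    finally have "height M c = (\<Sum>d=Suc c..<C. m d + of_bool (snd (bs ! d)))"
      by (simp add: sum.distrib)
    also have "\<dots> = (\<Sum>d=Suc c..<C. fst (bs ! d))"
      by (intro sum.cong) (use n in auto)
    finally show ?thesis .
  qed
  have "df M = (\<Sum>d=0..<C. of_bool (snd (bs ! d)))"
    by (simp add: df_def M_def xs_def length_filter_upt)
  then have r0: "N + df M = (\<Sum>d=0..<C. fst (bs ! d))"
  proof -
    have "(\<Sum>d=0..<C. fst (bs ! d)) = (\<Sum>d=0..<C. m d + of_bool (snd (bs ! d)))"
      by (intro sum.cong) (use n in auto)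
    then show ?thesis using total \<open>df M = _\<close> by (simp add: m_def[symmetric] sum.distrib)
  qed
  then have rows: "rows N M c = (\<Sum>d=c..<C. fst (bs ! d))" for c
    using h by (cases c) simp_all
  have "height M 0 \<le> N + df M"
    unfolding r0 h by (intro sum_mono2) auto
  moreover have "encode N C M = bs"
  proof (rule nth_equalityI)
    show "length (encode N C M) = length bs" by (simp add: encode_def len)
    fix c assume "c < length (encode N C M)"
    then have c: "c < C" by (simp add: encode_def)
    have "rows N M c - rows N M (Suc c) = fst (bs ! c)"
      using c unfolding rows by (simp add: sum.atLeast_Suc_lessThan)
    moreover have "c \<in> set (fst M) \<longleftrightarrow> snd (bs ! c)" using c by (simp add: M_def xs_def)
    ultimately show "encode N C M ! c = bs ! c" using c by (simp add: encode_def sites_def prod_eq_iff)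
  qed
  ultimately show ?thesis using sp parts by blast
qed

lemma encode_inj:
  assumes "fits N C K" "fits N C L" "0 < C" "encode N C K = encode N C L"
  shows "K = L"
proof (rule superpartition_eqI)
  have s: "sites (rows N K) (set (fst K)) c = sites (rows N L) (set (fst L)) c" if "c < C" for c
    using assms(4) that by (simp add: encode_def)
  show "set (fst K) = set (fst L)"
  proof (intro set_eqI)
    fix c show "c \<in> set (fst K) \<longleftrightarrow> c \<in> set (fst L)"
      using s[of c] assms(1,2) by (cases "c < C") (auto simp: sites_def fits_def)
  qed
  have top: "height K c = height L c" if "C - 1 \<le> c" for c
    using that fits_height[OF assms(1), of c] fits_height[OF assms(2), of c] by simp
  have "height K c = height L c" if "c \<le> C - 1" for c
    using that
  proof (induction c rule: inc_induct)
    case base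
    show ?case by (rule top) simp
  next
    case (step c)
    have "rows N K (Suc c) - rows N K (Suc (Suc c)) = rows N L (Suc c) - rows N L (Suc (Suc c))"
      using s[of "Suc c"] step.hyps by (simp add: sites_def)
    then show ?case using step.IH height_antimono[of c "Suc c" K] height_antimono[of c "Suc c" L] by simp
  qed
  with top show "height K = height L" by (metis ext nat_le_linear)
qed (use assms in \<open>auto simp: fits_def\<close>)

text \<open>The second conserved charge: the circle-free parts that cross the edge to the right.
  Under \<open>Carry\<close> such a part goes right in exchange for a circle going left.\<close>

definition bosons_out :: "edge \<Rightarrow> nat" where
  "bosons_out j = of_bool (j = Push \<or> j = Carry)"

lemma vertex_bosons:
  assumes "vertex i a j = Some b" "snd a \<longrightarrow> 0 < fst a"
  shows "snd b \<longrightarrow> 0 < fst b"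
    "fst b - of_bool (snd b) + bosons_out j = fst a - of_bool (snd a) + bosons_out i"
proof -
  obtain n f n' f' where "a = (n, f)" "b = (n', f')" by (metis surj_pair)
  with assms show "snd b \<longrightarrow> 0 < fst b"
    "fst b - of_bool (snd b) + bosons_out j = fst a - of_bool (snd a) + bosons_out i"
    by (cases i; cases j; auto simp: bosons_out_def split: if_splits)+
qed

lemma path_bosons:
  assumes "path e a b c C" "c \<le> C" "\<And>x. x < C \<Longrightarrow> snd (a x) \<longrightarrow> 0 < fst (a x)"
  shows "(\<Sum>x=c..<C. fst (b x) - of_bool (snd (b x))) = (\<Sum>x=c..<C. fst (a x) - of_bool (snd (a x))) + bosons_out (e c)"
  using assms(2,1)
proof (induction c rule: inc_induct)
  case base
  then show ?case by (simp add: path_def bosons_out_def)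
next
  case (step c)
  have p: "path e a b (Suc c) C" and v: "vertex (e c) (a c) (e (Suc c)) = Some (b c)"
    using step.prems step.hyps by (auto simp: path_def)
  from vertex_bosons(2)[OF v assms(3)] step.IH[OF p] step.hyps show ?case
    by (simp add: sum.atLeast_Suc_lessThan)
qed

lemma sum_bosons:
  assumes "fits N C K" "0 < C"
  shows "(\<Sum>x=0..<C. fst (sites (rows N K) (set (fst K)) x) - of_bool (snd (sites (rows N K) (set (fst K)) x))) = N"
    and "snd (sites (rows N K) (set (fst K)) x) \<longrightarrow> 0 < fst (sites (rows N K) (set (fst K)) x)"
proof -
  let ?s = "sites (rows N K) (set (fst K))"
  have corn: "set (fst K) \<subseteq> corners (rows N K)" using assms by (auto intro!: rows_corners simp: fits_def)
  then show legal: "snd (?s x) \<longrightarrow> 0 < fst (?s x)" for x by (auto simp: sites_def corners_def)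
  have A: "rows N K (Suc x) \<le> rows N K x" for x
    by (rule antimonoD[OF fits_rows(1)[OF assms(1)]]) simp
  have "(\<Sum>x=c..<C. rows N K x - rows N K (Suc x)) = rows N K c - rows N K C" if "c \<le> C" for c
    using that
  proof (induction c rule: inc_induct)
    case (step c)
    have "rows N K C \<le> rows N K (Suc c)"
      by (rule antimonoD[OF fits_rows(1)[OF assms(1)]]) (use step.hyps in simp)
    then show ?case using step A[of c] by (simp add: sum.atLeast_Suc_lessThan)
  qed simp
  moreover have "rows N K C = 0" using fits_height[OF assms(1), of "C - 1"] assms(2) by (cases C) auto
  ultimately have "(\<Sum>x=0..<C. fst (?s x)) = N + df K" by (simp add: sites_def)
  moreover have "(\<Sum>x=0..<C. of_bool (snd (?s x))) = df K"
  proof -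
    have "{0..<C} \<inter> set (fst K) = set (fst K)" using assms by (auto simp: fits_def)
    then show ?thesis using assms by (simp add: sites_def card_fst fits_def)
  qed
  moreover have "(\<Sum>x=0..<C. fst (?s x) - of_bool (snd (?s x))) = (\<Sum>x=0..<C. fst (?s x)) - (\<Sum>x=0..<C. of_bool (snd (?s x)))"
    by (rule sum_subtractf_nat) (use legal in \<open>auto simp: Suc_le_eq\<close>)
  ultimately show "(\<Sum>x=0..<C. fst (?s x) - of_bool (snd (?s x))) = N" by simp
qed

text \<open>A middle row is a priori any list of sites. Conservation of the circle-free parts
  supplies the total that \<open>encode_surj\<close> needs, and as column 0 gains at most one box,
  the slack in \<open>Suc (height K 0) < N\<close> makes the decoded superpartition fit.\<close>

lemma transfer_decode:
  assumes K: "fits N C K" "Suc (height K 0) < N" and C: "0 < C" and len: "length bs = C"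
    and i: "i = Idle \<or> i = Fresh" and nz: "transfer u i (encode N C K) bs \<noteq> 0"
  shows "\<exists>M. fits N C M \<and> encode N C M = bs"
proof -
  let ?a = "sites (rows N K) (set (fst K))"
  have bs: "bs = map (\<lambda>x. bs ! x) [0..<C]" using len by (auto intro: nth_equalityI)
  obtain e where p: "path e ?a (\<lambda>x. bs ! x) 0 C" and e0: "e 0 = i"
    using nz unfolding encode_def by (subst (asm) bs) (blast dest: transfer_nonzero_path)
  have legal: "snd (?a x) \<longrightarrow> 0 < fst (?a x)" for x by (rule sum_bosons(2)[OF K(1) C])
  have "\<forall>b\<in>set bs. snd b \<longrightarrow> 0 < fst b"
  proof
    fix b assume "b \<in> set bs"
    then obtain x where "x < C" "b = bs ! x" using len by (auto simp: in_set_conv_nth)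
    then show "snd b \<longrightarrow> 0 < fst b"
      using vertex_bosons(1)[OF _ legal] p unfolding path_def by blast
  qed
  moreover have "(\<Sum>x=0..<C. fst (bs ! x) - of_bool (snd (bs ! x))) = N"
    using path_bosons[OF p le0 legal] sum_bosons(1)[OF K(1) C] e0 i by (auto simp: bosons_out_def)
  ultimately obtain M where M: "superpartition M" "\<forall>p\<in>set (fst M) \<union> set (snd M). p < C"
      "height M 0 \<le> N + df M" "encode N C M = bs"
    using encode_surj[OF len C] by blast
  let ?b = "sites (rows N M) (set (fst M))"
  have "bs ! x = ?b x" if "x < C" for x using M(4) that by (auto simp: encode_def)
  then have p': "path e ?a ?b 0 C" using p by (simp add: path_def)
  have "height M (C - 1) = 0" by (rule height_eq_0) (use M(2) C in auto)
  then have "rows N K C = rows N M C"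
    using fits_height[OF K(1), of "C - 1"] C by (cases C) auto
  from path_rows[OF p' fits_rows(1)[OF K(1)] antimono_rows[OF M(3)] this, of 1] C
  have "height M 0 \<le> Suc (height K 0)" by (simp add: boxes_added_def)
  then show ?thesis using M K(2) by (intro exI[of _ M]) (auto simp: fits_def)
qed

text \<open>The first argument tells whether the step is barred. The \<open>THE\<close> is only evaluated when the column of the new circle
  exists; it is then unique.\<close>

definition strip_sign :: "bool \<Rightarrow> spart \<Rightarrow> spart \<Rightarrow> int" where
  "strip_sign b K L = (if b
     then if \<exists>q. barred_strip q K L then (- 1) ^ card {c \<in> set (fst K). c < (THE q. barred_strip q K L)} else 0
     else of_bool (plain_strip K L))"

definition start :: "bool \<Rightarrow> edge" where
  "start b = (if b then Fresh else Idle)"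

lemma transfer_eq_strip_sign:
  assumes "fits N C K" "fits N C L" "0 < C"
  shows "transfer u (start b) (encode N C K) (encode N C L) =
    of_int (strip_sign b K L) * u ^ (sdegree L - sdegree K)"
proof (cases b)
  case False
  then show ?thesis by (simp add: start_def strip_sign_def transfer_plain[OF assms])
next
  case True
  show ?thesis
  proof (cases "\<exists>q. barred_strip q K L")
    case ex: True
    then obtain q where q: "barred_strip q K L" by blast
    then have "(THE q. barred_strip q K L) = q" by (blast intro: barred_strip_unique)
    then show ?thesis using True q ex by (simp add: start_def strip_sign_def transfer_barred[OF assms q])
  next
    case False
    then show ?thesis using True transfer_barred_nonzero[OF assms]
      by (auto simp: start_def strip_sign_def)
  qed
qed

lemma strip_sign_nonzero: "strip_sign b K L \<noteq> 0 \<Longrightarrow> strip K L"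
  by (auto simp: strip_sign_def plain_strip_def barred_strip_def split: if_splits)

lemma strip_fits:
  assumes "strip K L" "fits N C L" "superpartition K" "0 < C"
  shows "fits N C K"
proof -
  have le: "height K c \<le> height L c" for c using assms(1) by (simp add: strip_def)
  have "p < C" if "p \<in> set (fst K) \<union> set (snd K)" for p
  proof (cases p)
    case (Suc c)
    have "0 < height K c"
      using that Suc by (auto simp: height_def filter_empty_conv)
    then have "0 < height L c" using le[of c] by simp
    then show ?thesis using fits_height[OF assms(2), of c] Suc by force
  qed (use assms(4) in simp)
  then show ?thesis using assms le[of 0] by (auto simp: fits_def)
qed

lemma transfer_support:
  "transfer u i as bs \<noteq> 0 \<Longrightarrow>
    length bs = length as \<and> set bs \<subseteq> (\<Union>a\<in>set as. \<Union>i. \<Union>j. set_option (vertex i a j))"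
proof (induction u i as bs rule: transfer.induct)
  case (2 u i a as b bs)
  then obtain j where j: "vertex_weight u i a j b * transfer u j as bs \<noteq> 0"
    by (auto elim: sum.not_neutral_contains_not_neutral)
  then have "vertex i a j = Some b" "transfer u j as bs \<noteq> 0"
    using vertex_weight_eq_0[of i a j b u] by (metis mult_zero_left, metis mult_zero_right)
  moreover from this have "b \<in> (\<Union>i. \<Union>j. set_option (vertex i a j))"
    by (intro UN_I[of i] UN_I[of j]) simp_all
  ultimately show ?case using "2.IH"[of j] by auto
qed auto

text \<open>Lists of sites that contribute decode by \<open>transfer_decode\<close>, and members of
  \<open>S\<close> that contribute fit by \<open>strip_fits\<close>, so both sums have the same
  nonzero terms. \<open>S\<close> is arbitrary so that one set can serve both orders of the
  steps.\<close>

lemma double_transfer_eq_sum_strip: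
  assumes K: "fits N C K" "Suc (height K 0) < N" and L: "fits N C L" and C: "0 < C"
    and S: "finite S" "\<forall>M\<in>S. superpartition M"
      "\<And>M. superpartition M \<Longrightarrow> strip_sign b K M \<noteq> 0 \<Longrightarrow> strip_sign b' M L \<noteq> 0 \<Longrightarrow> M \<in> S"
  shows "double_transfer u v (encode N C K) (encode N C L) (start b) (start b') =
    (\<Sum>M\<in>S. of_int (strip_sign b K M * strip_sign b' M L) * u ^ (sdegree M - sdegree K) * v ^ (sdegree L - sdegree M))"
proof -
  let ?A = "(\<Union>a\<in>set (encode N C K). \<Union>i. \<Union>j. set_option (vertex i a j))"
  let ?B = "{bs. set bs \<subseteq> ?A \<and> length bs = length (encode N C K)}"
  let ?t = "\<lambda>bs. transfer u (start b) (encode N C K) bs * transfer v (start b') bs (encode N C L)"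
  have fin: "finite ?A" by simp
  have "double_transfer u v (encode N C K) (encode N C L) (start b) (start b') = (\<Sum>bs\<in>?B. ?t bs)"
  proof (rule double_transfer_eq_sum[OF fin])
    fix a i j c assume "a \<in> set (encode N C K)" "vertex i a j = Some c"
    then show "c \<in> ?A" by (intro UN_I[of a] UN_I[of i] UN_I[of j]) simp_all
  qed
  also have "\<dots> = (\<Sum>bs\<in>encode N C ` {M\<in>S. fits N C M}. ?t bs)"
  proof (rule sum.mono_neutral_cong)
    show "finite ?B" using finite_lists_length_eq[OF fin] .
    show "?t bs = 0" if bs: "bs \<in> ?B - encode N C ` {M \<in> S. fits N C M}" for bs
    proof (rule ccontr)
      assume nz: "?t bs \<noteq> 0"
      then have nz': "transfer u (start b) (encode N C K) bs \<noteq> 0" by force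
      have len: "length bs = C" using bs by (simp add: encode_def)
      have st: "start b = Idle \<or> start b = Fresh" by (simp add: start_def)
      from transfer_decode[OF K C len st nz'] obtain M where M: "fits N C M" "encode N C M = bs"
        by (elim exE conjE)
      have "strip_sign b K M \<noteq> 0" "strip_sign b' M L \<noteq> 0"
        using nz unfolding M(2)[symmetric] transfer_eq_strip_sign[OF K(1) M(1) C] transfer_eq_strip_sign[OF M(1) L C]
        by auto
      then have "M \<in> S" using S(3)[of M] M(1) by (simp add: fits_def)
      then show False using bs M by blast
    qed
    show "?t bs = 0" if bs: "bs \<in> encode N C ` {M \<in> S. fits N C M} - ?B" for bs
      using transfer_support[of u "start b" "encode N C K" bs] bs by force
  qed (use S(1) in auto)
  also have "\<dots> = (\<Sum>M | M \<in> S \<and> fits N C M. ?t (encode N C M))"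
  proof (rule sum.reindex_cong[OF _ refl refl])
    show "inj_on (encode N C) {M \<in> S. fits N C M}"
      by (rule inj_onI) (use encode_inj[OF _ _ C] in blast)
  qed
  also have "\<dots> = (\<Sum>M\<in>S. of_int (strip_sign b K M * strip_sign b' M L) * u ^ (sdegree M - sdegree K) * v ^ (sdegree L - sdegree M))"
  proof (rule sum.mono_neutral_cong_left)
    show "\<forall>M\<in>S - {M \<in> S. fits N C M}. of_int (strip_sign b K M * strip_sign b' M L) *
        u ^ (sdegree M - sdegree K) * v ^ (sdegree L - sdegree M) = 0"
    proof
      fix M assume "M \<in> S - {M \<in> S. fits N C M}"
      then have "superpartition M" "\<not> fits N C M" using S(2) by auto
      then have "strip_sign b' M L = 0" using strip_fits[OF strip_sign_nonzero L _ C] by blast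
      then show "of_int (strip_sign b K M * strip_sign b' M L) *
        u ^ (sdegree M - sdegree K) * v ^ (sdegree L - sdegree M) = 0" by simp
    qed
    show "?t (encode N C M) = of_int (strip_sign b K M * strip_sign b' M L) *
        u ^ (sdegree M - sdegree K) * v ^ (sdegree L - sdegree M)" if "M \<in> {M \<in> S. fits N C M}" for M
      using that K L C by (simp add: transfer_eq_strip_sign)
  qed (use S(1) in auto)
  finally show ?thesis .
qed

section \<open>Exchange of two steps\<close>

definition swap_sign :: "bool \<Rightarrow> bool \<Rightarrow> int" where
  "swap_sign b b' = (if b \<and> b' then - 1 else 1)"

lemma fits_exists:
  assumes "superpartition K" "superpartition L"
  obtains N C where "fits N C K" "Suc (height K 0) < N" "fits N C L" "0 < C"
proof -
  let ?P = "set (fst K) \<union> set (snd K) \<union> set (fst L) \<union> set (snd L)"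
  obtain C where C: "\<forall>p\<in>?P. p < C"
    using finite_nat_set_iff_bounded[of ?P] by auto
  show ?thesis
    by (rule that[of "height K 0 + height L 0 + 2" "Suc C"])
       (use C assms in \<open>auto simp: fits_def less_SucI\<close>)
qed

text \<open>Only the four relations for pairs of \<open>Idle\<close> and \<open>Fresh\<close> at the
  left end enter here; the other twelve served the induction over the columns.\<close>

lemma strip_sign_commute_poly:
  fixes u :: "'a :: comm_ring_1"
  assumes sp: "superpartition K" "superpartition L" and S: "finite S" "\<forall>M\<in>S. superpartition M"
    and mem: "\<And>M b. superpartition M \<Longrightarrow> strip_sign b M L \<noteq> 0 \<Longrightarrow> M \<in> S"
  shows "(\<Sum>M\<in>S. of_int (strip_sign b K M * strip_sign b' M L) * u ^ (sdegree L - sdegree M)) =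
    of_int (swap_sign b b') *
    (\<Sum>M\<in>S. of_int (strip_sign b' K M * strip_sign b M L) * u ^ (sdegree M - sdegree K))"
proof -
  obtain N C where f: "fits N C K" "Suc (height K 0) < N" "fits N C L" "0 < C"
    by (rule fits_exists[OF sp])
  have legal: "\<forall>a\<in>set (encode N C K). snd a \<longrightarrow> 0 < fst a"
    using sum_bosons(2)[OF f(1,4)] by (auto simp: encode_def)
  have "double_transfer 1 u (encode N C K) (encode N C L) (start b) (start b') =
      of_int (swap_sign b b') * double_transfer u 1 (encode N C K) (encode N C L) (start b') (start b)"
    using intertwined_double_transfer[OF legal, of u "encode N C L"]
    by (cases b; cases b') (simp_all add: intertwined_def start_def swap_sign_def)
  moreover note double_transfer_eq_sum_strip[OF f S, of b b' 1 u] double_transfer_eq_sum_strip[OF f S, of b' b u 1]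
  ultimately show ?thesis using mem by simp
qed

lemma strip_sign_degree: "strip_sign b K L \<noteq> 0 \<Longrightarrow> sdegree K \<le> sdegree L"
  using strip_degree[OF strip_sign_nonzero, of b K L] by simp

text \<open>On both sides the exponent of \<open>u\<close> counts the boxes of the step of type
  \<open>b'\<close>. The identity holds for every real \<open>u\<close>, so comparing coefficients
  of polynomials isolates the steps with \<open>r\<close> boxes.\<close>

lemma strip_sign_commute:
  assumes "superpartition K" "superpartition L" "finite S" "\<forall>M\<in>S. superpartition M"
    and "\<And>M b. superpartition M \<Longrightarrow> strip_sign b M L \<noteq> 0 \<Longrightarrow> M \<in> S"
  shows "(\<Sum>M\<in>S. if sdegree L - sdegree M = r then strip_sign b K M * strip_sign b' M L else 0) =
    swap_sign b b' * (\<Sum>M\<in>S. if sdegree M - sdegree K = r then strip_sign b' K M * strip_sign b M L else 0)"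
proof -
  define R where "R = Max (insert r ((\<lambda>M. sdegree L - sdegree M) ` S \<union> (\<lambda>M. sdegree M - sdegree K) ` S))"
  have R: "r \<le> R" "\<And>M. M \<in> S \<Longrightarrow> sdegree L - sdegree M \<le> R" "\<And>M. M \<in> S \<Longrightarrow> sdegree M - sdegree K \<le> R"
    unfolding R_def using assms(3) by (auto intro!: Max_ge)
  have expand: "(\<Sum>M\<in>S. of_int (a M) * u ^ d M) = (\<Sum>i\<le>R. of_int (\<Sum>M\<in>S. if d M = i then a M else 0) * u ^ i)"
    if "\<And>M. M \<in> S \<Longrightarrow> d M \<le> R" for a :: "spart \<Rightarrow> int" and d and u :: real
  proof -
    have "(\<Sum>i\<le>R. of_int (\<Sum>M\<in>S. if d M = i then a M else 0) * u ^ i) =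
        (\<Sum>M\<in>S. \<Sum>i\<le>R. if d M = i then of_int (a M) * u ^ i else 0)"
      by (subst sum.swap) (simp add: sum_distrib_right if_distrib if_distribR cong: if_cong)
    also have "\<dots> = (\<Sum>M\<in>S. of_int (a M) * u ^ d M)"
      by (intro sum.cong refl) (simp add: that)
    finally show ?thesis by simp
  qed
  let ?c = "\<lambda>i. real_of_int (\<Sum>M\<in>S. if sdegree L - sdegree M = i then strip_sign b K M * strip_sign b' M L else 0)"
  let ?d = "\<lambda>i. real_of_int (\<Sum>M\<in>S. if sdegree M - sdegree K = i then strip_sign b' K M * strip_sign b M L else 0)"
  have "(\<Sum>i\<le>R. ?c i * u ^ i) = (\<Sum>i\<le>R. (of_int (swap_sign b b') * ?d i) * u ^ i)" for u
  proof -
    have "(\<Sum>M\<in>S. of_int (strip_sign b K M * strip_sign b' M L) * u ^ (sdegree L - sdegree M)) =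
      of_int (swap_sign b b') *
      (\<Sum>M\<in>S. of_int (strip_sign b' K M * strip_sign b M L) * u ^ (sdegree M - sdegree K))"
      by (rule strip_sign_commute_poly[OF assms(1-4)]) (rule assms(5))
    then show ?thesis
    by (simp add: expand[OF R(2)] expand[OF R(3)] sum_distrib_left mult.assoc del: of_int_sum of_int_mult)
  qed
  then have "\<forall>i\<le>R. ?c i = of_int (swap_sign b b') * ?d i"
    by (subst (asm) atomize_all) (simp only: polyfun_eq_coeffs)
  then have "?c r = of_int (swap_sign b b') * ?d r" using R(1) by blast
  then show ?thesis by (simp only: of_int_mult[symmetric] of_int_eq_iff)
qed

section \<open>Signed counts of tableaux\<close>

fun barred :: "weight \<Rightarrow> bool" where
  "barred (Plain r) = False"
| "barred (Barred r) = True"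

definition step_sign :: "spart \<Rightarrow> spart \<Rightarrow> weight \<Rightarrow> int" where
  "step_sign K L w = (if sdegree L = sdegree K + weight_abs w then strip_sign (barred w) K L else 0)"

lemma tableau_step_iff:
  assumes "superpartition K" "superpartition L"
  shows "tableau_step K L w \<longleftrightarrow> step_sign K L w \<noteq> 0"
  by (cases w) (simp_all only: tableau_step_Plain[OF assms] tableau_step_Barred[OF assms], 
      auto simp: step_sign_def strip_sign_def)

lemma strip_sign_df: "strip_sign b K L \<noteq> 0 \<Longrightarrow> df K \<le> df L"
  by (auto simp: strip_sign_def plain_strip_def barred_strip_def split: if_splits)

text \<open>Degree and number of circles never decrease along a step, so this finite set contains
  every intermediate shape on the way to \<open>L\<close>, whatever the order of the steps.\<close>

definition below :: "spart \<Rightarrow> spart set" where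
  "below L = {M. superpartition M \<and> sdegree M \<le> sdegree L \<and> df M \<le> df L}"

lemma finite_below: "finite (below L)"
proof -
  let ?A = "{xs. set xs \<subseteq> {..sdegree L} \<and> length xs \<le> df L + sdegree L}"
  have "below L \<subseteq> ?A \<times> ?A"
  proof
    fix M assume M: "M \<in> below L"
    have "p \<le> sdegree M" if "p \<in> set (fst M) \<union> set (snd M)" for p
      using that member_le_sum_list[of p "fst M"] member_le_sum_list[of p "snd M"] by (auto simp: sdegree_def)
    moreover have "length xs \<le> sum_list xs" if "\<forall>a\<in>set xs. 1 \<le> a" for xs :: "nat list"
      using that by (induction xs) auto
    then have "length (snd M) \<le> sum_list (snd M)" using M by (simp add: below_def superpartition_def)
    ultimately show "M \<in> ?A \<times> ?A"
      using M by (cases M) (fastforce simp: below_def df_def sdegree_def)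
  qed
  moreover have "finite ?A" by (intro finite_lists_length_le) simp
  ultimately show ?thesis by (meson finite_SigmaI finite_subset)
qed

lemma below_step: "superpartition M \<Longrightarrow> strip_sign b M L \<noteq> 0 \<Longrightarrow> L \<in> below N \<Longrightarrow> M \<in> below N"
  using strip_sign_degree[of b M L] strip_sign_df[of b M L] by (auto simp: below_def)

lemma step_sign_commute:
  assumes K: "superpartition K" and L: "L \<in> below N"
  shows "(\<Sum>M\<in>below N. step_sign K M w * step_sign M L w') =
    swap_sign (barred w) (barred w') * (\<Sum>M\<in>below N. step_sign K M w' * step_sign M L w)"
proof (cases "sdegree L = sdegree K + weight_abs w + weight_abs w'")
  case False
  then have "step_sign K M w * step_sign M L w' = 0" "step_sign K M w' * step_sign M L w = 0" for M
    by (auto simp: step_sign_def)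
  then show ?thesis by (simp only: sum.neutral_const mult_zero_right)
next
  case True
  have 1: "step_sign K M w * step_sign M L w' = (if sdegree L - sdegree M = weight_abs w'
     then strip_sign (barred w) K M * strip_sign (barred w') M L else 0)" for M
    using True strip_sign_degree[of "barred w'" M L] by (cases "strip_sign (barred w') M L = 0") (auto simp: step_sign_def)
  have 2: "step_sign K M w' * step_sign M L w = (if sdegree M - sdegree K = weight_abs w'
     then strip_sign (barred w') K M * strip_sign (barred w) M L else 0)" for M
    using True strip_sign_degree[of "barred w'" K M] by (cases "strip_sign (barred w') K M = 0") (auto simp: step_sign_def)
  have "(\<Sum>M\<in>below N. if sdegree L - sdegree M = weight_abs w'
       then strip_sign (barred w) K M * strip_sign (barred w') M L else 0) =
    swap_sign (barred w) (barred w') * (\<Sum>M\<in>below N. if sdegree M - sdegree K = weight_abs w'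
       then strip_sign (barred w') K M * strip_sign (barred w) M L else 0)"
    by (rule strip_sign_commute) (use K L below_step[OF _ _ L] finite_below in \<open>auto simp: below_def\<close>)
  then show ?thesis unfolding 1 2 .
qed

section \<open>Chains of steps and their signs\<close>

primrec walk_sum :: "spart \<Rightarrow> weight list \<Rightarrow> spart \<Rightarrow> spart \<Rightarrow> int" where
  "walk_sum N [] K L = of_bool (K = L)"
| "walk_sum N (w # ws) K L = (\<Sum>M\<in>below N. step_sign K M w * walk_sum N ws M L)"

lemma walk_sum_swap:
  assumes "superpartition K"
  shows "walk_sum N (ws @ w # w' # ws') K L = swap_sign (barred w) (barred w') * walk_sum N (ws @ w' # w # ws') K L"
  using assms
proof (induction ws arbitrary: K)
  case Nil
  have *: "walk_sum N (v # v' # ws') K L =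
      (\<Sum>M'\<in>below N. (\<Sum>M\<in>below N. step_sign K M v * step_sign M M' v') * walk_sum N ws' M' L)" for v v'
    by (simp add: sum_distrib_left sum_distrib_right) (subst sum.swap, simp add: mult.assoc)
  have "walk_sum N (w # w' # ws') K L = (\<Sum>M'\<in>below N. swap_sign (barred w) (barred w') *
      ((\<Sum>M\<in>below N. step_sign K M w' * step_sign M M' w) * walk_sum N ws' M' L))"
    unfolding * by (intro sum.cong refl) (simp only: step_sign_commute[OF Nil, of _ N w w'] mult.assoc)
  then show ?case unfolding append_Nil *[of w' w] by (simp only: sum_distrib_left[symmetric])
next
  case (Cons v ws)
  have "walk_sum N (ws @ w # w' # ws') M L = swap_sign (barred w) (barred w') * walk_sum N (ws @ w' # w # ws') M L"
    if "M \<in> below N" for M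
    using that by (intro Cons.IH) (simp add: below_def)
  then show ?case by (simp add: sum_distrib_left mult.left_commute)
qed

primrec walks :: "spart \<Rightarrow> weight list \<Rightarrow> spart \<Rightarrow> spart \<Rightarrow> spart list set" where
  "walks N [] K L = (if K = L then {[K]} else {})"
| "walks N (w # ws) K L = (\<Union>M\<in>{M \<in> below N. tableau_step K M w}. (#) K ` walks N ws M L)"

lemma finite_walks: "finite (walks N ws K L)"
  by (induction ws arbitrary: K) (auto simp: finite_below)

lemma walks_hd: "Ls \<in> walks N ws K L \<Longrightarrow> \<exists>Ls'. Ls = K # Ls'"
  by (cases ws) (auto split: if_splits)

lemma walks_iff:
  "Ls \<in> walks N ws K L \<longleftrightarrow> length Ls = Suc (length ws) \<and> Ls ! 0 = K \<and> Ls ! length ws = L \<and>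
     (\<forall>i<length ws. tableau_step (Ls ! i) (Ls ! Suc i) (ws ! i) \<and> Ls ! Suc i \<in> below N)"
proof (induction ws arbitrary: K Ls)
  case Nil
  show ?case by (cases Ls) auto
next
  case (Cons w ws)
  show ?case
  proof (cases "\<exists>Ls'. Ls = K # Ls' \<and> Ls' \<noteq> []")
    case True
    then obtain Ls' where Ls: "Ls = K # Ls'" "Ls' \<noteq> []" by blast
    have "Ls \<in> walks N (w # ws) K L \<longleftrightarrow> (\<exists>M\<in>below N. tableau_step K M w \<and> Ls' \<in> walks N ws M L)"
      by (auto simp: Ls)
    also have "\<dots> \<longleftrightarrow> Ls' ! 0 \<in> below N \<and> tableau_step K (Ls' ! 0) w \<and> Ls' \<in> walks N ws (Ls' ! 0) L"
      using Cons.IH by auto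
    also have "\<dots> \<longleftrightarrow> length Ls = Suc (length (w # ws)) \<and> Ls ! 0 = K \<and> Ls ! length (w # ws) = L \<and>
     (\<forall>i<length (w # ws). tableau_step (Ls ! i) (Ls ! Suc i) ((w # ws) ! i) \<and> Ls ! Suc i \<in> below N)"
      unfolding Cons.IH Ls(1) by (auto simp: All_less_Suc2)
    finally show ?thesis .
  next
    case False
    then have "Ls \<notin> walks N (w # ws) K L" by (auto dest: walks_hd)
    moreover have "\<not> (length Ls = Suc (length (w # ws)) \<and> Ls ! 0 = K)"
      using False by (cases Ls) auto
    ultimately show ?thesis by blast
  qed
qed

lemma walk_sum_eq:
  assumes "superpartition K"
  shows "walk_sum N ws K L = (\<Sum>Ls\<in>walks N ws K L. \<Prod>i<length ws. step_sign (Ls ! i) (Ls ! Suc i) (ws ! i))"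
  using assms
proof (induction ws arbitrary: K)
  case Nil
  show ?case by simp
next
  case (Cons w ws)
  let ?f = "\<lambda>ws Ls. \<Prod>i<length ws. step_sign (Ls ! i) (Ls ! Suc i) (ws ! i)"
  let ?S = "{M \<in> below N. tableau_step K M w}"
  have fin: "finite ?S" by (simp add: finite_below)
  have "(\<Sum>Ls\<in>walks N (w # ws) K L. ?f (w # ws) Ls) = (\<Sum>M\<in>?S. \<Sum>Ls\<in>(#) K ` walks N ws M L. ?f (w # ws) Ls)"
    unfolding walks.simps
    by (rule sum.UNION_disjoint[OF fin]) (auto simp: finite_walks dest: walks_hd)
  also have "\<dots> = (\<Sum>M\<in>?S. \<Sum>Ls\<in>walks N ws M L. step_sign K M w * ?f ws Ls)"
  proof (rule sum.cong[OF refl])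
    fix M
    have "(\<Sum>Ls\<in>(#) K ` walks N ws M L. ?f (w # ws) Ls) = (\<Sum>Ls\<in>walks N ws M L. ?f (w # ws) (K # Ls))"
      by (subst sum.reindex) auto
    also have "\<dots> = (\<Sum>Ls\<in>walks N ws M L. step_sign K M w * ?f ws Ls)"
    proof (rule sum.cong[OF refl])
      fix Ls assume "Ls \<in> walks N ws M L"
      then have "Ls ! 0 = M" by (simp add: walks_iff)
      then show "?f (w # ws) (K # Ls) = step_sign K M w * ?f ws Ls"
        unfolding list.size(4) add.right_neutral add_Suc_right prod.lessThan_Suc_shift by simp
    qed
    finally show "(\<Sum>Ls\<in>(#) K ` walks N ws M L. ?f (w # ws) Ls) = (\<Sum>Ls\<in>walks N ws M L. step_sign K M w * ?f ws Ls)" .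
  qed
  also have "\<dots> = (\<Sum>M\<in>?S. step_sign K M w * walk_sum N ws M L)"
    by (intro sum.cong refl) (simp add: Cons.IH below_def sum_distrib_left)
  also have "\<dots> = (\<Sum>M\<in>below N. step_sign K M w * walk_sum N ws M L)"
    by (intro sum.mono_neutral_left finite_below) (auto simp: tableau_step_iff Cons.prems below_def)
  finally show ?case by simp
qed

lemma tableaux_eq_walks:
  assumes L: "superpartition L"
  shows "{Ls. tableau L \<alpha> Ls} = walks L \<alpha> ([], []) L"
proof (intro set_eqI iffI)
  fix Ls assume "Ls \<in> {Ls. tableau L \<alpha> Ls}"
  then have T: "length Ls = Suc (length \<alpha>)" "\<forall>K\<in>set Ls. superpartition K" "Ls ! 0 = ([], [])" "Ls ! length \<alpha> = L"
    "\<And>i. i < length \<alpha> \<Longrightarrow> tableau_step (Ls ! i) (Ls ! Suc i) (\<alpha> ! i)" by (auto simp: tableau_def)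
  have sp: "superpartition (Ls ! i)" if "i \<le> length \<alpha>" for i using T(1,2) that by simp
  have "Ls ! i \<in> below L" if "i \<le> length \<alpha>" for i
    using that
  proof (induction i rule: inc_induct)
    case base
    then show ?case using T(4) L by (simp add: below_def)
  next
    case (step i)
    then have "step_sign (Ls ! i) (Ls ! Suc i) (\<alpha> ! i) \<noteq> 0"
      using T(5)[of i] sp by (simp add: tableau_step_iff)
    then show ?case using below_step[OF sp _ step.IH] step.hyps by (auto simp: step_sign_def split: if_splits)
  qed
  then show "Ls \<in> walks L \<alpha> ([], []) L" using T by (simp add: walks_iff)
next
  fix Ls assume W: "Ls \<in> walks L \<alpha> ([], []) L"
  have "superpartition (Ls ! i)" if "i < length Ls" for i
    using W that by (cases i) (auto simp: walks_iff below_def superpartition_def)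
  then have "\<forall>K\<in>set Ls. superpartition K" by (metis in_set_conv_nth)
  then show "Ls \<in> {Ls. tableau L \<alpha> Ls}" using W by (simp add: walks_iff tableau_def)
qed

text \<open>\<open>\<theta>\<^bsub>ls ! 0\<^esub> \<theta>\<^bsub>ls ! 1\<^esub> \<dots> = theta_sign ls \<theta>\<^bsub>set ls\<^esub>\<close>.\<close>

definition theta_sign :: "nat list \<Rightarrow> rat" where
  "theta_sign ls = coeff (prod_list (map Theta ls)) [] (set ls)"

lemma theta_sign_Nil: "theta_sign [] = 1"
  by (simp add: theta_sign_def one_superseries.rep_eq)

lemma theta_sign_Cons: "a \<notin> set ls \<Longrightarrow> theta_sign (a # ls) = cross_sign {a} (set ls) * theta_sign ls"
  by (simp add: theta_sign_def coeff_Theta_times)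

text \<open>The new label is the largest, so its theta belongs at the end and crosses the
  \<open>length ls - k\<close> thetas behind it.\<close>

lemma theta_sign_insert:
  assumes "distinct ls" "\<forall>l\<in>set ls. l < i"
  shows "theta_sign (take k ls @ i # drop k ls) = (- 1) ^ (length ls - k) * theta_sign ls"
  using assms
proof (induction ls arbitrary: k)
  case Nil
  then show ?case by (simp add: theta_sign_Cons theta_sign_Nil)
next
  case (Cons a ls)
  show ?case
  proof (cases k)
    case 0
    have "cross_sign {i} (set (a # ls)) = (\<Prod>l\<in>set (a # ls). - 1)"
      unfolding cross_sign_def using Cons.prems by (simp cong: prod.cong)
    also have "\<dots> = (- 1) ^ length (a # ls)"
      using distinct_card[OF Cons.prems(1)] by simp
    finally show ?thesis
      using 0 Cons.prems by (simp only: take_0 drop_0 append_Nil diff_zero) (subst theta_sign_Cons, auto)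
  next
    case (Suc k')
    have set: "set (take k' ls @ i # drop k' ls) = insert i (set ls)"
      by (metis append_take_drop_id list.simps(15) set_append Un_insert_right)
    have "cross_sign {a} (insert i (set ls)) = cross_sign {a} (set ls)"
      using Cons.prems by (auto simp: cross_sign_def)
    moreover have "a \<notin> insert i (set ls)" using Cons.prems by auto
    ultimately show ?thesis
      using Cons Suc by (simp add: theta_sign_Cons set del: set_append)
  qed
qed

text \<open>All columns left of \<open>q\<close> gain a box, so exactly the old circles left of
  \<open>q\<close> go to rows beyond \<open>height L q\<close>, and these rows belong to the circles
  of \<open>L\<close> left of \<open>q\<close>. This identifies the sign of the vertex model with
  that of \<open>theta_sign_insert\<close>.\<close>

lemma barred_strip_sign:
  assumes K: "superpartition K" and L: "superpartition L" and q: "barred_strip q K L"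
  shows "card {c \<in> set (fst K). c < q} = df K - card {p \<in> circles L. fst p < height L q}"
proof -
  note bs = q[unfolded barred_strip_def]
  let ?F = "set (fst K)" and ?G = "set (fst L)"
  have strict: "c < d \<Longrightarrow> d \<in> ?G \<Longrightarrow> height L d < height L c" for c d by (rule height_strict)
  have hF: "height L c > height L q \<longleftrightarrow> c < q" if "c \<in> ?F" for c
  proof
    assume "height L q < height L c"
    then show "c < q" using height_antimono[of q c L] by (cases "c < q") auto
  next
    assume "c < q"
    then show "height L q < height L c" using bs height_antimono[of c q K] by simp
  qed
  have hG: "height L c > height L q \<longleftrightarrow> c < q" for c
    using height_antimono[of q c L] strict[of c q] bs by (cases "c < q") auto
  have "height L ` {c \<in> ?F. c < q} = {t \<in> height L ` ?F. height L q < t}" using hF by auto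
  also have "\<dots> = {t \<in> height L ` (?G - {q}). height L q < t}" using bs by simp
  also have "\<dots> = height L ` {c \<in> ?G. c < q}" using hG by auto
  finally have "card (height L ` {c \<in> ?F. c < q}) = card (height L ` {c \<in> ?G. c < q})" by simp
  moreover have "card (height L ` {c \<in> ?F. c < q}) = card {c \<in> ?F. c < q}"
    by (rule card_image) (rule inj_on_subset[OF barred_strip_inj[OF assms]], auto)
  moreover have "card (height L ` {c \<in> ?G. c < q}) = card {c \<in> ?G. c < q}"
    by (rule card_image) (rule inj_on_subset[OF inj_on_height], auto)
  ultimately have "card {c \<in> ?F. c < q} = card {c \<in> ?G. c < q}" by simp
  moreover have "card {p \<in> circles L. fst p < height L q} = card {c \<in> ?G. q < c}"
  proof -
    have "height L c < height L q \<longleftrightarrow> q < c" if "c \<in> ?G" for c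
      using strict[of q c] that height_antimono[of c q L] by (cases "q < c") auto
    then have "{p \<in> circles L. fst p < height L q} = (\<lambda>c. (height L c, c)) ` {c \<in> ?G. q < c}"
      by (auto simp: circles_eq[OF L])
    then show ?thesis by (simp add: card_image inj_on_def)
  qed
  moreover have "card ?G = Suc (card {c \<in> ?G. c < q} + card {c \<in> ?G. q < c})"
  proof -
    have "?G = insert q ({c \<in> ?G. c < q} \<union> {c \<in> ?G. q < c})" using bs by auto
    then have "card ?G = card (insert q ({c \<in> ?G. c < q} \<union> {c \<in> ?G. q < c}))" by simp
    also have "\<dots> = Suc (card ({c \<in> ?G. c < q} \<union> {c \<in> ?G. q < c}))" by (subst card_insert_disjoint) auto
    also have "card ({c \<in> ?G. c < q} \<union> {c \<in> ?G. q < c}) = card {c \<in> ?G. c < q} + card {c \<in> ?G. q < c}"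
      by (rule card_Un_disjoint) auto
    finally show ?thesis .
  qed
  ultimately show ?thesis using bs by (simp add: card_fst L)
qed

lemma tableauD:
  assumes "tableau L \<alpha> Ls"
  shows "i \<le> length \<alpha> \<Longrightarrow> superpartition (Ls ! i)"
    "i < length \<alpha> \<Longrightarrow> tableau_step (Ls ! i) (Ls ! Suc i) (\<alpha> ! i)"
    "i < length \<alpha> \<Longrightarrow> step_sign (Ls ! i) (Ls ! Suc i) (\<alpha> ! i) \<noteq> 0"
    "i < length \<alpha> \<Longrightarrow> strip (Ls ! i) (Ls ! Suc i)"
    "i < length \<alpha> \<Longrightarrow> sdegree (Ls ! Suc i) = sdegree (Ls ! i) + weight_abs (\<alpha> ! i)"
proof -
  show sp: "superpartition (Ls ! i)" if "i \<le> length \<alpha>" for i using assms that by (simp add: tableau_def)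
  show st: "tableau_step (Ls ! i) (Ls ! Suc i) (\<alpha> ! i)" if "i < length \<alpha>" for i using assms that by (simp add: tableau_def)
  show nz: "step_sign (Ls ! i) (Ls ! Suc i) (\<alpha> ! i) \<noteq> 0" if "i < length \<alpha>" for i
    using st[OF that] sp that by (simp add: tableau_step_iff)
  show "strip (Ls ! i) (Ls ! Suc i)" if "i < length \<alpha>"
    using nz[OF that] strip_sign_nonzero by (auto simp: step_sign_def split: if_splits)
  show "sdegree (Ls ! Suc i) = sdegree (Ls ! i) + weight_abs (\<alpha> ! i)" if "i < length \<alpha>"
    using nz[OF that] by (auto simp: step_sign_def split: if_splits)
qed

text \<open>Label \<open>n\<close> exceeds all earlier labels, so \<open>theta_sign_insert\<close>
  gives the effect of step \<open>n\<close>, and \<open>barred_strip_sign\<close> recognizes it as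
  \<open>step_sign\<close>.\<close>

lemma circle_labels_props:
  assumes T: "tableau L \<alpha> Ls" and "n \<le> length \<alpha>"
  shows "distinct (circle_labels \<alpha> Ls n) \<and> set (circle_labels \<alpha> Ls n) = {i. i < n \<and> barred (\<alpha> ! i)} \<and>
    theta_sign (circle_labels \<alpha> Ls n) = of_int (\<Prod>i<n. step_sign (Ls ! i) (Ls ! Suc i) (\<alpha> ! i))"
  using assms(2)
proof (induction n)
  case 0
  then show ?case by (simp add: theta_sign_Nil)
next
  case (Suc n)
  let ?K = "Ls ! n" and ?L = "Ls ! Suc n" and ?ls = "circle_labels \<alpha> Ls n"
  have n: "n < length \<alpha>" "n \<le> length \<alpha>" using Suc.prems by auto
  have K: "superpartition ?K" and L: "superpartition ?L"
    and nz: "step_sign ?K ?L (\<alpha> ! n) \<noteq> 0" and deg: "sdegree ?L = sdegree ?K + weight_abs (\<alpha> ! n)"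
    using tableauD[OF T] Suc.prems by auto
  have IH: "distinct ?ls" "set ?ls = {i. i < n \<and> barred (\<alpha> ! i)}"
    "theta_sign ?ls = of_int (\<Prod>i<n. step_sign (Ls ! i) (Ls ! Suc i) (\<alpha> ! i))"
    using Suc.IH[OF n(2)] by auto
  show ?case
  proof (cases "\<alpha> ! n")
    case (Plain r)
    have "step_sign ?K ?L (\<alpha> ! n) = 1"
      using nz Plain by (auto simp: step_sign_def strip_sign_def split: if_splits)
    moreover have "circle_labels \<alpha> Ls (Suc n) = ?ls" using Plain by simp
    moreover have "{i. i < Suc n \<and> barred (\<alpha> ! i)} = {i. i < n \<and> barred (\<alpha> ! i)}"
      using Plain by (auto simp: less_Suc_eq)
    ultimately show ?thesis using IH by simp
  next
    case (Barred r)
    then obtain q where q: "barred_strip q ?K ?L"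
      using nz by (auto simp: step_sign_def strip_sign_def split: if_splits)
    then have the_q: "(THE q. barred_strip q ?K ?L) = q" by (blast intro: barred_strip_unique)
    have sg: "step_sign ?K ?L (\<alpha> ! n) = (- 1) ^ card {c \<in> set (fst ?K). c < q}"
      using deg Barred q the_q by (auto simp: step_sign_def strip_sign_def)
    have the_nc: "(THE q. new_circle ?K ?L q) = (height ?L q, q)"
      unfolding barred_strip_new_circle[OF L q] by (rule the_eq_trivial)
    define k where "k = card {p \<in> circles ?L. fst p < height ?L q}"
    have step: "circle_labels \<alpha> Ls (Suc n) = take k ?ls @ n # drop k ?ls"
      by (simp add: Barred Let_def the_nc k_def)
    have len: "length ?ls = df ?K" by (rule length_circle_labels[OF T n(2)])
    have "theta_sign (take k ?ls @ n # drop k ?ls) = (- 1) ^ (df ?K - k) * theta_sign ?ls"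
      using theta_sign_insert[of ?ls n k] IH len by simp
    also have "df ?K - k = card {c \<in> set (fst ?K). c < q}"
      unfolding k_def by (rule barred_strip_sign[OF K L q, symmetric])
    finally have "theta_sign (circle_labels \<alpha> Ls (Suc n)) =
        of_int (\<Prod>i<Suc n. step_sign (Ls ! i) (Ls ! Suc i) (\<alpha> ! i))"
      unfolding step by (simp add: IH(3) sg)
    moreover have "set (circle_labels \<alpha> Ls (Suc n)) = {i. i < Suc n \<and> barred (\<alpha> ! i)}"
    proof -
      have "set (take k ?ls @ n # drop k ?ls) = insert n (set (take k ?ls @ drop k ?ls))"
        by (simp del: append_take_drop_id)
      also have "\<dots> = insert n {i. i < n \<and> barred (\<alpha> ! i)}" by (simp only: append_take_drop_id IH(2))
      also have "\<dots> = {i. i < Suc n \<and> barred (\<alpha> ! i)}" using Barred by (auto simp: less_Suc_eq)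
      finally show ?thesis unfolding step .
    qed
    moreover have "distinct (circle_labels \<alpha> Ls (Suc n))"
    proof -
      have "n \<notin> set ?ls" using IH(2) by simp
      then have "n \<notin> set (take k ?ls)" "n \<notin> set (drop k ?ls)"
        by (meson in_set_takeD, meson in_set_dropD)
      moreover have "set (take k ?ls) \<inter> set (drop k ?ls) = {}" using IH(1) by (rule set_take_disj_set_drop_if_distinct) simp
      ultimately show ?thesis unfolding step using IH(1) by auto
    qed
    ultimately show ?thesis by blast
  qed
qed

lemma sum_theta_sign_tableaux:
  assumes "superpartition L"
  shows "(\<Sum>Ls | tableau L \<alpha> Ls. theta_sign (circle_labels \<alpha> Ls (length \<alpha>))) = of_int (walk_sum L \<alpha> ([], []) L)"
proof -
  have "walk_sum L \<alpha> ([], []) L = (\<Sum>Ls | tableau L \<alpha> Ls. \<Prod>i<length \<alpha>. step_sign (Ls ! i) (Ls ! Suc i) (\<alpha> ! i))"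
    unfolding tableaux_eq_walks[OF assms] by (rule walk_sum_eq) (simp add: superpartition_def)
  also have "of_int \<dots> = (\<Sum>Ls | tableau L \<alpha> Ls. theta_sign (circle_labels \<alpha> Ls (length \<alpha>)))"
    unfolding of_int_sum by (intro sum.cong refl) (use circle_labels_props in simp)
  finally show ?thesis by simp
qed

lemma finite_tableaux: "superpartition L \<Longrightarrow> finite {Ls. tableau L \<alpha> Ls}"
  by (simp add: tableaux_eq_walks finite_walks)

section \<open>Coefficients of Schur functions\<close>

definition content :: "spart \<Rightarrow> filling \<Rightarrow> nat list" where
  "content L T = map (\<lambda>q. the (fst T q)) (box_list L)"

lemma length_content: "length (content L T) = sdegree L"
  by (simp add: content_def length_box_list)

definition stabilizer_size :: "nat list \<Rightarrow> nat" where
  "stabilizer_size w = card {\<sigma>. \<sigma> permutes {..<length w} \<and> permute_list \<sigma> w = w}"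

text \<open>The permutations that carry \<open>u\<close> to \<open>w\<close> form a coset of the
  stabilizer of \<open>w\<close> or the empty set.\<close>

lemma card_permute_list_eq:
  "card {\<sigma>. \<sigma> permutes {..<length u} \<and> permute_list \<sigma> u = w} = (if mset u = mset w then stabilizer_size w else 0)"
proof (cases "mset u = mset w")
  case True
  then obtain \<tau> where \<tau>: "\<tau> permutes {..<length w}" "permute_list \<tau> w = u"
    using mset_eq_permutation by metis
  have len: "length u = length w" using True by (rule mset_eq_length)
  have "bij_betw (\<lambda>\<sigma>. \<tau> \<circ> \<sigma>) {\<sigma>. \<sigma> permutes {..<length u} \<and> permute_list \<sigma> u = w}
      {\<sigma>. \<sigma> permutes {..<length w} \<and> permute_list \<sigma> w = w}"
  proof (rule bij_betw_byWitness[where f' = "\<lambda>\<sigma>. inv \<tau> \<circ> \<sigma>"])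
    show "\<forall>\<sigma>\<in>{\<sigma>. \<sigma> permutes {..<length u} \<and> permute_list \<sigma> u = w}. inv \<tau> \<circ> (\<tau> \<circ> \<sigma>) = \<sigma>"
      by (simp add: fun_eq_iff permutes_inverses[OF \<tau>(1)])
    show "\<forall>\<sigma>\<in>{\<sigma>. \<sigma> permutes {..<length w} \<and> permute_list \<sigma> w = w}. \<tau> \<circ> (inv \<tau> \<circ> \<sigma>) = \<sigma>"
      by (simp add: fun_eq_iff permutes_inverses[OF \<tau>(1)])
    show "(\<lambda>\<sigma>. \<tau> \<circ> \<sigma>) ` {\<sigma>. \<sigma> permutes {..<length u} \<and> permute_list \<sigma> u = w}
        \<subseteq> {\<sigma>. \<sigma> permutes {..<length w} \<and> permute_list \<sigma> w = w}"
    proof (rule image_subsetI)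
      fix \<sigma> assume "\<sigma> \<in> {\<sigma>. \<sigma> permutes {..<length u} \<and> permute_list \<sigma> u = w}"
      then have \<sigma>: "\<sigma> permutes {..<length w}" "permute_list \<sigma> u = w" by (simp_all only: len mem_Collect_eq)
      show "\<tau> \<circ> \<sigma> \<in> {\<sigma>. \<sigma> permutes {..<length w} \<and> permute_list \<sigma> w = w}"
        using permutes_compose[OF \<sigma>(1) \<tau>(1)] permute_list_compose[OF \<sigma>(1), of \<tau>] \<tau>(2) \<sigma>(2) by simp
    qed
    have inv: "permute_list (inv \<tau>) u = w"
      using permute_list_compose[OF permutes_inv[OF \<tau>(1)], of \<tau>]
      unfolding \<tau>(2) permutes_inv_o(1)[OF \<tau>(1)] by simp
    show "(\<lambda>\<sigma>. inv \<tau> \<circ> \<sigma>) ` {\<sigma>. \<sigma> permutes {..<length w} \<and> permute_list \<sigma> w = w}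
        \<subseteq> {\<sigma>. \<sigma> permutes {..<length u} \<and> permute_list \<sigma> u = w}"
    proof (rule image_subsetI)
      fix \<sigma> assume "\<sigma> \<in> {\<sigma>. \<sigma> permutes {..<length w} \<and> permute_list \<sigma> w = w}"
      then have \<sigma>: "\<sigma> permutes {..<length w}" "permute_list \<sigma> w = w" by simp_all
      have "permute_list (inv \<tau> \<circ> \<sigma>) u = permute_list \<sigma> (permute_list (inv \<tau>) u)"
        by (rule permute_list_compose) (simp add: \<sigma>(1) len)
      then show "inv \<tau> \<circ> \<sigma> \<in> {\<sigma>. \<sigma> permutes {..<length u} \<and> permute_list \<sigma> u = w}"
        using permutes_compose[OF \<sigma>(1) permutes_inv[OF \<tau>(1)]] unfolding inv \<sigma>(2) len by simp
    qed
  qed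
  then show ?thesis using True by (simp add: stabilizer_size_def bij_betw_same_card)
next
  case False
  then have "{\<sigma>. \<sigma> permutes {..<length u} \<and> permute_list \<sigma> u = w} = {}"
    by auto
  then show ?thesis using False by (simp only: card.empty if_False)
qed

lemma stabilizer_size_map: "inj f \<Longrightarrow> stabilizer_size (map f w) = stabilizer_size w"
proof -
  assume f: "inj f"
  have "{\<sigma>. \<sigma> permutes {..<length w} \<and> permute_list \<sigma> (map f w) = map f w} =
      {\<sigma>. \<sigma> permutes {..<length w} \<and> permute_list \<sigma> w = w}"
    using inj_map_eq_map[OF f] by (auto simp: permute_list_map)
  then show ?thesis by (simp add: stabilizer_size_def)
qed

text \<open>One factor contains only thetas and the other only x, so a single split of the monomial
  survives. The second factor is summed over all orders of the boxes, hence depends only on the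
  multiset of labels.\<close>

lemma coeff_tableau_term_eq:
  "coeff (tableau_term L T) w I =
    (if set (snd T) = I \<and> mset (content L T) = mset w then theta_sign (snd T) * of_nat (stabilizer_size w) else 0)"
proof -
  let ?u = "content L T" and ?P = "{\<sigma>. \<sigma> permutes {..<sdegree L}}"
  define p where "p = prod_list (map Theta (snd T))"
  define q where "q = (\<Sum>\<sigma>\<in>?P. prod_list (map X (permute_list \<sigma> ?u)))"
  have "prod_list (map (\<lambda>i. X (the (fst T (box_list L ! \<sigma> i)))) [0..<sdegree L]) = prod_list (map X (permute_list \<sigma> ?u))"
    if "\<sigma> \<in> ?P" for \<sigma>
  proof -
    have "\<sigma> i < sdegree L" if "i < sdegree L" for i
      using permutes_in_image[of \<sigma> "{..<sdegree L}" i] \<open>\<sigma> \<in> ?P\<close> that by simp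
    then have "map (\<lambda>i. the (fst T (box_list L ! \<sigma> i))) [0..<sdegree L] = permute_list \<sigma> ?u"
      by (auto simp: permute_list_def length_content content_def length_box_list)
    then show ?thesis by (metis (mono_tags, lifting) list.map_comp o_def map_eq_conv)
  qed
  then have term_eq: "tableau_term L T = p * q" by (simp add: tableau_term_def p_def q_def)
  have p0: "coeff p u J = (if u = [] \<and> J = set (snd T) then theta_sign (snd T) else 0)" for u J
    using coeff_prod_Theta[of "snd T" u J] by (auto simp: p_def theta_sign_def)
  have fin: "finite ?P" by (simp add: finite_permutations)
  have q0: "coeff q v K = (if K = {} then of_nat (card {\<sigma> \<in> ?P. permute_list \<sigma> ?u = v}) else 0)" for v K
  proof -
    have "coeff q v K = (\<Sum>\<sigma>\<in>?P. if permute_list \<sigma> ?u = v \<and> K = {} then 1 else 0)"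
      unfolding q_def coeff_sum coeff_prod_X by (intro sum.cong refl if_cong) auto
    also have "\<dots> = (if K = {} then of_nat (card {\<sigma> \<in> ?P. permute_list \<sigma> ?u = v}) else 0)"
      using fin by (simp add: sum.If_cases Int_def)
    finally show ?thesis .
  qed
  show ?thesis
  proof (cases "finite I")
    case True
    have "coeff (p * q) w I = coeff p [] I * coeff q w {}"
      unfolding coeff_times_fun
      by (subst sum_singleton_support[OF finite_splits[OF True], where a = "(([], w), (I, {}))"])
         (auto simp: splits_def p0 q0)
    then show ?thesis
      unfolding term_eq p0 q0 using card_permute_list_eq[of ?u w] by (auto simp: length_content)
  next
    case False
    then have "set (snd T) \<noteq> I" by auto
    then show ?thesis using False by (simp add: coeff_infinite)
  qed
qed

text \<open>The weight of a tableau that contributes to the monomial \<open>x\<^sub>w \<theta>\<^sub>I\<close>, as a sequence of length \<open>n\<close>.\<close>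

definition weights :: "nat list \<Rightarrow> nat set \<Rightarrow> nat \<Rightarrow> weight list" where
  "weights w I n = map (\<lambda>i. (if i \<in> I then Barred else Plain) (count_list w i)) [0..<n]"

lemma length_weights [simp]: "length (weights w I n) = n"
  by (simp add: weights_def)

lemma nth_weights: "i < n \<Longrightarrow> weights w I n ! i = (if i \<in> I then Barred else Plain) (count_list w i)"
  by (simp add: weights_def)

lemma weights_Suc: "weights w I (Suc n) = weights w I n @ [(if n \<in> I then Barred else Plain) (count_list w n)]"
  by (simp add: weights_def)

section \<open>Recovering a tableau from its filling\<close>

lemma tableau_boxes_mono:
  assumes "tableau L \<alpha> Ls" "i \<le> j" "j \<le> length \<alpha>"
  shows "boxes (Ls ! i) \<subseteq> boxes (Ls ! j)"
  using assms(2,3)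
proof (induction j rule: dec_induct)
  case (step j)
  have "strip (Ls ! j) (Ls ! Suc j)" using tableauD(4)[OF assms(1), of j] step.prems by simp
  then have "boxes (Ls ! j) \<subseteq> boxes (Ls ! Suc j)"
    by (auto simp: boxes_eq strip_def intro: order_less_le_trans)
  then show ?case using step by simp
qed simp

lemma box_label_iff:
  assumes T: "tableau L \<alpha> Ls"
  shows "box_labels \<alpha> Ls q = Some i \<longleftrightarrow> i < length \<alpha> \<and> q \<in> boxes (Ls ! Suc i) - boxes (Ls ! i)"
proof -
  let ?P = "\<lambda>i. i < length \<alpha> \<and> q \<in> boxes (Ls ! Suc i) - boxes (Ls ! i)"
  have uniq: "i = j" if "?P i" "?P j" for i j
  proof (rule ccontr)
    assume "i \<noteq> j"
    then consider "Suc i \<le> j" | "Suc j \<le> i" by linarith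
    then show False
      by cases (use that tableau_boxes_mono[OF T, of "Suc i" j] tableau_boxes_mono[OF T, of "Suc j" i] in auto)
  qed
  have ex: "\<exists>i. ?P i" if q: "q \<in> boxes (Ls ! length \<alpha>)"
  proof -
    define m where "m = (LEAST m. q \<in> boxes (Ls ! m))"
    have m: "q \<in> boxes (Ls ! m)" "m \<le> length \<alpha>"
      unfolding m_def using q by (auto intro: LeastI Least_le)
    have "boxes (Ls ! 0) = {}" using T by (simp add: tableau_def boxes_eq height_def)
    then have "m \<noteq> 0" using m(1) by (metis empty_iff)
    then obtain i where i: "m = Suc i" by (cases m) auto
    then have "q \<notin> boxes (Ls ! i)" using not_less_Least[of i "\<lambda>m. q \<in> boxes (Ls ! m)"] by (simp add: m_def)
    then show ?thesis using m i by (intro exI[of _ i]) auto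
  qed
  have sub: "q \<in> boxes (Ls ! length \<alpha>)" if "?P i" for i
    using that tableau_boxes_mono[OF T, of "Suc i" "length \<alpha>"] by auto
  show ?thesis
  proof (cases "q \<in> boxes (Ls ! length \<alpha>)")
    case True
    then obtain j where j: "?P j" using ex by blast
    then have "(THE i. ?P i) = j" by (rule the_equality) (rule uniq[OF _ j])
    then have lab: "box_labels \<alpha> Ls q = Some j" using True by (simp only: box_labels_def if_True)
    show ?thesis
    proof
      assume "box_labels \<alpha> Ls q = Some i"
      then show "?P i" using lab j by simp
    next
      assume "?P i"
      then show "box_labels \<alpha> Ls q = Some i" using lab uniq[OF j] by simp
    qed
  next
    case False
    then have "box_labels \<alpha> Ls q = None" "\<not> ?P i" using sub by (auto simp: box_labels_def)
    then show ?thesis by simp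
  qed
qed

lemma distinct_box_list: "distinct (box_list L)"
proof -
  have "distinct (concat (map (\<lambda>t. map (Pair t) (g t)) ts))"
    if "distinct ts" "\<forall>t. distinct (g t)" for ts :: "nat list" and g :: "nat \<Rightarrow> nat list"
    using that by (induction ts) (auto simp: distinct_map inj_on_def)
  then show ?thesis unfolding box_list_def by simp
qed

lemma count_content:
  assumes "dom (fst T) = boxes L"
  shows "count_list (content L T) i = card {q. fst T q = Some i}"
proof -
  have "count_list (content L T) i = length (filter (\<lambda>q. the (fst T q) = i) (box_list L))"
    unfolding content_def by (induction "box_list L" rule: rev_induct) (auto simp: count_list_eq_length_filter filter_map comp_def eq_commute)
  also have "\<dots> = card (set (filter (\<lambda>q. the (fst T q) = i) (box_list L)))"
    by (rule distinct_card[symmetric]) (simp add: distinct_box_list)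
  also have "set (filter (\<lambda>q. the (fst T q) = i) (box_list L)) = {q. fst T q = Some i}"
    unfolding set_filter set_box_list assms[symmetric] by auto
  finally show ?thesis .
qed

lemma count_content_tableau:
  assumes T: "tableau L \<alpha> Ls"
  shows "count_list (content L (box_labels \<alpha> Ls, ls)) i = (if i < length \<alpha> then weight_abs (\<alpha> ! i) else 0)"
proof -
  have "dom (box_labels \<alpha> Ls) = boxes L" using T by (auto simp: box_labels_def tableau_def dom_def)
  then have "count_list (content L (box_labels \<alpha> Ls, ls)) i = card {q. box_labels \<alpha> Ls q = Some i}"
    by (simp add: count_content)
  also have "\<dots> = (if i < length \<alpha> then weight_abs (\<alpha> ! i) else 0)"
  proof (cases "i < length \<alpha>")
    case True
    have "card (boxes (Ls ! Suc i) - boxes (Ls ! i)) = weight_abs (\<alpha> ! i)"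
      using strip_degree[OF tableauD(4)[OF T True]] tableauD(5)[OF T True] by simp
    then show ?thesis using True by (simp add: box_label_iff[OF T] set_diff_eq)
  qed (simp add: box_label_iff[OF T])
  finally show ?thesis .
qed

text \<open>At a circle column of either superpartition the common height drops strictly below that
  of all columns to its left, so rows determine columns. \<open>A\<close> will be everything for a
  plain step and the complement of the new circle for a barred one.\<close>

lemma same_height_circles:
  assumes "height L = height L'" "height L ` (set (fst L) \<inter> A) = height L ` (set (fst L') \<inter> A)"
  shows "set (fst L) \<inter> A = set (fst L') \<inter> A"
proof -
  have "inj_on (height L) (set (fst L) \<union> set (fst L'))"
  proof (rule inj_onI)
    fix c d assume cd: "c \<in> set (fst L) \<union> set (fst L')" "d \<in> set (fst L) \<union> set (fst L')" "height L c = height L d"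
    show "c = d"
      using cd height_strict[of c L d] height_strict[of d L c] height_strict[of c L' d] height_strict[of d L' c] assms(1)
      by (metis UnE less_irrefl linorder_neqE_nat)
  qed
  then show ?thesis using assms(2) by (meson inf_le1 inj_on_image_eq_iff le_supI1 le_supI2)
qed

text \<open>A filling records only the final circles, but those of a step are determined by the previous superpartition and the
  boxes, so a tableau can be recovered from its filling from left to right.\<close>

lemma tableau_step_determ:
  assumes sp: "superpartition K" "superpartition L" "superpartition L'" and h: "height L = height L'"
    and nz: "step_sign K L w \<noteq> 0" "step_sign K L' w \<noteq> 0"
  shows "L = L'"
proof (cases w)
  case (Plain r)
  then have "plain_strip K L" "plain_strip K L'"
    using nz by (auto simp: step_sign_def strip_sign_def split: if_splits)
  then have "height L ` (set (fst L) \<inter> UNIV) = height L ` (set (fst L') \<inter> UNIV)"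
    using h by (simp add: plain_strip_def)
  from same_height_circles[OF h this] show ?thesis
    using sp h by (intro superpartition_eqI) auto
next
  case (Barred r)
  then obtain q q' where q: "barred_strip q K L" "barred_strip q' K L'"
    using nz by (auto simp: step_sign_def strip_sign_def split: if_splits)
  have qq: "q = q'"
    using q h unfolding barred_strip_def by (metis linorder_neqE_nat n_not_Suc_n)
  have "height L ` (set (fst L) \<inter> - {q}) = height L ` (set (fst L') \<inter> - {q})"
    using q h unfolding qq by (simp add: barred_strip_def Diff_eq)
  from same_height_circles[OF h this] have "set (fst L) = set (fst L')"
    using q unfolding qq barred_strip_def by blast
  then show ?thesis using sp h by (intro superpartition_eqI) auto
qed

lemma box_labels_inj:
  assumes T: "tableau L \<alpha> Ls" and T': "tableau L \<alpha> Ls'" and eq: "box_labels \<alpha> Ls = box_labels \<alpha> Ls'"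
  shows "Ls = Ls'"
proof (rule nth_equalityI)
  show "length Ls = length Ls'" using T T' by (simp add: tableau_def)
  fix i assume "i < length Ls"
  then have "i \<le> length \<alpha>" using T by (simp add: tableau_def)
  then show "Ls ! i = Ls' ! i"
  proof (induction i)
    case 0
    then show ?case using T T' by (simp add: tableau_def)
  next
    case (Suc i)
    then have i: "i < length \<alpha>" and IH: "Ls ! i = Ls' ! i" by auto
    have D: "boxes (Ls ! Suc i) - boxes (Ls ! i) = boxes (Ls' ! Suc i) - boxes (Ls' ! i)"
      using box_label_iff[OF T] box_label_iff[OF T'] i unfolding eq by blast
    have "boxes (Ls ! Suc i) = boxes (Ls' ! Suc i)"
      using tableau_boxes_mono[OF T, of i "Suc i"] tableau_boxes_mono[OF T', of i "Suc i"] i D IH by auto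
    then have "t < height (Ls ! Suc i) c \<longleftrightarrow> t < height (Ls' ! Suc i) c" for t c
      by (auto simp: boxes_eq set_eq_iff)
    then have "height (Ls ! Suc i) = height (Ls' ! Suc i)"
      by (metis ext linorder_neqE_nat less_irrefl)
    moreover have "step_sign (Ls ! i) (Ls' ! Suc i) (\<alpha> ! i) \<noteq> 0"
      using tableauD(3)[OF T' i] IH by simp
    ultimately show ?case
      using tableau_step_determ[OF tableauD(1)[OF T] tableauD(1)[OF T] tableauD(1)[OF T'] _ tableauD(3)[OF T i]] i
      by simp
  qed
qed

section \<open>Independence of trailing zero weights\<close>

definition filling_of :: "weight list \<Rightarrow> spart list \<Rightarrow> filling" where
  "filling_of \<alpha> Ls = (box_labels \<alpha> Ls, circle_labels \<alpha> Ls (length \<alpha>))"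

lemma circle_labels_append:
  "k \<le> length \<alpha> \<Longrightarrow> length Ls = Suc (length \<alpha>) \<Longrightarrow>
    circle_labels (\<alpha> @ \<beta>) (Ls @ Ms) k = circle_labels \<alpha> Ls k"
proof (induction k)
  case (Suc k)
  then have "(Ls @ Ms) ! k = Ls ! k" "(Ls @ Ms) ! Suc k = Ls ! Suc k" "(\<alpha> @ \<beta>) ! k = \<alpha> ! k"
    by (simp_all add: nth_append)
  with Suc show ?case by (simp only: circle_labels.simps)
qed simp

text \<open>Such a step is stationary, so appending it changes no filling; this allows weight
  sequences of any sufficiently large common length.\<close>

lemma Plain_zero_step:
  assumes "superpartition K" "superpartition L"
  shows "tableau_step K L (Plain 0) \<longleftrightarrow> K = L"
proof
  assume "tableau_step K L (Plain 0)"
  then have s: "plain_strip K L" "sdegree L = sdegree K"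
    unfolding tableau_step_Plain[OF assms] by simp_all
  have "strip K L" using s by (simp add: plain_strip_def)
  then have "boxes L - boxes K = {}"
    using strip_degree[of K L] s(2) boxes_eq finite_subset[of "boxes L - boxes K" "boxes L"]
    by (simp add: set_box_list[symmetric])
  then have h: "height K = height L"
  proof -
    assume e: "boxes L - boxes K = {}"
    have "height L c \<le> height K c" for c
    proof (rule ccontr)
      assume "\<not> height L c \<le> height K c"
      then have "(height K c, c) \<in> boxes L - boxes K" by (simp add: boxes_eq)
      then show False using e by simp
    qed
    then show ?thesis using \<open>strip K L\<close> by (auto simp: strip_def fun_eq_iff intro: antisym)
  qed
  have "height K ` (set (fst K) \<inter> UNIV) = height K ` (set (fst L) \<inter> UNIV)"
    using s(1) h by (simp add: plain_strip_def)
  from same_height_circles[OF h this] show "K = L"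
    using assms h by (intro superpartition_eqI) auto
next
  assume "K = L"
  then show "tableau_step K L (Plain 0)"
    unfolding tableau_step_Plain[OF assms] by (simp add: plain_strip_def strip_def)
qed

lemma tableau_append_zero:
  assumes "superpartition L"
  shows "tableau L (\<alpha> @ [Plain 0]) Ls \<longleftrightarrow> (\<exists>Ls'. Ls = Ls' @ [L] \<and> tableau L \<alpha> Ls')"
proof
  assume T: "tableau L (\<alpha> @ [Plain 0]) Ls"
  then have len: "length Ls = Suc (Suc (length \<alpha>))" by (simp add: tableau_def)
  then obtain Ls' M where Ls: "Ls = Ls' @ [M]" by (cases Ls rule: rev_cases) auto
  have len': "length Ls' = Suc (length \<alpha>)" using len Ls by simp
  have M: "M = L" using T Ls len' by (simp add: tableau_def nth_append)
  have sp: "superpartition (Ls' ! length \<alpha>)" using T Ls len' by (auto simp: tableau_def)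
  have steps: "tableau_step (Ls ! i) (Ls ! Suc i) ((\<alpha> @ [Plain 0]) ! i)" if "i < length (\<alpha> @ [Plain 0])" for i
    using T that unfolding tableau_def by blast
  have "Ls ! length \<alpha> = Ls' ! length \<alpha>" "Ls ! Suc (length \<alpha>) = L" "(\<alpha> @ [Plain 0]) ! length \<alpha> = Plain 0"
    using len' by (simp_all add: Ls M nth_append)
  with steps[of "length \<alpha>"] have "tableau_step (Ls' ! length \<alpha>) L (Plain 0)" by (simp only: length_append) simp
  then have "Ls' ! length \<alpha> = L" by (rule iffD1[OF Plain_zero_step[OF sp assms]])
  moreover have "tableau_step (Ls' ! i) (Ls' ! Suc i) (\<alpha> ! i)" if "i < length \<alpha>" for i
    using steps[of i] len' that by (simp add: Ls nth_append)
  ultimately have "tableau L \<alpha> Ls'" using T len' Ls by (simp add: tableau_def nth_append)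
  then show "\<exists>Ls'. Ls = Ls' @ [L] \<and> tableau L \<alpha> Ls'" using Ls M by blast
next
  assume "\<exists>Ls'. Ls = Ls' @ [L] \<and> tableau L \<alpha> Ls'"
  then obtain Ls' where Ls: "Ls = Ls' @ [L]" and T: "tableau L \<alpha> Ls'" by blast
  have len': "length Ls' = Suc (length \<alpha>)" using T by (simp add: tableau_def)
  have "tableau_step (Ls ! i) (Ls ! Suc i) ((\<alpha> @ [Plain 0]) ! i)" if "i < Suc (length \<alpha>)" for i
  proof (cases "i = length \<alpha>")
    case True
    then have "Ls ! i = L" "Ls ! Suc i = L" using T len' by (simp_all add: Ls nth_append tableau_def)
    then show ?thesis using True Plain_zero_step[OF assms assms] by simp
  next
    case False
    then show ?thesis using T len' that by (simp add: Ls nth_append tableau_def)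
  qed
  then show "tableau L (\<alpha> @ [Plain 0]) Ls"
    using T len' assms by (simp add: tableau_def Ls nth_append)
qed

lemma filling_of_append_zero:
  assumes L: "superpartition L" and T: "tableau L \<alpha> Ls"
  shows "filling_of (\<alpha> @ [Plain 0]) (Ls @ [L]) = filling_of \<alpha> Ls"
proof -
  have len: "length Ls = Suc (length \<alpha>)" and last: "Ls ! length \<alpha> = L" using T by (auto simp: tableau_def)
  have T': "tableau L (\<alpha> @ [Plain 0]) (Ls @ [L])" using T tableau_append_zero[OF L] by blast
  have "box_labels (\<alpha> @ [Plain 0]) (Ls @ [L]) q = Some i \<longleftrightarrow> box_labels \<alpha> Ls q = Some i" for q i
    unfolding box_label_iff[OF T] box_label_iff[OF T']
    using len last by (auto simp: nth_append less_Suc_eq)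
  then have "box_labels (\<alpha> @ [Plain 0]) (Ls @ [L]) = box_labels \<alpha> Ls"
    by (intro ext) (metis not_Some_eq)
  moreover have "circle_labels (\<alpha> @ [Plain 0]) (Ls @ [L]) (length (\<alpha> @ [Plain 0])) = circle_labels \<alpha> Ls (length \<alpha>)"
    using circle_labels_append[of "length \<alpha>" \<alpha> Ls "[Plain 0]" "[L]"] len by simp
  ultimately show ?thesis by (simp add: filling_of_def)
qed

lemma fillings_weights_Suc:
  assumes L: "superpartition L" and n: "set w \<union> I \<subseteq> {..<n}"
  shows "filling_of (weights w I (Suc n)) ` {Ls. tableau L (weights w I (Suc n)) Ls} =
    filling_of (weights w I n) ` {Ls. tableau L (weights w I n) Ls}"
proof -
  have "n \<notin> I" "n \<notin> set w" using n by auto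
  then have W: "weights w I (Suc n) = weights w I n @ [Plain 0]" by (simp add: weights_Suc count_notin)
  have set: "{Ls. tableau L (weights w I n @ [Plain 0]) Ls} = (\<lambda>Ls. Ls @ [L]) ` {Ls. tableau L (weights w I n) Ls}"
    unfolding tableau_append_zero[OF L] by blast
  show ?thesis
    unfolding W set image_image by (intro image_cong refl) (simp add: filling_of_append_zero[OF L])
qed

lemma fillings_weights_eq:
  assumes "superpartition L" "set w \<union> I \<subseteq> {..<n}" "set w \<union> I \<subseteq> {..<n'}"
  shows "filling_of (weights w I n) ` {Ls. tableau L (weights w I n) Ls} =
    filling_of (weights w I n') ` {Ls. tableau L (weights w I n') Ls}"
proof -
  have "filling_of (weights w I b) ` {Ls. tableau L (weights w I b) Ls} =
    filling_of (weights w I a) ` {Ls. tableau L (weights w I a) Ls}"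
    if "a \<le> b" "set w \<union> I \<subseteq> {..<a}" for a b
    using that(1)
  proof (induction b rule: dec_induct)
    case (step b)
    have "set w \<union> I \<subseteq> {..<b}" using that(2) step.hyps by auto
    then show ?case using fillings_weights_Suc[OF assms(1)] step.IH by simp
  qed simp
  then show ?thesis using assms(2,3) by (metis nat_le_linear)
qed

text \<open>The circle labels tell which steps are barred and the multiplicities of the box labels
  give their sizes, so a filling determines its weight up to trailing zeros.\<close>

lemma fillings_with_content:
  assumes L: "superpartition L" and n: "set w \<union> I \<subseteq> {..<n}"
  shows "{T \<in> sSSYT L. set (snd T) = I \<and> mset (content L T) = mset w} =
    filling_of (weights w I n) ` {Ls. tableau L (weights w I n) Ls}" (is "?A = ?B")
proof (intro set_eqI iffI)
  fix T assume "T \<in> ?B"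
  then obtain Ls where T: "tableau L (weights w I n) Ls" and eq: "T = filling_of (weights w I n) Ls" by auto
  have "T \<in> sSSYT L" unfolding eq filling_of_def sSSYT_def using T by blast
  moreover have "set (snd T) = I"
    using circle_labels_props[OF T order_refl] n by (auto simp: eq filling_of_def nth_weights split: if_splits)
  moreover have "mset (content L T) = mset w"
  proof (rule multiset_eqI)
    fix i
    have "i \<notin> set w" if "\<not> i < n" using n that by auto
    then show "count (mset (content L T)) i = count (mset w) i"
      unfolding count_mset eq filling_of_def count_content_tableau[OF T]
      by (auto simp: nth_weights count_notin)
  qed
  ultimately show "T \<in> ?A" by simp
next
  fix T assume "T \<in> ?A"
  then obtain \<alpha> Ls where T: "tableau L \<alpha> Ls" and eq: "T = filling_of \<alpha> Ls"
    and I: "set (snd T) = I" and w: "mset (content L T) = mset w"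
    by (auto simp: sSSYT_def filling_of_def)
  have I': "I = {i. i < length \<alpha> \<and> barred (\<alpha> ! i)}"
    using circle_labels_props[OF T order_refl] I by (simp add: eq filling_of_def)
  have cnt: "count_list w i = (if i < length \<alpha> then weight_abs (\<alpha> ! i) else 0)" for i
    using count_content_tableau[OF T] w by (metis count_mset eq filling_of_def)
  have \<alpha>: "\<alpha> = weights w I (length \<alpha>)"
  proof (rule nth_equalityI)
    fix i assume i: "i < length \<alpha>"
    show "\<alpha> ! i = weights w I (length \<alpha>) ! i"
      using i by (cases "\<alpha> ! i") (simp_all add: nth_weights cnt I')
  qed simp
  have "set w \<subseteq> {..<length \<alpha>}"
    using cnt by (metis count_list_0_iff lessThan_iff subsetI)
  then have "set w \<union> I \<subseteq> {..<length \<alpha>}" using I' by auto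
  from fillings_weights_eq[OF L n this] T eq \<alpha> show "T \<in> ?B" by auto
qed

text \<open>For a fixed weight the tableaux inject into the fillings, so the signed sum over
  fillings is a signed sum over chains. The free bound \<open>n\<close> permits the same length for
  a monomial and its image under a transposition.\<close>

lemma coeff_schur:
  assumes L: "superpartition L" and n: "set w \<union> I \<subseteq> {..<n}"
  shows "coeff (schur L) w I = of_nat (stabilizer_size w) * of_int (walk_sum L (weights w I n) ([], []) L)"
proof -
  let ?\<alpha> = "weights w I n"
  let ?A = "{T \<in> sSSYT L. set (snd T) = I \<and> mset (content L T) = mset w}"
  let ?c = "\<lambda>T. coeff (tableau_term L T) w I"
  have A: "?A = filling_of ?\<alpha> ` {Ls. tableau L ?\<alpha> Ls}" by (rule fillings_with_content[OF L n])
  have fin: "finite ?A" unfolding A using finite_tableaux[OF L] by simp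
  have inj: "inj_on (filling_of ?\<alpha>) {Ls. tableau L ?\<alpha> Ls}"
    by (rule inj_onI) (auto simp: filling_of_def intro: box_labels_inj)
  have "coeff (schur L) w I = (\<Sum>T\<in>{T \<in> sSSYT L. ?c T \<noteq> 0}. ?c T)"
    unfolding schur_def by (rule coeff_formal_sum[OF summable_schur])
  also have "\<dots> = (\<Sum>T\<in>?A. ?c T)"
    by (intro sum.mono_neutral_left fin) (auto simp: coeff_tableau_term_eq)
  also have "\<dots> = (\<Sum>T\<in>?A. theta_sign (snd T) * of_nat (stabilizer_size w))"
    by (intro sum.cong refl) (simp add: coeff_tableau_term_eq)
  also have "\<dots> = (\<Sum>Ls | tableau L ?\<alpha> Ls. theta_sign (circle_labels ?\<alpha> Ls n)) * of_nat (stabilizer_size w)"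
    unfolding A sum.reindex[OF inj] by (simp add: filling_of_def sum_distrib_right)
  also have "(\<Sum>Ls | tableau L ?\<alpha> Ls. theta_sign (circle_labels ?\<alpha> Ls n)) = of_int (walk_sum L ?\<alpha> ([], []) L)"
    using sum_theta_sign_tableaux[OF L, of ?\<alpha>] by simp
  finally show ?thesis by simp
qed

section \<open>The action of permutations\<close>

lemma perm_sign_adjacent:
  assumes "finite J"
  shows "perm_sign \<langle>k \<leftrightarrow> Suc k\<rangle> J = (if k \<in> J \<and> Suc k \<in> J then - 1 else 1)"
proof -
  let ?p = "\<langle>k \<leftrightarrow> Suc k\<rangle>"
  have "i < j \<and> ?p \<langle>$\<rangle> j < ?p \<langle>$\<rangle> i \<longleftrightarrow> i = k \<and> j = Suc k" for i j
    by (cases "i = k"; cases "i = Suc k"; cases "j = k"; cases "j = Suc k") auto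
  then have "perm_sign ?p J = (\<Prod>i\<in>J. \<Prod>j\<in>J. if i = k \<and> j = Suc k then - 1 else 1)"
    by (simp add: perm_sign_def)
  also have "\<dots> = (\<Prod>i\<in>J. if i = k then (\<Prod>j\<in>J. if j = Suc k then - 1 else 1) else 1)"
    by (intro prod.cong refl) simp
  also have "\<dots> = (if k \<in> J \<and> Suc k \<in> J then - 1 else 1)"
    using assms by (simp add: prod.delta)
  finally show ?thesis .
qed

lemma swap_swap: "\<langle>a \<leftrightarrow> b\<rangle> \<langle>$\<rangle> (\<langle>a \<leftrightarrow> b\<rangle> \<langle>$\<rangle> c) = c"
  by (metis apply_inverse_apply(1) inverse_swap)

lemma in_swap_image: "c \<in> apply \<langle>a \<leftrightarrow> b\<rangle> ` I \<longleftrightarrow> \<langle>a \<leftrightarrow> b\<rangle> \<langle>$\<rangle> c \<in> I"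
  by (auto simp: swap_swap intro: rev_image_eqI[of "\<langle>a \<leftrightarrow> b\<rangle> \<langle>$\<rangle> c"])

lemma weights_adjacent:
  fixes p k defines "p \<equiv> \<langle>k \<leftrightarrow> Suc k\<rangle>"
  assumes "Suc k < n"
  obtains ws ws' where
    "weights w I n = ws @ weights w I n ! k # weights w I n ! Suc k # ws'"
    "weights (map (apply p) w) (apply p ` I) n = ws @ weights w I n ! Suc k # weights w I n ! k # ws'"
proof -
  define g where "g i = (if i \<in> I then Barred else Plain) (count_list w i)" for i
  have g': "(if i \<in> apply p ` I then Barred else Plain) (count_list (map (apply p) w) i) = g (p \<langle>$\<rangle> i)" for i
  proof -
    have pp: "p \<langle>$\<rangle> (p \<langle>$\<rangle> i) = i" for i by (simp add: p_def swap_swap)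
    have "i \<in> apply p ` I \<longleftrightarrow> p \<langle>$\<rangle> i \<in> I" by (simp only: p_def in_swap_image)
    moreover have "count_list (map (apply p) w) i = count_list w (p \<langle>$\<rangle> i)"
      by (induction w) (auto simp: pp)
    ultimately show ?thesis by (simp add: g_def)
  qed
  have upt: "[0..<n] = [0..<k] @ k # Suc k # [Suc (Suc k)..<n]"
    using upt_add_eq_append[of 0 k "n - k"] assms(2) by (simp add: upt_conv_Cons)
  have W: "weights w I n = map g [0..<n]" "weights (map (apply p) w) (apply p ` I) n = map (\<lambda>i. g (p \<langle>$\<rangle> i)) [0..<n]"
    unfolding weights_def g' by (simp_all add: g_def)
  have same: "map (\<lambda>i. g (p \<langle>$\<rangle> i)) [0..<k] = map g [0..<k]"
    "map (\<lambda>i. g (p \<langle>$\<rangle> i)) [Suc (Suc k)..<n] = map g [Suc (Suc k)..<n]"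
    by (auto simp: p_def)
  have nth: "weights w I n ! k = g k" "weights w I n ! Suc k = g (Suc k)" using assms(2) by (simp_all add: W)
  show ?thesis
    by (rule that[of "map g [0..<k]" "map g [Suc (Suc k)..<n]"])
       (unfold nth, unfold W upt, simp_all add: same, simp_all add: p_def)
qed

text \<open>Exchanging the two weights costs \<open>swap_sign\<close>, and reordering the two thetas
  costs the same sign, so they cancel; relabelling does not affect the stabilizer.\<close>

lemma act_adjacent_schur:
  assumes L: "superpartition L"
  shows "act \<langle>k \<leftrightarrow> Suc k\<rangle> (schur L) = schur L"
proof (rule superseries_eqI)
  fix w I
  let ?p = "\<langle>k \<leftrightarrow> Suc k\<rangle>"
  show "coeff (act ?p (schur L)) w I = coeff (schur L) w I"
  proof (cases "finite I")
    case True
    define n where "n = Suc (Max (insert (Suc k) (set w \<union> I \<union> set (map (apply ?p) w) \<union> apply ?p ` I)))"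
    have lt: "i < n" if "i \<in> insert (Suc k) (set w \<union> I \<union> set (map (apply ?p) w) \<union> apply ?p ` I)" for i
      unfolding n_def using that True by (intro le_imp_less_Suc Max_ge) auto
    obtain ws ws' where W: "weights w I n = ws @ weights w I n ! k # weights w I n ! Suc k # ws'"
      "weights (map (apply ?p) w) (apply ?p ` I) n = ws @ weights w I n ! Suc k # weights w I n ! k # ws'"
      by (rule weights_adjacent[of k n w I]) (use lt in auto)
    have sp: "superpartition ([], [])" by (simp add: superpartition_def)
    let ?s = "swap_sign (barred (weights w I n ! Suc k)) (barred (weights w I n ! k))"
    have bar: "barred (weights w I n ! i) \<longleftrightarrow> i \<in> I" if "i < n" for i
      using that by (simp add: nth_weights)
    have s: "?s = (if k \<in> I \<and> Suc k \<in> I then - 1 else 1)"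
      using lt[of "Suc k"] by (simp add: swap_sign_def bar)
    have "coeff (act ?p (schur L)) w I = perm_sign ?p (apply ?p ` I) * coeff (schur L) (map (apply ?p) w) (apply ?p ` I)"
      by (simp add: act.rep_eq)
    also have "coeff (schur L) (map (apply ?p) w) (apply ?p ` I) =
       of_nat (stabilizer_size w) * of_int (walk_sum L (ws @ weights w I n ! Suc k # weights w I n ! k # ws') ([], []) L)"
      unfolding W(2)[symmetric] using coeff_schur[OF L, of "map (apply ?p) w" "apply ?p ` I" n] lt
      by (auto simp: stabilizer_size_map)
    also have "walk_sum L (ws @ weights w I n ! Suc k # weights w I n ! k # ws') ([], []) L =
        ?s * walk_sum L (weights w I n) ([], []) L"
      by (subst W(1)) (rule walk_sum_swap[OF sp])
    also have "perm_sign ?p (apply ?p ` I) = of_int ?s"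
      unfolding s using True by (subst perm_sign_adjacent) (auto simp: in_swap_image)
    also have "of_int ?s * (of_nat (stabilizer_size w) * of_int (?s * walk_sum L (weights w I n) ([], []) L)) =
        coeff (schur L) w I"
    proof -
      have "set w \<union> I \<subseteq> {..<n}" using lt by blast
      from coeff_schur[OF L this] show ?thesis by (simp add: swap_sign_def)
    qed
    finally show ?thesis .
  qed (simp add: coeff_infinite)
qed

section \<open>Reduction to adjacent transpositions\<close>

lemma perm_sign_times:
  assumes "finite J"
  shows "perm_sign (p * q) J = perm_sign p (apply q ` J) * perm_sign q J"
proof -
  let ?r = "\<lambda>i j. q \<langle>$\<rangle> i < q \<langle>$\<rangle> j" and ?s = "\<lambda>i j. p \<langle>$\<rangle> (q \<langle>$\<rangle> i) < p \<langle>$\<rangle> (q \<langle>$\<rangle> j)"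
  let ?e = "\<lambda>P. if P then - 1 else 1 :: rat"
  have "perm_sign p (apply q ` J) = (\<Prod>i\<in>J. \<Prod>j\<in>J. ?e (?r i j \<and> ?s j i))"
    by (simp add: perm_sign_def prod.reindex)
  \<comment> \<open>Each pair is sorted by its own order as well. Once the indices of the second
    product are exchanged, all products run over \<open>i < j\<close>, and an inversion of
    \<open>p * q\<close> is a pair reversed at exactly one of the two stages.\<close>
  also have "\<dots> = (\<Prod>i\<in>J. \<Prod>j\<in>J. ?e (i < j \<and> ?r i j \<and> ?s j i) * ?e (j < i \<and> ?r i j \<and> ?s j i))"
    by (intro prod.cong refl) auto
  also have "\<dots> = (\<Prod>i\<in>J. \<Prod>j\<in>J. ?e (i < j \<and> ?r i j \<and> ?s j i)) * (\<Prod>i\<in>J. \<Prod>j\<in>J. ?e (j < i \<and> ?r i j \<and> ?s j i))"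
    by (simp add: prod.distrib)
  also have "(\<Prod>i\<in>J. \<Prod>j\<in>J. ?e (j < i \<and> ?r i j \<and> ?s j i)) = (\<Prod>i\<in>J. \<Prod>j\<in>J. ?e (i < j \<and> ?r j i \<and> ?s i j))"
    by (rule prod.swap)
  finally have "perm_sign p (apply q ` J) * perm_sign q J =
     (\<Prod>i\<in>J. \<Prod>j\<in>J. ?e (i < j \<and> ?r i j \<and> ?s j i) * ?e (i < j \<and> ?r j i \<and> ?s i j) * ?e (i < j \<and> ?r j i))"
    by (simp add: perm_sign_def prod.distrib)
  also have "\<dots> = (\<Prod>i\<in>J. \<Prod>j\<in>J. ?e (i < j \<and> ?s j i))"
  proof (intro prod.cong refl)
    fix i j :: nat
    have "?r i j \<or> ?r j i \<or> i = j" "?s i j \<or> ?s j i \<or> i = j"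
      by (metis apply_inj linorder_neqE_nat)+
    then show "?e (i < j \<and> ?r i j \<and> ?s j i) * ?e (i < j \<and> ?r j i \<and> ?s i j) * ?e (i < j \<and> ?r j i) = ?e (i < j \<and> ?s j i)"
      by auto
  qed
  also have "\<dots> = perm_sign (p * q) J" by (simp add: perm_sign_def apply_times)
  finally show ?thesis by simp
qed

lemma act_compose: "act (p * q) f = act p (act q f)"
proof (rule superseries_eqI)
  fix w I
  show "coeff (act (p * q) f) w I = coeff (act p (act q f)) w I"
  proof (cases "finite I")
    case True
    let ?J = "apply (inverse q) ` apply (inverse p) ` I"
    have J: "apply (inverse (p * q)) ` I = ?J" "map (apply (inverse (p * q))) w = map (apply (inverse q)) (map (apply (inverse p)) w)"
      by (simp_all add: apply_times image_comp)
    have "apply q ` ?J = apply (inverse p) ` I" by (simp add: image_image)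
    then have "perm_sign (p * q) ?J = perm_sign p (apply (inverse p) ` I) * perm_sign q ?J"
      using perm_sign_times[of ?J p q] True by simp
    then show ?thesis unfolding act.rep_eq J by simp
  qed (simp add: coeff_infinite)
qed

lemma act_1: "act 1 f = f"
proof -
  have "perm_sign 1 I = 1" for I
    unfolding perm_sign_def by (intro prod.neutral ballI) simp
  then show ?thesis by (intro superseries_eqI) (simp add: act.rep_eq)
qed

text \<open>Composing with the transposition of \<open>a\<close> and its image fixes
  \<open>a\<close> and so shrinks the support; a transposition is reached from adjacent ones by
  repeated conjugation.\<close>

lemma perm_induct_adjacent:
  fixes p :: "nat perm"
  assumes one: "P 1" and times: "\<And>p q. P p \<Longrightarrow> P q \<Longrightarrow> P (p * q)" and adj: "\<And>k. P \<langle>k \<leftrightarrow> Suc k\<rangle>"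
  shows "P p"
proof -
  have swap: "P \<langle>a \<leftrightarrow> b\<rangle>" if "a < b" for a b
    using that
  proof (induction b)
    case (Suc b)
    show ?case
    proof (cases "a = b")
      case True
      then show ?thesis using adj by simp
    next
      case False
      then have ab: "a < b" using Suc.prems by simp
      have "\<langle>a \<leftrightarrow> Suc b\<rangle> = \<langle>b \<leftrightarrow> Suc b\<rangle> * \<langle>a \<leftrightarrow> b\<rangle> * \<langle>b \<leftrightarrow> Suc b\<rangle>"
      proof (rule perm_eqI)
        fix c show "\<langle>a \<leftrightarrow> Suc b\<rangle> \<langle>$\<rangle> c = (\<langle>b \<leftrightarrow> Suc b\<rangle> * \<langle>a \<leftrightarrow> b\<rangle> * \<langle>b \<leftrightarrow> Suc b\<rangle>) \<langle>$\<rangle> c"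
          using ab by (cases "c = a"; cases "c = b"; cases "c = Suc b") (auto simp: apply_times)
      qed
      then show ?thesis using times adj Suc.IH[OF ab] by simp
    qed
  qed simp
  have swap: "P \<langle>a \<leftrightarrow> b\<rangle>" for a b
    using swap[of a b] swap[of b a] one by (cases a b rule: linorder_cases) (auto simp: swap_sym)
  show ?thesis
  proof (induction "card (affected p)" arbitrary: p rule: less_induct)
    case less
    show ?case
    proof (cases "p = 1")
      case False
      then obtain a where a: "a \<in> affected p" by (metis affected_empty_iff ex_in_conv)
      let ?q = "\<langle>a \<leftrightarrow> p \<langle>$\<rangle> a\<rangle> * p"
      have "affected ?q \<subseteq> affected p - {a}"
      proof
        fix c assume "c \<in> affected ?q"
        then have c: "\<langle>a \<leftrightarrow> p \<langle>$\<rangle> a\<rangle> \<langle>$\<rangle> (p \<langle>$\<rangle> c) \<noteq> c" by (simp add: in_affected apply_times)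
        then have "c \<noteq> a" by auto
        moreover have "c \<in> affected p"
        proof (rule ccontr)
          assume "c \<notin> affected p"
          then have pc: "p \<langle>$\<rangle> c = c" by (simp add: in_affected)
          then have "c = p \<langle>$\<rangle> a" using c \<open>c \<noteq> a\<close> by (metis apply_swap_same)
          then have "p \<langle>$\<rangle> c = p \<langle>$\<rangle> a" using pc by simp
          then show False using \<open>c \<noteq> a\<close> by (simp add: apply_inj)
        qed
        ultimately show "c \<in> affected p - {a}" by simp
      qed
      then have "affected ?q \<subset> affected p" using a by blast
      then have "P ?q" by (intro less psubset_card_mono) simp_all
      have "p = \<langle>a \<leftrightarrow> p \<langle>$\<rangle> a\<rangle> * ?q" by (simp add: mult.assoc[symmetric])
      then show ?thesis using times[OF swap \<open>P ?q\<close>] by metis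
    qed (simp add: one)
  qed
qed

theorem theorem6p4:
  fixes n m :: nat and \<Lambda> :: spart
  assumes "superpartition_of n m \<Lambda>"
  shows "symmetric (schur \<Lambda>)"
proof -
  have "superpartition \<Lambda>" using assms by (simp add: superpartition_of_def)
  then have "act p (schur \<Lambda>) = schur \<Lambda>" for p
    by (induction p rule: perm_induct_adjacent) (simp_all add: act_1 act_compose act_adjacent_schur)
  then show ?thesis by (simp add: symmetric_def)
qed

end
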